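(* Let $\mathtt{A}$ be a finite set, let $X\subset\mathtt{A}^{\mathbb{Z}}$ be an irreducible sofic shift, and let $\Phi$ be an absolutely summable potential on $X$. Then every equilibrium measure for $\Phi$ is a weak Gibbs measure; that is, if $\nu\in M_1(X,T)$ is an equilibrium measure for $\varphi_\Phi$ (equivalently, a tangent functional to the pressure at $\varphi_\Phi$), then $\nu$ is a weak Gibbs measure for $\psi=\varphi_\Phi-P(\varphi_\Phi)$.
   Context: $\mathtt{A}^{\mathbb{Z}}$ has the product topology ($\mathtt{A}$ discrete), and $\mathbb{Z}$ acts by $(T^jx)(k):=x(k+j)$. A shift space is a closed $T$-invariant subset of $\mathtt{A}^{\mathbb{Z}}$. An irreducible sofic shift is a shift space $X$ for which there exist a finite directed graph $G=(V,E)$ that is irreducible (for any two vertices $P,Q\in V$ there is a directed path from $P$ to $Q$) and a labeling $\mathcal{L}:E\to\mathtt{A}$ such that $x\in X$ if and only if there is a bi-infinite path $(e(k))_{k\in\mathbb{Z}}$ on $G$ with $x(k)=\mathcal{L}(e(k))$ for all $k\in\mathbb{Z}$. $C(X)$ is the space of real continuous functions on $X$ with sup-norm $\|\cdot\|_\infty$; $M_1(X,T)$ is the set of $T$-invariant Borel probability measures on $X$. $\Lambda_m:=\{-m,\ldots,m\}$; $J_\Lambda(x):=(x(k):k\in\Lambda)$; $X_n:=J_{\Lambda_n}(X)$. An absolutely summable potential is a family $\Phi=\{\Phi_A\}$ of continuous functions $\Phi_A:X\to\mathbb{R}$ indexed by the finite subsets $A\subset\mathbb{Z}$ such that $\Phi_A(x)=\Phi_A(y)$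 whenever $J_A(x)=J_A(y)$, $\Phi_A\circ T^a=\Phi_{A+a}$ for all $a\in\mathbb{Z}$, and $\|\Phi\|:=\sum_{A\ni0}\|\Phi_A\|_\infty<\infty$. Put $\varphi_\Phi:=\sum_{A\ni0}\Phi_A/|A|\in C(X)$. $P(\psi)$, for $\psi\in C(X)$, is the usual topological pressure, $P(\psi)=\lim_{n\to\infty}\frac1{|\Lambda_n|}\ln\sum_{u\in X_n}\sup\{\exp\sum_{k\in\Lambda_n}\psi(T^kx):x\in X,\ J_{\Lambda_n}(x)=u\}$. A measure $\nu\in M_1(X,T)$ is an equilibrium measure for $\varphi\in C(X)$ if $h(\nu)+\int\varphi\,d\nu=P(\varphi)$, where $h(\nu)$ is the Kolmogorov–Sinai entropy of $\nu$ for the shift. It is a tangent functional to the pressure at $\varphi$ if $P(\varphi+f)\ge P(\varphi)+\int f\,d\nu$ for all $f\in C(X)$. In this setting the two notions coincide. Let $B_m(x):=\{y\in X:J_{\Lambda_m}(y)=J_{\Lambda_m}(x)\}$. A Borel probability measure $\nu$ on $X$ is a weak Gibbs measure for $\psi\in C(X)$ if for every $\delta>0$ there is $N_\delta$ such that for all $m\ge N_\delta$, $\sup_{x\in X}\big|\frac1{|\Lambda_m|}\ln\nu(B_m(x))-\frac1{|\Lambda_m|}\sum_{j\in\Lambda_m}\psi(T^jx)\big|\le\delta$. *)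

theory Defs
  imports "HOL-Probability.Probability" "Graph_Theory.Graph_Theory"
begin

text \<open>
  The finite alphabet is a type of class \<open>{finite, discrete_topology}\<close>. The library's topology on
  \<open>int \<Rightarrow> 'a\<close> is the product topology, so \<open>closed\<close>, \<open>continuous_on\<close> and \<open>borel\<close> are the
  intended notions on the full shift. Functions on a shift space \<open>X\<close> are total functions of which
  only the values on \<open>X\<close> matter.
\<close>

definition shift :: "int \<Rightarrow> (int \<Rightarrow> 'a) \<Rightarrow> (int \<Rightarrow> 'a)" where
  "shift j x = (\<lambda>k. x (k + j))"

definition shift_space :: "(int \<Rightarrow> 'a::{finite, discrete_topology}) set \<Rightarrow> bool" where
  "shift_space X \<longleftrightarrow> closed X \<and> (\<forall>j. \<forall>x\<in>X. shift j x \<in> X)"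

definition biinfinite_path :: "('v, 'e) pre_digraph \<Rightarrow> (int \<Rightarrow> 'e) \<Rightarrow> bool" where
  "biinfinite_path G e \<longleftrightarrow>
     (\<forall>k. e k \<in> arcs G) \<and> (\<forall>k. head G (e k) = tail G (e (k + 1)))"

text \<open>
  Loops and parallel edges are allowed by \<open>fin_digraph\<close>. As the graph is finite, taking vertices
  and edges to be natural numbers is no restriction.
\<close>

definition irreducible_sofic_shift :: "(int \<Rightarrow> 'a::{finite, discrete_topology}) set \<Rightarrow> bool" where
  "irreducible_sofic_shift X \<longleftrightarrow> shift_space X \<and>
     (\<exists>(G :: (nat, nat) pre_digraph) (L :: nat \<Rightarrow> 'a).
        fin_digraph G \<and> strongly_connected G \<and>
        (\<forall>x. x \<in> X \<longleftrightarrow> (\<exists>e. biinfinite_path G e \<and> (\<forall>k. x k = L (e k)))))"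

definition Lam :: "nat \<Rightarrow> int set" where
  "Lam m = {- int m..int m}"

definition J :: "int set \<Rightarrow> (int \<Rightarrow> 'a) \<Rightarrow> (int \<Rightarrow> 'a)" where
  "J A x = restrict x A"

definition sup_norm :: "'b set \<Rightarrow> ('b \<Rightarrow> real) \<Rightarrow> real" where
  "sup_norm X f = (SUP x\<in>X. \<bar>f x\<bar>)"

definition absolutely_summable_potential ::
    "(int \<Rightarrow> 'a::{finite, discrete_topology}) set \<Rightarrow> (int set \<Rightarrow> (int \<Rightarrow> 'a) \<Rightarrow> real) \<Rightarrow> bool" where
  "absolutely_summable_potential X \<Phi> \<longleftrightarrow>
     (\<forall>A. finite A \<longrightarrow> continuous_on X (\<Phi> A)) \<and>
     (\<forall>A. finite A \<longrightarrow> (\<forall>x\<in>X. \<forall>y\<in>X. J A x = J A y \<longrightarrow> \<Phi> A x = \<Phi> A y)) \<and>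
     (\<forall>A a. finite A \<longrightarrow> (\<forall>x\<in>X. \<Phi> A (shift a x) = \<Phi> ((\<lambda>k. k + a) ` A) x)) \<and>
     (\<lambda>A. sup_norm X (\<Phi> A)) summable_on {A. finite A \<and> 0 \<in> A}"

text \<open>For an absolutely summable potential the pointwise sum is also the sum in \<open>C(X)\<close>.\<close>

definition phi :: "(int set \<Rightarrow> (int \<Rightarrow> 'a) \<Rightarrow> real) \<Rightarrow> (int \<Rightarrow> 'a) \<Rightarrow> real" where
  "phi \<Phi> x = (\<Sum>\<^sub>\<infinity>A\<in>{A. finite A \<and> 0 \<in> A}. \<Phi> A x / real (card A))"

definition pressure ::
    "(int \<Rightarrow> 'a::{finite, discrete_topology}) set \<Rightarrow> ((int \<Rightarrow> 'a) \<Rightarrow> real) \<Rightarrow> real" where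
  "pressure X \<psi> = lim (\<lambda>n. 1 / real (card (Lam n)) *
     ln (\<Sum>u\<in>J (Lam n) ` X.
           Sup {exp (\<Sum>k\<in>Lam n. \<psi> (shift k x)) | x. x \<in> X \<and> J (Lam n) x = u}))"

definition borel_prob_on ::
    "(int \<Rightarrow> 'a::{finite, discrete_topology}) set \<Rightarrow> (int \<Rightarrow> 'a) measure \<Rightarrow> bool" where
  "borel_prob_on X \<nu> \<longleftrightarrow> prob_space \<nu> \<and> space \<nu> = X \<and> sets \<nu> = sets (restrict_space borel X)"

definition invariant_measures ::
    "(int \<Rightarrow> 'a::{finite, discrete_topology}) set \<Rightarrow> (int \<Rightarrow> 'a) measure set" where
  "invariant_measures X = {\<nu>. borel_prob_on X \<nu> \<and> (\<forall>j. distr \<nu> \<nu> (shift j) = \<nu>)}"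

definition finite_partitions :: "'b measure \<Rightarrow> 'b set set set" where
  "finite_partitions M = {\<xi>. finite \<xi> \<and> \<xi> \<subseteq> sets M \<and> partition_on (space M) \<xi>}"

definition partition_entropy :: "'b measure \<Rightarrow> 'b set set \<Rightarrow> real" where
  "partition_entropy M \<xi> = - (\<Sum>C\<in>\<xi>. measure M C * ln (measure M C))"

text \<open>
  The join of the partitions \<open>T\<^sup>-\<^sup>i \<xi>\<close> for \<open>i < n\<close>; it may additionally contain the empty set, which
  does not contribute to the entropy.
\<close>

definition iterated_join :: "'b measure \<Rightarrow> ('b \<Rightarrow> 'b) \<Rightarrow> 'b set set \<Rightarrow> nat \<Rightarrow> 'b set set" where
  "iterated_join M T \<xi> n =
     {{x \<in> space M. \<forall>i<n. (T ^^ i) x \<in> c i} | c. \<forall>i<n. c i \<in> \<xi>}"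

definition ks_entropy :: "'b measure \<Rightarrow> ('b \<Rightarrow> 'b) \<Rightarrow> ereal" where
  "ks_entropy M T =
     (SUP \<xi>\<in>finite_partitions M.
        ereal (lim (\<lambda>n. partition_entropy M (iterated_join M T \<xi> n) / real n)))"

definition equilibrium_measure ::
    "(int \<Rightarrow> 'a::{finite, discrete_topology}) set \<Rightarrow> ((int \<Rightarrow> 'a) \<Rightarrow> real) \<Rightarrow>
     (int \<Rightarrow> 'a) measure \<Rightarrow> bool" where
  "equilibrium_measure X \<phi> \<nu> \<longleftrightarrow> \<nu> \<in> invariant_measures X \<and>
     ks_entropy \<nu> (shift 1) + ereal (\<integral>x. \<phi> x \<partial>\<nu>) = ereal (pressure X \<phi>)"

definition tangent_functional ::
    "(int \<Rightarrow> 'a::{finite, discrete_topology}) set \<Rightarrow> ((int \<Rightarrow> 'a) \<Rightarrow> real) \<Rightarrow>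
     (int \<Rightarrow> 'a) measure \<Rightarrow> bool" where
  "tangent_functional X \<phi> \<nu> \<longleftrightarrow> \<nu> \<in> invariant_measures X \<and>
     (\<forall>f. continuous_on X f \<longrightarrow>
        pressure X (\<lambda>x. \<phi> x + f x) \<ge> pressure X \<phi> + (\<integral>x. f x \<partial>\<nu>))"

definition B :: "(int \<Rightarrow> 'a) set \<Rightarrow> nat \<Rightarrow> (int \<Rightarrow> 'a) \<Rightarrow> (int \<Rightarrow> 'a) set" where
  "B X m x = {y \<in> X. J (Lam m) y = J (Lam m) x}"

text \<open>
  The condition that the supremum over \<open>X\<close> is at most \<open>\<delta>\<close> is written pointwise. Positivity of
  \<open>\<nu>(B\<^sub>m(x))\<close> is part of it, since \<open>ln 0\<close> stands for \<open>-\<infinity>\<close> in the definition whereas \<open>ln 0 = 0\<close>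
  in the library.
\<close>

definition weak_gibbs_measure ::
    "(int \<Rightarrow> 'a::{finite, discrete_topology}) set \<Rightarrow> ((int \<Rightarrow> 'a) \<Rightarrow> real) \<Rightarrow>
     (int \<Rightarrow> 'a) measure \<Rightarrow> bool" where
  "weak_gibbs_measure X \<psi> \<nu> \<longleftrightarrow> borel_prob_on X \<nu> \<and>
     (\<forall>\<delta>>0. \<exists>N. \<forall>m\<ge>N. \<forall>x\<in>X. measure \<nu> (B X m x) > 0 \<and>
        \<bar>1 / real (card (Lam m)) * ln (measure \<nu> (B X m x))
          - 1 / real (card (Lam m)) * (\<Sum>j\<in>Lam m. \<psi> (shift j x))\<bar> \<le> \<delta>)"

end

theory Submission
  imports Defs
begin

text \<open>An equilibrium measure is a tangent functional by the variational inequality, so that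
  \<open>P(\<phi> + f) - P(\<phi>) \<ge> \<integral> f d\<nu>\<close> for all \<open>f\<close>; it suffices to use this for multiples \<open>f\<close> of the
  indicator function of a cylinder set \<open>[u]\<close> of length \<open>L\<close>. In an irreducible sofic shift the
  content of a block of length \<open>L\<close> can be replaced by any word, up to a bounded number of symbols
  at its ends and a bounded translation, without changing the configuration outside. Absolute
  summability makes the energy that is exchanged with the outside \<open>o(L)\<close>. Hence in finite volume,
  conditionally on everything outside a block, the word \<open>u\<close> occurs in the block with probability
  \<open>p = exp (S\<^sub>L \<phi>(u) - L P(\<phi>) + o(L))\<close>. For the lower bound on \<open>\<nu>[u]\<close> take \<open>f = - 1\<^bsub>[u]\<^esub>\<close> and
  disjoint blocks, which gives \<open>P(\<phi> + f) \<le> P(\<phi>) - p / (2 L)\<close>; for the upper bound take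
  \<open>f = 1\<^bsub>[u]\<^esub> / L\<close>, which gives \<open>P(\<phi> + f) \<le> P(\<phi>) + 2 p / L\<close>.\<close>

text \<open>The measure \<open>\<nu>\<close> is known only through the pressure, and nothing is
  known about its own conditional probabilities. All estimates are therefore made for finite-volume
  sums, and tangency carries them over to \<open>\<nu>\<close>. A weak Gibbs bound concerns
  exponential rates, so constants and factors \<open>L\<close> may be lost on the way. What may not
  be lost is uniformity in the exterior of a block: the one-block estimates carry an arbitrary
  weight on the exterior, which lets them be multiplied over disjoint blocks. The two choices of
  \<open>f\<close> differ because of their signs. With \<open>f \<le> 0\<close> occurrences may be
  forgotten, so one family of disjoint blocks is enough. With \<open>f \<ge> 0\<close> every
  occurrence counts, overlapping ones included; the factor \<open>1 / L\<close> turns the sum over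
  all positions into an average over \<open>L\<close> families of disjoint positions. The
  translation is forced by the period of the graph: connections of prescribed lengths need not
  exist. The return to the given exterior has to be on time, so the inserted word must give
  way.\<close>

text \<open>Serves two limits, that of the logarithms of partition functions and that of the joint
  entropies: \<open>pressure\<close> and \<open>ks_entropy\<close> are written with
  \<open>lim\<close>, which says something only once convergence is known. The linear lower bound
  keeps the infimum of \<open>a n / n\<close> finite.\<close>

lemma fekete:
  fixes a :: "nat \<Rightarrow> real"
  assumes sub: "\<And>m n. a (m + n) \<le> a m + a n"
    and low: "\<And>n. - (c * real n) \<le> a n"
  shows "convergent (\<lambda>n. a n / real n)"
proof -
  define S where "S = (\<lambda>n. a n / real n) ` {1..}"
  define l where "l = Inf S"
  have bdd: "bdd_below S"
    unfolding S_def
  proof (rule bdd_belowI2)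
    fix n :: nat assume "n \<in> {1..}"
    then show "- c \<le> a n / real n"
      using low[of n] by (simp add: field_simps)
  qed
  have mult: "a (q * n) \<le> real q * a n" if "q \<ge> 1" for q n
    using that
  proof (induction q rule: dec_induct)
    case (step q)
    then show ?case using sub[of n "q * n"] by (simp add: algebra_simps)
  qed simp
  have "(\<lambda>n. a n / real n) \<longlonglongrightarrow> l"
  proof (rule LIMSEQ_I)
    fix r :: real assume "r > 0"
    have "S \<noteq> {}" by (auto simp: S_def)
    then obtain s where "s \<in> S" "s < l + r / 2"
      using cInf_lessD[of S "l + r / 2"] \<open>r > 0\<close> by (auto simp: l_def)
    then obtain n where n: "n \<ge> 1" "a n / real n < l + r / 2"
      by (auto simp: S_def)
    define M where "M = Max ((\<lambda>j. \<bar>a j\<bar>) ` {..<n}) + \<bar>a n\<bar>"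
    have M: "\<bar>a j\<bar> + \<bar>a n\<bar> \<le> M" if "j < n" for j
      using that by (auto simp: M_def)
    have M0: "M \<ge> 0" using M[of 0] n by simp
    obtain N :: nat where N: "real N > 2 * (M + \<bar>l\<bar> * n + r * n) / r"
      using reals_Archimedean2 by blast
    have "\<bar>a k / real k - l\<bar> < r" if k: "k \<ge> N + n" for k
    proof -
      have k0: "k > 0" using k n by simp
      have "k div n \<ge> 1" using k n by (simp add: Suc_leI div_greater_zero_iff)
      have "a k = a (k div n * n + k mod n)" by simp
      also have "\<dots> \<le> a (k div n * n) + a (k mod n)" by (rule sub)
      also have "\<dots> \<le> real (k div n) * a n + a (k mod n)"
        using mult[OF \<open>k div n \<ge> 1\<close>, of n] by simp
      also have "real (k div n) = (real k - real (k mod n)) / real n"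
        using n by (metis (no_types, lifting) add_diff_cancel_right' div_mult_mod_eq 
            nonzero_mult_div_cancel_right of_nat_0_eq_iff of_nat_add of_nat_mult not_one_le_zero)
      also have "(real k - real (k mod n)) / real n * a n
          = real k * (a n / n) - real (k mod n) / n * a n"
        using n by (simp add: field_simps)
      also have "- (real (k mod n) / n * a n) \<le> \<bar>a n\<bar>"
      proof -
        have "\<bar>real (k mod n) / n * a n\<bar> \<le> 1 * \<bar>a n\<bar>"
          unfolding abs_mult using n by (intro mult_right_mono) auto
        then show ?thesis by linarith
      qed
      then have "real k * (a n / n) - real (k mod n) / n * a n + a (k mod n)
          \<le> real k * (a n / n) + M"
        using M[of "k mod n"] n by auto
      finally have "a k \<le> real k * (a n / n) + M" .
      also have "\<dots> < real k * (l + r / 2) + M"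
        using n(2) k0 by (intro add_strict_right_mono mult_strict_left_mono) auto
      also have "M < real k * (r / 2)"
      proof -
        have "2 * (M + \<bar>l\<bar> * n + r * n) / r < real k" using N k by linarith
        then have "2 * (M + \<bar>l\<bar> * n + r * n) < real k * r"
          using \<open>r > 0\<close> by (simp add: field_simps)
        moreover have "\<bar>l\<bar> * n + r * n \<ge> 0" using \<open>r > 0\<close> by simp
        ultimately show ?thesis by (simp add: algebra_simps)
      qed
      finally have "a k < real k * (l + r)" by (simp add: algebra_simps)
      then have up: "a k / real k < l + r" using k0 by (simp add: field_simps)
      have "l \<le> a k / real k"
        unfolding l_def using bdd k0 by (intro cInf_lower) (auto simp: S_def)
      then show ?thesis using up \<open>r > 0\<close> by auto
    qed
    then show "\<exists>no. \<forall>n\<ge>no. norm (a n / real n - l) < r"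
      by auto
  qed
  then show ?thesis by (rule convergentI)
qed

section \<open>Walks in strongly connected graphs and filling of blocks\<close>

text \<open>Powers of this relation record only the length and the two ends of a walk, which is all
  that the timing arguments use.\<close>

definition edge_rel :: "('v, 'e) pre_digraph \<Rightarrow> ('v \<times> 'v) set" where
  "edge_rel G = {(tail G e, head G e) | e. e \<in> arcs G}"

lemma relpow_add_trans:
  assumes "(u, v) \<in> R ^^ m" "(v, w) \<in> R ^^ n"
  shows "(u, w) \<in> R ^^ (m + n)"
  using assms by (auto simp: relpow_add)

text \<open>The witness \<open>g\<close> is the least positive difference of two elements of \<open>S\<close>.\<close>

lemma nat_semigroup_eventually:
  fixes S :: "nat set"
  assumes add: "\<And>m n. m \<in> S \<Longrightarrow> n \<in> S \<Longrightarrow> m + n \<in> S"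
    and ne: "s \<in> S" "s > 0"
  obtains g n0 where "g > 0" "\<And>n. n \<in> S \<Longrightarrow> g dvd n"
    "\<And>n. g dvd n \<Longrightarrow> n \<ge> n0 \<Longrightarrow> n \<in> S"
proof -
  define P where "P d \<longleftrightarrow> d > 0 \<and> (\<exists>m\<in>S. m > 0 \<and> m + d \<in> S)" for d
  have "P s" using ne add by (auto simp: P_def)
  define g where "g = (LEAST d. P d)"
  have "P g" unfolding g_def using \<open>P s\<close> by (rule LeastI)
  have least: "g \<le> d" if "P d" for d unfolding g_def using that by (rule Least_le)
  obtain m where m: "m \<in> S" "m > 0" "m + g \<in> S" and g: "g > 0"
    using \<open>P g\<close> by (auto simp: P_def)
  have mult: "q * x \<in> S" if "x \<in> S" "q \<ge> 1" for q x
    using that(2,1)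
  proof (induction q rule: dec_induct)
    case (step q) then show ?case using add by simp
  qed simp
  have dvd: "g dvd x" if x: "x \<in> S" for x
  proof (rule ccontr)
    assume "\<not> g dvd x"
    then have r: "x mod g > 0" "x mod g < g" using g by (auto simp: dvd_eq_mod_eq_0)
    have "x > 0" using \<open>\<not> g dvd x\<close> by (cases x) auto
    show False
    proof (cases "x div g = 0")
      case True
      then have "x < g" using g by (simp add: div_eq_0_iff)
      moreover have "P x" using x \<open>x > 0\<close> add by (auto simp: P_def)
      ultimately show False using least by fastforce
    next
      case False
      then have q: "x div g \<ge> 1" by simp
      \<comment> \<open>Both \<open>x div g * (m + g)\<close> and \<open>x + x div g * m\<close>
        belong to \<open>S\<close>; their difference \<open>x mod g\<close> is positive and smaller
        than \<open>g\<close>.\<close>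
      have "x div g * (m + g) + x mod g = x + x div g * m"
        by (metis ab_semigroup_add_class.add_ac(1) add.commute div_mult_mod_eq
            distrib_left)
      then have "P (x mod g)"
        using r mult[OF m(3) q] add[OF x mult[OF m(1) q]] q m
        unfolding P_def by (metis add_gr_0 mult_pos_pos zero_less_one order_less_le_trans)
      then show False using least r by fastforce
    qed
  qed
  obtain m' where m': "m = g * m'" using dvd[OF m(1)] by (auto elim: dvdE)
  have m'0: "m' > 0" using m' m by (cases m') auto
  \<comment> \<open>With \<open>n = g * k\<close> and \<open>k = q * m' + r\<close>, the number
    \<open>n = (q - r) * m + r * (m + g)\<close> is a sum of elements of \<open>S\<close> as soon as
    \<open>q > r\<close>. Since \<open>r < m'\<close>, the bound on \<open>n\<close>, which gives
    \<open>q \<ge> m' + 1\<close>, is enough.\<close>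
  have large: "n \<in> S" if n: "g dvd n" "n \<ge> g * (m' * (m' + 1))" for n
  proof -
    obtain k where k: "n = g * k" using n by (auto elim: dvdE)
    then have k_ge: "k \<ge> m' * (m' + 1)" using n g by simp
    define q r where "q = k div m'" and "r = k mod m'"
    have "r < m'" using m'0 by (simp add: r_def)
    have "q \<ge> m' + 1" unfolding q_def using k_ge m'0
      by (simp add: less_eq_div_iff_mult_less_eq mult.commute)
    then have qr: "q - r \<ge> 1" "r \<le> q" using \<open>r < m'\<close> by auto
    have "k = q * m' + r" by (simp add: q_def r_def)
    then have "n = q * m + r * g" using k m' by (simp add: algebra_simps)
    also have "\<dots> = (q - r) * m + r * (m + g)"
    proof -
      obtain c where "q = r + c" using qr(2) le_Suc_ex by blast
      then show ?thesis by (simp add: algebra_simps)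
    qed
    finally have n_eq: "n = (q - r) * m + r * (m + g)" .
    show ?thesis
    proof (cases "r = 0")
      case True
      then show ?thesis using n_eq mult[OF m(1) qr(1)] by simp
    next
      case False
      then have "r \<ge> 1" by simp
      then show ?thesis using n_eq add mult[OF m(1) qr(1)] mult[OF m(3)] by simp
    qed
  qed
  show thesis using that[OF g dvd large] .
qed

lemma strongly_connected_relpow:
  assumes "fin_digraph G" "strongly_connected G" "u \<in> verts G" "v \<in> verts G"
  shows "\<exists>n. (u, v) \<in> edge_rel G ^^ n"
proof -
  have "u \<rightarrow>\<^sup>*\<^bsub>G\<^esub> v" using assms by (auto simp: strongly_connected_def)
  then have "(u, v) \<in> (arcs_ends G)\<^sup>*"
    unfolding reachable_def by (rule rtrancl_on_rtranclI)
  moreover have "arcs_ends G = edge_rel G"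
    by (auto simp: arcs_ends_def edge_rel_def arc_to_ends_def)
  ultimately show ?thesis by (simp add: rtrancl_power)
qed

text \<open>The lengths of closed walks at \<open>r\<close> form an additive semigroup, so up to
  finitely many exceptions they are the multiples of some \<open>g\<close>. Modulo \<open>g\<close>
  all walks from \<open>r\<close> to \<open>q\<close> have the same length, and the two given walks
  from \<open>p\<close> show that \<open>m\<close> lies in this residue class; a walk of length
  exactly \<open>m\<close> then exists for all large \<open>m\<close>. There are finitely many
  vertices, hence one \<open>D\<close> for all of them.\<close>

lemma walk_difference:
  assumes G: "fin_digraph G" "strongly_connected G"
  obtains D where
    "\<And>u v. u \<in> verts G \<Longrightarrow> v \<in> verts G \<Longrightarrow> \<exists>l\<le>D. (u, v) \<in> edge_rel G ^^ l"
    "\<And>p q r m n. p \<in> verts G \<Longrightarrow> q \<in> verts G \<Longrightarrow> r \<in> verts G \<Longrightarrow>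
       (p, r) \<in> edge_rel G ^^ n \<Longrightarrow> (p, q) \<in> edge_rel G ^^ (n + m) \<Longrightarrow> m \<ge> D \<Longrightarrow>
       (r, q) \<in> edge_rel G ^^ m"
proof -
  interpret fin_digraph G by (rule G)
  let ?R = "edge_rel G"
  let ?V = "verts G"
  have fV: "finite ?V" by simp
  define len where "len u v = (LEAST n. (u, v) \<in> ?R ^^ n)" for u v
  have len: "(u, v) \<in> ?R ^^ len u v" if "u \<in> ?V" "v \<in> ?V" for u v
    unfolding len_def using strongly_connected_relpow[OF G that] by (rule LeastI_ex)
  define D1 where "D1 = Max ((\<lambda>(u, v). len u v) ` (?V \<times> ?V))"
  have D1: "len u v \<le> D1" if "u \<in> ?V" "v \<in> ?V" for u v
    unfolding D1_def using fV that by (intro Max_ge) auto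
  have "\<exists>N. \<forall>p q n m. p \<in> ?V \<longrightarrow> q \<in> ?V \<longrightarrow>
       (p, r) \<in> ?R ^^ n \<longrightarrow> (p, q) \<in> ?R ^^ (n + m) \<longrightarrow> m \<ge> N \<longrightarrow> (r, q) \<in> ?R ^^ m"
    if r: "r \<in> ?V" for r
  proof -
    define S where "S = {n. (r, r) \<in> ?R ^^ n}"
    have add: "m + n \<in> S" if "m \<in> S" "n \<in> S" for m n
      using that relpow_add_trans by (auto simp: S_def)
    show ?thesis
    proof (cases "\<exists>s\<in>S. s > 0")
      \<comment> \<open>Without a closed walk of positive length at \<open>r\<close> the graph is a
        single vertex without arcs. Then \<open>m = 0\<close>, and the bound \<open>1\<close> makes
        the claim vacuous.\<close>
      case False
      have "m = 0" if "p \<in> ?V" "q \<in> ?V" "(p, r) \<in> ?R ^^ n" "(p, q) \<in> ?R ^^ (n + m)" for p q n m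
      proof -
        have "(r, r) \<in> ?R ^^ (len r p + (n + m) + len q r)"
          using len[OF r that(1)] len[OF that(2) r] that(4) by (blast intro: relpow_add_trans)
        then show ?thesis using False by (auto simp: S_def)
      qed
      then show ?thesis by (intro exI[of _ 1]) fastforce
    next
      case True
      then obtain s where "s \<in> S" "s > 0" by auto
      then obtain g n0 where g: "g > 0" "\<And>n. n \<in> S \<Longrightarrow> g dvd n"
          "\<And>n. g dvd n \<Longrightarrow> n \<ge> n0 \<Longrightarrow> n \<in> S"
        using nat_semigroup_eventually[of S s] add by metis
      have "(r, q) \<in> ?R ^^ m"
        if *: "p \<in> ?V" "q \<in> ?V" "(p, r) \<in> ?R ^^ n" "(p, q) \<in> ?R ^^ (n + m)" "m \<ge> n0 + D1"
        for p q n m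
      proof -
        define c d f where "c = len r p" and "d = len r q" and "f = len q r"
        have c: "(r, p) \<in> ?R ^^ c" and d: "(r, q) \<in> ?R ^^ d" and f: "(q, r) \<in> ?R ^^ f"
          using len r * by (auto simp: c_def d_def f_def)
        \<comment> \<open>Closing the walks up at \<open>r\<close> shows that \<open>g\<close>
          divides \<open>c + n\<close>, \<open>c + n + m + f\<close> and \<open>d + f\<close>, hence
          \<open>m - d\<close>. The required walk makes a loop of length \<open>m - d\<close> at
          \<open>r\<close> and then takes \<open>d\<close> steps to \<open>q\<close>.\<close>
        have "c + n \<in> S" "c + (n + m) + f \<in> S" "d + f \<in> S"
          unfolding S_def using c d f * by (blast intro: relpow_add_trans)+
        then have dv: "g dvd c + n" "g dvd c + (n + m) + f" "g dvd d + f" using g by auto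
        have "d \<le> m" using D1[OF r *(2)] * by (simp add: d_def)
        have "(c + n) + (d + f) + (m - d) = c + (n + m) + f" using \<open>d \<le> m\<close> by simp
        then have "g dvd m - d" using dv by (metis dvd_add dvd_add_right_iff)
        moreover have "m - d \<ge> n0" using D1[OF r *(2)] * by (simp add: d_def)
        ultimately have "(r, r) \<in> ?R ^^ (m - d)" using g by (auto simp: S_def)
        then have "(r, q) \<in> ?R ^^ (m - d + d)" using d by (rule relpow_add_trans)
        then show ?thesis using \<open>d \<le> m\<close> by simp
      qed
      then show ?thesis by blast
    qed
  qed
  then obtain N where N: "\<And>r p q n m. r \<in> ?V \<Longrightarrow> p \<in> ?V \<Longrightarrow> q \<in> ?V \<Longrightarrow>
       (p, r) \<in> ?R ^^ n \<Longrightarrow> (p, q) \<in> ?R ^^ (n + m) \<Longrightarrow> m \<ge> N r \<Longrightarrow> (r, q) \<in> ?R ^^ m"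
    by metis
  define D2 where "D2 = Max (N ` ?V)"
  have D2: "N r \<le> D2" if "r \<in> ?V" for r unfolding D2_def using fV that by auto
  show thesis
  proof (rule that[of "max D1 D2"])
    fix u v assume "u \<in> ?V" "v \<in> ?V"
    then show "\<exists>l\<le>max D1 D2. (u, v) \<in> ?R ^^ l"
      using len D1 by (intro exI[of _ "len u v"]) fastforce
  next
    fix p q r m n
    assume "p \<in> ?V" "q \<in> ?V" "r \<in> ?V" "(p, r) \<in> ?R ^^ n" "(p, q) \<in> ?R ^^ (n + m)"
      "m \<ge> max D1 D2"
    then show "(r, q) \<in> ?R ^^ m" using N[of r p q n m] D2[of r] by auto
  qed
qed

lemma biinfinite_path_relpow:
  assumes "biinfinite_path G e"
  shows "(tail G (e a), tail G (e (a + int n))) \<in> edge_rel G ^^ n"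
proof (induction n)
  case (Suc n)
  have "(tail G (e (a + int n)), tail G (e (a + int n + 1))) \<in> edge_rel G"
    using assms unfolding biinfinite_path_def edge_rel_def by force
  with Suc have "(tail G (e a), tail G (e (a + int n + 1))) \<in> edge_rel G ^^ Suc n"
    by (rule relpow_Suc_I)
  moreover have "a + int n + 1 = a + int (Suc n)" by simp
  ultimately show ?case by metis
qed simp

text \<open>Gluing happens at vertices of the graph and not at symbols: in a sofic shift two points
  that agree on a word cannot in general be spliced there, whereas paths that meet in a vertex can.
  The case \<open>l = 0\<close> is such a meeting.\<close>

lemma biinfinite_path_splice:
  assumes e: "biinfinite_path G e" and f: "biinfinite_path G f"
    and l: "(tail G (e a), tail G (f b)) \<in> edge_rel G ^^ l"
  obtains g where "biinfinite_path G g" "\<And>k. k < a \<Longrightarrow> g k = e k"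
    "\<And>k. k \<ge> a + int l \<Longrightarrow> g k = f (b + k - a - int l)"
proof -
  obtain q where q: "q 0 = tail G (e a)" "q l = tail G (f b)"
      "\<And>i. i < l \<Longrightarrow> (q i, q (Suc i)) \<in> edge_rel G"
    using l by (auto simp: relpow_fun_conv)
  have "\<exists>d. d \<in> arcs G \<and> tail G d = q i \<and> head G d = q (Suc i)" if "i < l" for i
    using q(3)[OF that] by (auto simp: edge_rel_def)
  then obtain d where d: "\<And>i. i < l \<Longrightarrow> d i \<in> arcs G \<and> tail G (d i) = q i \<and> head G (d i) = q (Suc i)"
    by metis
  define g where "g k = (if k < a then e k else if k < a + int l then d (nat (k - a))
      else f (b + k - a - int l))" for k
  have tl: "tail G (g k) = (if k < a then tail G (e k) else if k < a + int l then q (nat (k - a))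
      else tail G (f (b + k - a - int l)))" for k
    using d by (auto simp: g_def)
  have arcs: "g k \<in> arcs G" for k
    using e f d by (auto simp: g_def biinfinite_path_def)
  have "head G (g k) = tail G (g (k + 1))" for k
  proof -
    consider "k + 1 < a" | "k + 1 = a" "l = 0" | "k + 1 = a" "l > 0" | "a \<le> k" "k + 1 < a + int l"
      | "a \<le> k" "k + 1 = a + int l" | "a + int l \<le> k" by linarith
    then show ?thesis
    proof cases
      case 1 then show ?thesis using e by (auto simp: tl g_def biinfinite_path_def)
    next
      case 2
      have "head G (e k) = tail G (e (k + 1))" using e by (auto simp: biinfinite_path_def)
      then show ?thesis using 2 q by (simp add: tl) (simp add: g_def)
    next
      case 3
      have "head G (e k) = tail G (e (k + 1))" using e by (auto simp: biinfinite_path_def)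
      then show ?thesis using 3 q by (simp add: tl) (simp add: g_def)
    next
      case 4
      then have "nat (k + 1 - a) = Suc (nat (k - a))" "nat (k - a) < l" by auto
      then show ?thesis using 4 d[of "nat (k - a)"] by (simp add: tl) (simp add: g_def)
    next
      case 5
      then have "Suc (nat (k - a)) = l" by auto
      then show ?thesis using 5 d[of "nat (k - a)"] q by (simp add: tl) (simp add: g_def)
    next
      case 6
      have "head G (f (b + k - a - int l)) = tail G (f (b + k - a - int l + 1))"
        using f by (auto simp: biinfinite_path_def)
      moreover have "b + k - a - int l + 1 = b + (k + 1) - a - int l" by simp
      ultimately show ?thesis using 6 by (simp add: tl) (simp add: g_def)
    qed
  qed
  then have "biinfinite_path G g" using arcs by (simp add: biinfinite_path_def)
  then show thesis using that by (simp add: g_def)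
qed

text \<open>The shift \<open>s\<close> compensates for the length of the walk that leads from \<open>x\<close> into the path
  presenting \<open>y\<close>, so that the return to \<open>x\<close> has exactly the length \<open>D\<close> that the period of the
  graph permits.\<close>

lemma irreducible_sofic_filling:
  assumes "irreducible_sofic_shift X"
  obtains D :: nat where "\<And>x y a b L. x \<in> X \<Longrightarrow> y \<in> X \<Longrightarrow> L \<ge> 2 * D \<Longrightarrow>
    \<exists>x'\<in>X. \<exists>s\<le>D. (\<forall>k. k < a \<or> k \<ge> a + int L \<longrightarrow> x' k = x k) \<and>
      (\<forall>k. int D \<le> k \<and> k < int L - int D \<longrightarrow> x' (a + k) = y (b + k + int s))"
proof -
  from assms obtain G :: "(nat, nat) pre_digraph" and Lb :: "nat \<Rightarrow> 'a" where
    G: "fin_digraph G" "strongly_connected G"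
    and X: "\<And>x. x \<in> X \<longleftrightarrow> (\<exists>e. biinfinite_path G e \<and> (\<forall>k. x k = Lb (e k)))"
    unfolding irreducible_sofic_shift_def by auto
  interpret fin_digraph G by (rule G)
  obtain D where D1: "\<And>u v. u \<in> verts G \<Longrightarrow> v \<in> verts G \<Longrightarrow> \<exists>l\<le>D. (u, v) \<in> edge_rel G ^^ l"
    and D2: "\<And>p q r m n. p \<in> verts G \<Longrightarrow> q \<in> verts G \<Longrightarrow> r \<in> verts G \<Longrightarrow>
       (p, r) \<in> edge_rel G ^^ n \<Longrightarrow> (p, q) \<in> edge_rel G ^^ (n + m) \<Longrightarrow> m \<ge> D \<Longrightarrow>
       (r, q) \<in> edge_rel G ^^ m"
    using walk_difference[OF G] by blast
  show thesis
  proof (rule that[of D])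
    fix x y :: "int \<Rightarrow> 'a" and a b :: int and L :: nat
    assume "x \<in> X" "y \<in> X" and L: "L \<ge> 2 * D"
    then obtain e f where e: "biinfinite_path G e" "\<And>k. x k = Lb (e k)"
      and f: "biinfinite_path G f" "\<And>k. y k = Lb (f k)" unfolding X by blast
    have tv: "tail G (h k) \<in> verts G" if "biinfinite_path G h" for h k
      using that by (auto simp: biinfinite_path_def)
    \<comment> \<open>Aiming at time \<open>b + D\<close> of \<open>f\<close> and not at time
      \<open>b\<close> makes the translation \<open>s = D - l\<close> nonnegative, whatever the
      length \<open>l\<close> of the connection is.\<close>
    obtain l where l: "l \<le> D" "(tail G (e a), tail G (f (b + int D))) \<in> edge_rel G ^^ l"
      using D1 tv e f by blast
    obtain g where g: "biinfinite_path G g" "\<And>k. k < a \<Longrightarrow> g k = e k"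
        "\<And>k. k \<ge> a + int l \<Longrightarrow> g k = f (b + int D + k - a - int l)"
      using biinfinite_path_splice[OF e(1) f(1) l(2)] by metis
    have c: "a + int (L - D) = a + int L - int D" using L by simp
    have "(tail G (e a), tail G (g (a + int (L - D)))) \<in> edge_rel G ^^ (L - D)"
    proof -
      have "g (a + int (L - D)) = f (b + int D + int (L - D - l))"
        using g(3)[of "a + int (L - D)"] L l by (simp add: algebra_simps of_nat_diff)
      moreover have "(tail G (e a), tail G (f (b + int D + int (L - D - l))))
          \<in> edge_rel G ^^ (l + (L - D - l))"
        using l(2) biinfinite_path_relpow[OF f(1)] by (rule relpow_add_trans)
      moreover have "l + (L - D - l) = L - D" using L l by simp
      ultimately show ?thesis by simp
    qed
    \<comment> \<open>The untouched path \<open>e\<close> itself proves that a walk of length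
      \<open>L\<close> between the end vertices of the block exists; this is what puts
      \<open>D\<close> into the right residue class.\<close>
    moreover have "(tail G (e a), tail G (e (a + int L))) \<in> edge_rel G ^^ (L - D + D)"
      using biinfinite_path_relpow[OF e(1), of a L] L by simp
    ultimately have "(tail G (g (a + int (L - D))), tail G (e (a + int L))) \<in> edge_rel G ^^ D"
      using D2 tv e g by blast
    then obtain h where h: "biinfinite_path G h" "\<And>k. k < a + int (L - D) \<Longrightarrow> h k = g k"
        "\<And>k. k \<ge> a + int (L - D) + int D \<Longrightarrow> h k = e (a + int L + k - (a + int (L - D)) - int D)"
      using biinfinite_path_splice[OF g(1) e(1)] by metis
    define x' where "x' k = Lb (h k)" for k
    have "x' \<in> X" unfolding X x'_def using h(1) by blast
    moreover have "x' k = x k" if "k < a \<or> k \<ge> a + int L" for k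
    proof (cases "k < a")
      case True
      then show ?thesis using h(2)[of k] g(2)[of k] e(2) L by (simp add: x'_def)
    next
      case False
      then show ?thesis using h(3)[of k] that e(2) L by (simp add: x'_def of_nat_diff)
    qed
    moreover have "x' (a + k) = y (b + k + int (D - l))" if "int D \<le> k" "k < int L - int D" for k
      using h(2)[of "a + k"] g(3)[of "a + k"] that l f(2) L
      by (simp add: x'_def algebra_simps of_nat_diff)
    ultimately show "\<exists>x'\<in>X. \<exists>s\<le>D. (\<forall>k. k < a \<or> k \<ge> a + int L \<longrightarrow> x' k = x k) \<and>
      (\<forall>k. int D \<le> k \<and> k < int L - int D \<longrightarrow> x' (a + k) = y (b + k + int s))"
      by (intro bexI[of _ x'] exI[of _ "D - l"]) auto
  qed
qed

section \<open>Partition functions and pressure\<close>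

text \<open>Counting device: a map that is only bounded-to-one is made injective by adding to its
  value the data that are lost, and the sum over these data supplies the multiplicity.\<close>

lemma sum_le_sum_inj_on:
  fixes g :: "'a \<Rightarrow> real" and h :: "'b \<Rightarrow> real"
  assumes "inj_on f A" "f ` A \<subseteq> C" "finite C"
    and "\<And>x. x \<in> A \<Longrightarrow> g x \<le> h (f x)" "\<And>y. y \<in> C \<Longrightarrow> h y \<ge> 0"
  shows "sum g A \<le> sum h C"
proof -
  have "sum g A \<le> sum (\<lambda>x. h (f x)) A" using assms(4) by (rule sum_mono)
  also have "\<dots> = sum h (f ` A)" using assms(1) by (simp add: sum.reindex)
  also have "\<dots> \<le> sum h C" using assms by (intro sum_mono2) auto
  finally show ?thesis .
qed

lemma shift_apply [simp]: "shift j x k = x (k + j)"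
  by (simp add: shift_def)

lemma shift_shift [simp]: "shift j (shift k x) = shift (j + k) x"
  by (rule ext) (simp add: add.assoc)

lemma shift_0 [simp]: "shift 0 x = x"
  by (rule ext) simp

lemma J_eq_iff: "J K x = J K y \<longleftrightarrow> (\<forall>k\<in>K. x k = y k)"
  by (auto simp: J_def restrict_def fun_eq_iff)

lemma J_apply [simp]: "k \<in> K \<Longrightarrow> J K x k = x k"
  by (simp add: J_def)

lemma J_J [simp]: "K' \<subseteq> K \<Longrightarrow> J K' (J K x) = J K' x"
  by (auto simp: J_eq_iff)

lemma finite_J_image [simp]:
  fixes X :: "(int \<Rightarrow> 'a::finite) set"
  assumes "finite K"
  shows "finite (J K ` X)"
proof (rule finite_subset)
  show "J K ` X \<subseteq> PiE K (\<lambda>_. UNIV)" by (auto simp: J_def)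
  show "finite (PiE K (\<lambda>_. UNIV :: 'a set))" using assms by (intro finite_PiE) auto
qed

definition erg_sum :: "((int \<Rightarrow> 'a) \<Rightarrow> real) \<Rightarrow> int set \<Rightarrow> (int \<Rightarrow> 'a) \<Rightarrow> real" where
  "erg_sum \<psi> K x = (\<Sum>k\<in>K. \<psi> (shift k x))"

definition cyl_weight ::
    "(int \<Rightarrow> 'a) set \<Rightarrow> ((int \<Rightarrow> 'a) \<Rightarrow> real) \<Rightarrow> int set \<Rightarrow> (int \<Rightarrow> 'a) \<Rightarrow> real" where
  "cyl_weight X \<psi> K u = Sup {exp (erg_sum \<psi> K x) | x. x \<in> X \<and> J K x = u}"

definition part_fun ::
    "(int \<Rightarrow> 'a) set \<Rightarrow> ((int \<Rightarrow> 'a) \<Rightarrow> real) \<Rightarrow> int set \<Rightarrow> real" where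
  "part_fun X \<psi> K = (\<Sum>u\<in>J K ` X. cyl_weight X \<psi> K u)"

lemma erg_sum_Un:
  "finite K \<Longrightarrow> finite K' \<Longrightarrow> K \<inter> K' = {} \<Longrightarrow>
    erg_sum \<psi> (K \<union> K') x = erg_sum \<psi> K x + erg_sum \<psi> K' x"
  by (simp add: erg_sum_def sum.union_disjoint)

lemma erg_sum_diff:
  "finite K \<Longrightarrow> K' \<subseteq> K \<Longrightarrow>
    erg_sum \<psi> K x = erg_sum \<psi> K' x + erg_sum \<psi> (K - K') x"
  by (simp add: erg_sum_def sum.subset_diff add.commute)

lemma erg_sum_shift:
  "erg_sum \<psi> ((\<lambda>k. k + a) ` K) x = erg_sum \<psi> K (shift a x)"
  by (simp add: erg_sum_def sum.reindex inj_on_def)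

lemma erg_sum_shift_interval:
  "erg_sum \<psi> {l..<u} (shift a x) = erg_sum \<psi> {l + a..<u + a} x"
proof -
  have "(\<lambda>k. k + a) ` {l..<u} = {l + a..<u + a}" by (simp add: add.commute)
  then show ?thesis using erg_sum_shift[of \<psi> a "{l..<u}" x] by simp
qed

text \<open>The setting in which the pressure converges, kept so weak that a perturbed function
  enters it by a bound alone.\<close>

locale observable =
  fixes X :: "(int \<Rightarrow> 'a::{finite, discrete_topology}) set"
    and \<psi> :: "(int \<Rightarrow> 'a) \<Rightarrow> real" and M :: real
  assumes inv: "x \<in> X \<Longrightarrow> shift j x \<in> X"
    and nonempty: "X \<noteq> {}"
    and bound: "x \<in> X \<Longrightarrow> \<bar>\<psi> x\<bar> \<le> M"
begin

lemma erg_sum_bound: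
  assumes "x \<in> X"
  shows "\<bar>erg_sum \<psi> K x\<bar> \<le> M * real (card K)"
proof -
  have "\<bar>erg_sum \<psi> K x\<bar> \<le> (\<Sum>k\<in>K. \<bar>\<psi> (shift k x)\<bar>)"
    unfolding erg_sum_def by (rule sum_abs)
  also have "\<dots> \<le> of_nat (card K) * M"
    using inv[OF assms] bound by (intro sum_bounded_above) auto
  finally show ?thesis by (simp add: mult.commute)
qed

lemma weight_bdd:
  "bdd_above {exp (erg_sum \<psi> K x) | x. x \<in> X \<and> J K x = u}"
proof (rule bdd_aboveI)
  fix t assume "t \<in> {exp (erg_sum \<psi> K x) | x. x \<in> X \<and> J K x = u}"
  then obtain x where "x \<in> X" "t = exp (erg_sum \<psi> K x)" by auto
  then show "t \<le> exp (M * real (card K))" using erg_sum_bound[of x K] by simp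
qed

lemma weight_ge:
  assumes "x \<in> X"
  shows "exp (erg_sum \<psi> K x) \<le> cyl_weight X \<psi> K (J K x)"
  unfolding cyl_weight_def using assms by (intro cSup_upper weight_bdd) auto

lemma weight_le:
  assumes "u \<in> J K ` X"
    and "\<And>x. x \<in> X \<Longrightarrow> J K x = u \<Longrightarrow> exp (erg_sum \<psi> K x) \<le> c"
  shows "cyl_weight X \<psi> K u \<le> c"
  unfolding cyl_weight_def using assms by (intro cSup_least) auto

lemma weight_pos:
  assumes "u \<in> J K ` X"
  shows "cyl_weight X \<psi> K u > 0"
  using assms weight_ge[of _ K] by (metis exp_gt_zero imageE order_less_le_trans)

text \<open>The supremum over a cylinder is replaced by the value at a point that attains it up to
  the factor \<open>2\<close>, which disappears in the exponential rate.\<close>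

lemma weight_near_max:
  assumes "u \<in> J K ` X"
  obtains x where "x \<in> X" "J K x = u"
    "cyl_weight X \<psi> K u \<le> 2 * exp (erg_sum \<psi> K x)"
proof (rule ccontr)
  assume "\<not> thesis"
  then have "exp (erg_sum \<psi> K x) \<le> cyl_weight X \<psi> K u / 2"
    if "x \<in> X" "J K x = u" for x
    using that that(1,2) \<open>\<And>x. _ \<Longrightarrow> _ \<Longrightarrow> _ \<Longrightarrow> thesis\<close> by fastforce
  then have "cyl_weight X \<psi> K u \<le> cyl_weight X \<psi> K u / 2"
    using assms by (intro weight_le) auto
  then show False using weight_pos[OF assms] by simp
qed

lemma part_fun_ge:
  assumes "finite K"
  shows "exp (- (M * real (card K))) \<le> part_fun X \<psi> K"
proof -
  obtain x where x: "x \<in> X" using nonempty by auto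
  have "exp (- (M * real (card K))) \<le> exp (erg_sum \<psi> K x)"
    using erg_sum_bound[OF x, of K] by simp
  also have "\<dots> \<le> cyl_weight X \<psi> K (J K x)" by (rule weight_ge[OF x])
  also have "\<dots> \<le> part_fun X \<psi> K"
    unfolding part_fun_def using assms x weight_pos
    by (intro member_le_sum) (auto simp: less_imp_le)
  finally show ?thesis .
qed

lemma part_fun_pos: "finite K \<Longrightarrow> part_fun X \<psi> K > 0"
  using part_fun_ge by (meson exp_gt_zero order_less_le_trans)

lemma weight_Un:
  assumes "finite K" "finite K'" "K \<inter> K' = {}" "w \<in> J (K \<union> K') ` X"
  shows "cyl_weight X \<psi> (K \<union> K') w
    \<le> cyl_weight X \<psi> K (J K w) * cyl_weight X \<psi> K' (J K' w)"
proof (rule weight_le[OF assms(4)])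
  fix x assume x: "x \<in> X" "J (K \<union> K') x = w"
  have "exp (erg_sum \<psi> (K \<union> K') x) = exp (erg_sum \<psi> K x) * exp (erg_sum \<psi> K' x)"
    using assms by (simp add: erg_sum_Un exp_add)
  also have "\<dots> \<le> cyl_weight X \<psi> K (J K x) * cyl_weight X \<psi> K' (J K' x)"
    using weight_ge[OF x(1)] weight_pos x(1)
    by (intro mult_mono) (auto intro!: less_imp_le[OF weight_pos])
  also have "\<dots> = cyl_weight X \<psi> K (J K w) * cyl_weight X \<psi> K' (J K' w)"
    using x(2) by auto
  finally show "exp (erg_sum \<psi> (K \<union> K') x)
    \<le> cyl_weight X \<psi> K (J K w) * cyl_weight X \<psi> K' (J K' w)" .
qed

text \<open>A word on the union is determined by its two restrictions, but two words need not occur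
  together; hence only an inequality.\<close>

lemma part_fun_Un:
  assumes "finite K" "finite K'" "K \<inter> K' = {}"
  shows "part_fun X \<psi> (K \<union> K') \<le> part_fun X \<psi> K * part_fun X \<psi> K'"
proof -
  have "part_fun X \<psi> (K \<union> K') \<le>
    (\<Sum>(u, v)\<in>J K ` X \<times> J K' ` X. cyl_weight X \<psi> K u * cyl_weight X \<psi> K' v)"
    unfolding part_fun_def
  proof (rule sum_le_sum_inj_on[where f = "\<lambda>w. (J K w, J K' w)"])
    show "inj_on (\<lambda>w. (J K w, J K' w)) (J (K \<union> K') ` X)"
      by (auto simp: inj_on_def J_eq_iff)
    show "(\<lambda>w. (J K w, J K' w)) ` J (K \<union> K') ` X \<subseteq> J K ` X \<times> J K' ` X" by auto
  qed (use assms weight_Un weight_pos in \<open>auto simp: less_imp_le\<close>)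
  also have "\<dots> = part_fun X \<psi> K * part_fun X \<psi> K'"
    by (simp add: part_fun_def sum_product sum.cartesian_product)
  finally show ?thesis .
qed

lemma weight_shift:
  assumes u: "u \<in> J ((\<lambda>k. k + a) ` K) ` X"
  shows "cyl_weight X \<psi> ((\<lambda>k. k + a) ` K) u = cyl_weight X \<psi> K (J K (shift a u))"
proof -
  have "{exp (erg_sum \<psi> ((\<lambda>k. k + a) ` K) x) | x. x \<in> X \<and> J ((\<lambda>k. k + a) ` K) x = u}
      = {exp (erg_sum \<psi> K x) | x. x \<in> X \<and> J K x = J K (shift a u)}" (is "?A = ?B")
  proof (intro equalityI subsetI)
    fix t assume "t \<in> ?A"
    then obtain x where "x \<in> X" "J ((\<lambda>k. k + a) ` K) x = u"
        "t = exp (erg_sum \<psi> K (shift a x))" by (auto simp: erg_sum_shift)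
    then show "t \<in> ?B" using inv by (auto simp: J_eq_iff intro!: exI[of _ "shift a x"])
  next
    fix t assume "t \<in> ?B"
    then obtain x where "x \<in> X" "J K x = J K (shift a u)" "t = exp (erg_sum \<psi> K x)"
      by auto
    moreover obtain y where "u = J ((\<lambda>k. k + a) ` K) y" using u by blast
    ultimately show "t \<in> ?A" using inv
      by (auto simp: J_eq_iff erg_sum_shift intro!: exI[of _ "shift (- a) x"])
  qed
  then show ?thesis by (simp add: cyl_weight_def)
qed

lemma part_fun_shift:
  "part_fun X \<psi> ((\<lambda>k. k + a) ` K) = part_fun X \<psi> K"
  unfolding part_fun_def
proof (rule sum.reindex_bij_witness
    [of _ "\<lambda>v. J ((\<lambda>k. k + a) ` K) (shift (- a) v)" "\<lambda>u. J K (shift a u)"])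
  fix u assume u: "u \<in> J ((\<lambda>k. k + a) ` K) ` X"
  then obtain x where x: "x \<in> X" "u = J ((\<lambda>k. k + a) ` K) x" by auto
  show "J ((\<lambda>k. k + a) ` K) (shift (- a) (J K (shift a u))) = u"
    using x by (auto simp: J_eq_iff)
  have "J K (shift a u) = J K (shift a x)" using x by (auto simp: J_eq_iff)
  then show "J K (shift a u) \<in> J K ` X" using inv x by auto
  show "cyl_weight X \<psi> K (J K (shift a u)) = cyl_weight X \<psi> ((\<lambda>k. k + a) ` K) u"
    using weight_shift[OF u] by simp
next
  fix v assume "v \<in> J K ` X"
  then obtain x where x: "x \<in> X" "v = J K x" by auto
  show "J K (shift a (J ((\<lambda>k. k + a) ` K) (shift (- a) v))) = v"
    using x by (auto simp: J_eq_iff)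
  have "J ((\<lambda>k. k + a) ` K) (shift (- a) v) = J ((\<lambda>k. k + a) ` K) (shift (- a) x)"
    using x by (auto simp: J_eq_iff)
  then show "J ((\<lambda>k. k + a) ` K) (shift (- a) v) \<in> J ((\<lambda>k. k + a) ` K) ` X"
    using inv x by auto
qed

lemma part_fun_interval:
  "part_fun X \<psi> {a..<a + int n} = part_fun X \<psi> {0..<int n}"
proof -
  have "{a..<a + int n} = (\<lambda>k. k + a) ` {0..<int n}" by (simp add: add.commute)
  then show ?thesis by (simp only: part_fun_shift)
qed

lemma part_fun_add:
  "part_fun X \<psi> {0..<int (m + n)}
    \<le> part_fun X \<psi> {0..<int m} * part_fun X \<psi> {0..<int n}"
proof -
  have "{0..<int (m + n)} = {0..<int m} \<union> {int m..<int m + int n}" by auto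
  then show ?thesis
    using part_fun_Un[of "{0..<int m}" "{int m..<int m + int n}"]
    by (simp add: part_fun_interval)
qed

text \<open>The definition of \<open>pressure\<close> runs over the odd lengths
  \<open>2 * n + 1\<close> only. Submultiplicativity gives the limit along all lengths, which is
  needed since later block lengths such as \<open>l + 3 * D\<close> have either parity.\<close>

lemma pressure_tendsto:
  "(\<lambda>n. ln (part_fun X \<psi> {0..<int n}) / real n) \<longlonglongrightarrow> pressure X \<psi>"
proof -
  define a where "a n = ln (part_fun X \<psi> {0..<int n})" for n
  have sub: "a (m + n) \<le> a m + a n" for m n
  proof -
    have "a (m + n) \<le> ln (part_fun X \<psi> {0..<int m} * part_fun X \<psi> {0..<int n})"
      unfolding a_def by (intro ln_mono part_fun_add part_fun_pos) simp
    then show ?thesis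
      using part_fun_pos[of "{0..<int m}"] part_fun_pos[of "{0..<int n}"]
      by (simp add: a_def ln_mult)
  qed
  have "- (M * real n) \<le> a n" for n
    using part_fun_ge[of "{0..<int n}"] part_fun_pos[of "{0..<int n}"]
    by (simp add: a_def ln_ge_iff)
  with sub have "convergent (\<lambda>n. a n / real n)" by (rule fekete)
  then obtain l where l: "(\<lambda>n. a n / real n) \<longlonglongrightarrow> l" by (auto simp: convergent_def)
  have "strict_mono (\<lambda>n::nat. 2 * n + 1)" by (auto simp: strict_mono_def)
  then have "(\<lambda>n. a (2 * n + 1) / real (2 * n + 1)) \<longlonglongrightarrow> l"
    using LIMSEQ_subseq_LIMSEQ[OF l] unfolding o_def by blast
  moreover have "a (2 * n + 1) / real (2 * n + 1) = 1 / real (card (Lam n)) *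
     ln (\<Sum>u\<in>J (Lam n) ` X.
           Sup {exp (\<Sum>k\<in>Lam n. \<psi> (shift k x)) | x. x \<in> X \<and> J (Lam n) x = u})" for n
  proof -
    have L: "Lam n = {- int n..<- int n + int (2 * n + 1)}" by (auto simp: Lam_def)
    have c: "card (Lam n) = 2 * n + 1" by (simp add: Lam_def)
    have "part_fun X \<psi> (Lam n) = part_fun X \<psi> {0..<int (2 * n + 1)}"
      unfolding L by (rule part_fun_interval)
    then show ?thesis
      unfolding c by (simp add: a_def part_fun_def cyl_weight_def erg_sum_def)
  qed
  ultimately have "pressure X \<psi> = l" unfolding pressure_def by (simp add: limI)
  then show ?thesis using l by (simp add: a_def)
qed

end

section \<open>Absolutely summable potentials\<close>

lemma infsum_split_finite:
  fixes f :: "'a \<Rightarrow> real"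
  assumes "f summable_on A" "finite F" "F \<subseteq> A"
  shows "infsum f A = sum f F + infsum f (A - F)"
proof -
  have "infsum f (F \<union> (A - F)) = infsum f F + infsum f (A - F)"
    using assms by (intro infsum_Un_disjoint) (auto intro: summable_on_subset_banach)
  moreover have "F \<union> (A - F) = A" using assms by auto
  ultimately show ?thesis using assms by simp
qed

lemma summable_on_tail:
  fixes f :: "'a \<Rightarrow> real"
  assumes "f summable_on A" "\<epsilon> > 0"
  obtains F where "finite F" "F \<subseteq> A" "infsum f (A - F) \<le> \<epsilon>"
proof -
  obtain F where F: "finite F" "F \<subseteq> A" "dist (sum f F) (infsum f A) \<le> \<epsilon>"
    using infsum_finite_approximation[OF assms] by blast
  then show thesis
    using that[OF F(1,2)] infsum_split_finite[OF assms(1) F(1,2)] by (simp add: dist_real_def)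
qed

lemma sum_infsum_swap:
  fixes f :: "'k \<Rightarrow> 'a \<Rightarrow> real"
  assumes "finite K" "\<And>k. k \<in> K \<Longrightarrow> f k summable_on A"
  shows "(\<lambda>x. \<Sum>k\<in>K. f k x) summable_on A \<and> (\<Sum>k\<in>K. infsum (f k) A) = (\<Sum>\<^sub>\<infinity>x\<in>A. \<Sum>k\<in>K. f k x)"
  using assms
proof (induction K)
  case (insert k K)
  then show ?case by (auto intro: summable_on_add simp: infsum_add)
qed auto

lemma finite_subset_int_interval:
  assumes "finite (F :: int set set)" "\<And>A. A \<in> F \<Longrightarrow> finite A"
  obtains R :: nat where "\<And>A j. A \<in> F \<Longrightarrow> j \<in> A \<Longrightarrow> \<bar>j\<bar> \<le> int R"
proof -
  have "finite (\<Union>F)" using assms by auto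
  then obtain b where b: "\<And>j. j \<in> \<Union>F \<Longrightarrow> \<bar>j\<bar> \<le> b"
    using bdd_above_finite[of "abs ` \<Union>F"] by (auto simp: bdd_above_def)
  show thesis
  proof (rule that[of "nat b"])
    fix A j assume "A \<in> F" "j \<in> A"
    then have "\<bar>j\<bar> \<le> b" using b by blast
    moreover have "b \<le> int (nat b)" by simp
    ultimately show "\<bar>j\<bar> \<le> int (nat b)" by linarith
  qed
qed

locale summable_potential =
  fixes X :: "(int \<Rightarrow> 'a::{finite, discrete_topology}) set"
    and \<Phi> :: "int set \<Rightarrow> (int \<Rightarrow> 'a) \<Rightarrow> real"
  assumes pot: "absolutely_summable_potential X \<Phi>"
    and X_shift: "x \<in> X \<Longrightarrow> shift j x \<in> X"
begin

definition "I0 = {A :: int set. finite A \<and> 0 \<in> A}"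

definition "nm A = sup_norm X (\<Phi> A)"

lemma nm_summable: "nm summable_on I0"
  using pot unfolding absolutely_summable_potential_def nm_def[abs_def] I0_def by simp

lemma local_eq:
  "finite A \<Longrightarrow> x \<in> X \<Longrightarrow> y \<in> X \<Longrightarrow> (\<And>j. j \<in> A \<Longrightarrow> x j = y j) \<Longrightarrow> \<Phi> A x = \<Phi> A y"
  using pot unfolding absolutely_summable_potential_def J_eq_iff by metis

text \<open>A supremum of reals controls the values only if these are bounded above. Here they form
  a finite set: \<open>\<Phi> A\<close> depends on the word on \<open>A\<close> alone, and
  \<open>r\<close> chooses a point for each of the finitely many words.\<close>

lemma nm_ge:
  assumes "finite A" "x \<in> X"
  shows "\<bar>\<Phi> A x\<bar> \<le> nm A"
proof -
  define r where "r u = (SOME y. y \<in> X \<and> J A y = u)" for u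
  have "\<Phi> A y = \<Phi> A (r (J A y))" if "y \<in> X" for y
  proof -
    have "r (J A y) \<in> X \<and> J A (r (J A y)) = J A y"
      unfolding r_def by (rule someI[of "\<lambda>z. z \<in> X \<and> J A z = J A y" y]) (simp add: that)
    then show ?thesis
      using local_eq[OF assms(1) that, of "r (J A y)"] by (metis J_apply)
  qed
  then have "(\<lambda>x. \<bar>\<Phi> A x\<bar>) ` X \<subseteq> (\<lambda>u. \<bar>\<Phi> A (r u)\<bar>) ` (J A ` X)" by force
  then have "finite ((\<lambda>x. \<bar>\<Phi> A x\<bar>) ` X)"
    using assms(1) by (meson finite_J_image finite_imageI finite_subset)
  then show ?thesis
    unfolding nm_def sup_norm_def using assms(2) by (intro cSUP_upper) auto
qed

lemma nm_nonneg: "finite A \<Longrightarrow> X \<noteq> {} \<Longrightarrow> nm A \<ge> 0"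
  using nm_ge by (metis abs_ge_zero all_not_in_conv order.trans)

lemma card_ge_1: "A \<in> I0 \<Longrightarrow> real (card A) \<ge> 1"
  by (auto simp: I0_def Suc_le_eq card_gt_0_iff)

lemma term_le:
  assumes "A \<in> I0" "x \<in> X"
  shows "\<bar>\<Phi> A x / real (card A)\<bar> \<le> nm A"
proof -
  have "\<bar>\<Phi> A x\<bar> \<le> nm A" using assms nm_ge by (auto simp: I0_def)
  also have "\<dots> \<le> nm A * real (card A)"
    using card_ge_1[OF assms(1)] calculation by (simp add: mult_le_cancel_left1)
  finally show ?thesis using card_ge_1[OF assms(1)] by (simp add: field_simps)
qed

lemma term_summable:
  assumes "x \<in> X"
  shows "(\<lambda>A. \<Phi> A x / real (card A)) summable_on I0"
  using Infinite_Sum.abs_summable_on_comparison_test'[OF nm_summable, of "\<lambda>A. \<Phi> A x / real (card A)"]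
    term_le[OF _ assms] by (auto intro: abs_summable_summable)

lemma phi_eq: "phi \<Phi> x = (\<Sum>\<^sub>\<infinity>A\<in>I0. \<Phi> A x / real (card A))"
  by (simp add: phi_def I0_def)

lemma phi_bound:
  assumes "x \<in> X"
  shows "\<bar>phi \<Phi> x\<bar> \<le> infsum nm I0"
proof -
  have s: "(\<lambda>A. norm (\<Phi> A x / real (card A))) summable_on I0"
    using term_le[OF _ assms] by (intro Infinite_Sum.abs_summable_on_comparison_test'[OF nm_summable]) auto
  have "norm (phi \<Phi> x) \<le> (\<Sum>\<^sub>\<infinity>A\<in>I0. norm (\<Phi> A x / real (card A)))"
    unfolding phi_eq by (rule norm_infsum_bound[OF s])
  also have "\<dots> \<le> infsum nm I0"
    using term_le[OF _ assms] by (intro infsum_mono s nm_summable) auto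
  finally show ?thesis by simp
qed

lemma phi_diff_le:
  assumes x: "x \<in> X" and y: "y \<in> X"
    and d: "d summable_on I0" "\<And>A. A \<in> I0 \<Longrightarrow> \<bar>\<Phi> A x / real (card A) - \<Phi> A y / real (card A)\<bar> \<le> d A"
  shows "\<bar>phi \<Phi> x - phi \<Phi> y\<bar> \<le> infsum d I0"
proof -
  let ?t = "\<lambda>A. \<Phi> A x / real (card A) - \<Phi> A y / real (card A)"
  have s: "(\<lambda>A. norm (?t A)) summable_on I0"
    using d by (intro Infinite_Sum.abs_summable_on_comparison_test'[OF d(1)]) auto
  have "(\<Sum>\<^sub>\<infinity>A\<in>I0. ?t A) = phi \<Phi> x - phi \<Phi> y"
    unfolding phi_eq
    using term_summable[OF x] term_summable[OF y]
      infsum_add[of "\<lambda>A. \<Phi> A x / real (card A)" I0 "\<lambda>A. - (\<Phi> A y / real (card A))"]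
    by (simp add: summable_on_uminus infsum_uminus)
  then have "norm (phi \<Phi> x - phi \<Phi> y) \<le> (\<Sum>\<^sub>\<infinity>A\<in>I0. norm (?t A))"
    using norm_infsum_bound[OF s] by simp
  also have "\<dots> \<le> infsum d I0" using d by (intro infsum_mono s d(1)) auto
  finally show ?thesis by simp
qed

lemma term_diff_le:
  assumes "A \<in> I0" "x \<in> X" "y \<in> X"
  shows "\<bar>\<Phi> A x / real (card A) - \<Phi> A y / real (card A)\<bar>
    \<le> (if \<forall>j\<in>A. x j = y j then 0 else 2 * nm A / real (card A))"
proof (cases "\<forall>j\<in>A. x j = y j")
  case True
  then have "\<Phi> A x = \<Phi> A y" using assms by (intro local_eq) (auto simp: I0_def)
  then show ?thesis using True by simp
next
  case False
  have "\<bar>\<Phi> A x - \<Phi> A y\<bar> \<le> 2 * nm A"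
    using assms nm_ge[of A x] nm_ge[of A y] by (auto simp: I0_def)
  then have "\<bar>\<Phi> A x - \<Phi> A y\<bar> / real (card A) \<le> 2 * nm A / real (card A)"
    by (intro divide_right_mono) auto
  then have "\<bar>\<Phi> A x / real (card A) - \<Phi> A y / real (card A)\<bar> \<le> 2 * nm A / real (card A)"
    by (simp add: diff_divide_distrib[symmetric])
  then show ?thesis by (subst if_not_P[OF False])
qed

text \<open>Uniform continuity in combinatorial form: the finitely many sets in \<open>F\<close> do
  not reach beyond distance \<open>R\<close>, and the term of each of the others changes by at most
  twice its norm.\<close>

lemma phi_uniform:
  assumes "\<epsilon> > 0"
  shows "\<exists>R::nat. \<forall>x\<in>X. \<forall>y\<in>X. (\<forall>j. \<bar>j\<bar> \<le> int R \<longrightarrow> x j = y j) \<longrightarrow> \<bar>phi \<Phi> x - phi \<Phi> y\<bar> \<le> \<epsilon>"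
proof -
  obtain F where F: "finite F" "F \<subseteq> I0" "infsum nm (I0 - F) \<le> \<epsilon> / 2"
    using summable_on_tail[OF nm_summable] assms by (metis half_gt_zero)
  obtain R where R: "\<And>A j. A \<in> F \<Longrightarrow> j \<in> A \<Longrightarrow> \<bar>j\<bar> \<le> int R"
    using finite_subset_int_interval[OF F(1)] F(2) by (auto simp: I0_def)
  show ?thesis
  proof (intro exI[of _ R] ballI impI)
    fix x y assume xy: "x \<in> X" "y \<in> X" and eq: "\<forall>j. \<bar>j\<bar> \<le> int R \<longrightarrow> x j = y j"
    define d where "d A = (if A \<in> F then 0 else 2 * nm A)" for A
    have s: "nm summable_on (I0 - F)" using nm_summable by (rule summable_on_subset_banach) auto
    have dI: "(d has_sum infsum (\<lambda>A. 2 * nm A) (I0 - F)) I0"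
    proof (rule has_sum_cong_neutral[THEN iffD1])
      show "((\<lambda>A. 2 * nm A) has_sum infsum (\<lambda>A. 2 * nm A) (I0 - F)) (I0 - F)"
        using s by (intro has_sum_infsum summable_on_cmult_right)
    qed (auto simp: d_def)
    have "\<bar>phi \<Phi> x - phi \<Phi> y\<bar> \<le> infsum d I0"
    proof (rule phi_diff_le[OF xy])
      show "d summable_on I0" using dI by (rule has_sum_imp_summable)
      fix A assume A: "A \<in> I0"
      have nm: "nm A \<ge> 0" using nm_nonneg[of A] A xy(1) by (auto simp: I0_def)
      moreover have "2 * nm A / real (card A) \<le> 2 * nm A"
        using card_ge_1[OF A] nm by (simp add: divide_le_eq mult_le_cancel_left1)
      ultimately show "\<bar>\<Phi> A x / real (card A) - \<Phi> A y / real (card A)\<bar> \<le> d A"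
        using term_diff_le[OF A xy] R eq by (auto simp: d_def split: if_splits)
    qed
    also have "infsum d I0 = infsum (\<lambda>A. 2 * nm A) (I0 - F)" using dI by (rule infsumI)
    also have "\<dots> = 2 * infsum nm (I0 - F)" by (rule infsum_cmult_right')
    finally show "\<bar>phi \<Phi> x - phi \<Phi> y\<bar> \<le> \<epsilon>" using F(3) by simp
  qed
qed

text \<open>A set \<open>A\<close> contributes to the left-hand side for at most \<open>card A * n\<close> values of \<open>k\<close>, and if
  \<open>A\<close> has radius at most \<open>R\<close>, for at most \<open>2 * R\<close> values outside the block. The weights
  \<open>1 / card A\<close> in \<open>phi\<close> cancel the first count.\<close>

lemma phi_block_influence:
  assumes "\<epsilon> > 0"
  shows "\<exists>n0::nat. \<forall>n\<ge>n0. \<forall>x\<in>X. \<forall>y\<in>X. \<forall>a K.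
    (\<forall>k. k < a \<or> k \<ge> a + int n \<longrightarrow> x k = y k) \<longrightarrow> finite K \<longrightarrow> K \<inter> {a..<a + int n} = {} \<longrightarrow>
    (\<Sum>k\<in>K. \<bar>phi \<Phi> (shift k x) - phi \<Phi> (shift k y)\<bar>) \<le> \<epsilon> * real n"
proof (cases "X = {}")
  case True
  then show ?thesis by simp
next
  case ne: False
  obtain F where F: "finite F" "F \<subseteq> I0" "infsum nm (I0 - F) \<le> \<epsilon> / 4"
    using summable_on_tail[OF nm_summable, of "\<epsilon> / 4"] assms by auto
  obtain R where R: "\<And>A j. A \<in> F \<Longrightarrow> j \<in> A \<Longrightarrow> \<bar>j\<bar> \<le> int R"
    using finite_subset_int_interval[OF F(1)] F(2) by (auto simp: I0_def)
  \<comment> \<open>For every \<open>n\<close> the sets of \<open>F\<close> cost at most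
    \<open>4 * R * sum nm F\<close>: there are \<open>2 * R\<close> sites, each with
    \<open>2 * nm A\<close>. From \<open>n0\<close> on this is at most half of
    \<open>\<epsilon> * n\<close>; the other sets cost at most
    \<open>2 * n * (\<epsilon> / 4)\<close>.\<close>
  obtain n0 :: nat where n0: "real n0 \<ge> 4 * real R * sum nm F / (\<epsilon> / 2)"
    using real_arch_simple by blast
  show ?thesis
  proof (intro exI[of _ n0] allI ballI impI)
    fix n :: nat and x y and a :: int and K :: "int set"
    assume n: "n \<ge> n0" and xy: "x \<in> X" "y \<in> X"
      and eq: "\<forall>k. k < a \<or> k \<ge> a + int n \<longrightarrow> x k = y k"
      and K: "finite K" "K \<inter> {a..<a + int n} = {}"
    \<comment> \<open>Only for \<open>k \<in> Q A\<close> does the translate of \<open>A\<close> by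
      \<open>k\<close> meet the block, so only there can the term of \<open>A\<close>
      change.\<close>
    define Q where "Q A = {k \<in> K. \<exists>j\<in>A. j + k \<in> {a..<a + int n}}" for A
    define d where "d k A = (if k \<in> Q A then 2 * nm A / real (card A) else 0)" for k A
    have nm0: "nm A \<ge> 0" if "A \<in> I0" for A using that nm_nonneg ne by (auto simp: I0_def)
    have d_sum: "d k summable_on I0" for k
    proof (rule summable_on_comparison_test)
      show "(\<lambda>A. 2 * nm A) summable_on I0" by (intro summable_on_cmult_right nm_summable)
      fix A assume A: "A \<in> I0"
      show "d k A \<le> 2 * nm A" "0 \<le> d k A"
        using card_ge_1[OF A] nm0[OF A]
        by (auto simp: d_def divide_le_eq mult_le_cancel_left1)
    qed
    have "\<bar>phi \<Phi> (shift k x) - phi \<Phi> (shift k y)\<bar> \<le> infsum (d k) I0" if k: "k \<in> K" for k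
    proof (rule phi_diff_le[OF X_shift[OF xy(1)] X_shift[OF xy(2)] d_sum])
      fix A assume A: "A \<in> I0"
      have "\<forall>j\<in>A. shift k x j = shift k y j" if "k \<notin> Q A"
        using that k eq by (fastforce simp: Q_def)
      moreover have "0 \<le> 2 * nm A / real (card A)" using nm0[OF A] by simp
      ultimately show "\<bar>\<Phi> A (shift k x) / real (card A) - \<Phi> A (shift k y) / real (card A)\<bar> \<le> d k A"
        using term_diff_le[OF A X_shift[OF xy(1)] X_shift[OF xy(2)], of k k]
        unfolding d_def by (smt (verit, ccfv_SIG))
    qed
    then have "(\<Sum>k\<in>K. \<bar>phi \<Phi> (shift k x) - phi \<Phi> (shift k y)\<bar>) \<le> (\<Sum>k\<in>K. infsum (d k) I0)"
      by (rule sum_mono)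
    also have "\<dots> = (\<Sum>\<^sub>\<infinity>A\<in>I0. \<Sum>k\<in>K. d k A)"
      using sum_infsum_swap[OF K(1) d_sum] by simp
    also have "\<dots> = (\<Sum>A\<in>F. \<Sum>k\<in>K. d k A) + (\<Sum>\<^sub>\<infinity>A\<in>I0 - F. \<Sum>k\<in>K. d k A)"
      using sum_infsum_swap[OF K(1) d_sum] F by (intro infsum_split_finite) auto
    also have "\<dots> \<le> (\<Sum>A\<in>F. 4 * real R * nm A) + (\<Sum>\<^sub>\<infinity>A\<in>I0 - F. 2 * real n * nm A)"
    proof -
      have dQ: "(\<Sum>k\<in>K. d k A) = real (card (Q A)) * (2 * nm A / real (card A))" for A
      proof -
        have "(\<Sum>k\<in>K. d k A) = (\<Sum>k\<in>Q A. 2 * nm A / real (card A))"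
          unfolding d_def using K(1) by (intro sum.mono_neutral_cong_right) (auto simp: Q_def)
        then show ?thesis by simp
      qed
      have small: "(\<Sum>k\<in>K. d k A) \<le> 4 * real R * nm A" if A: "A \<in> F" for A
      proof -
        have AI: "A \<in> I0" using A F by auto
        have "Q A \<subseteq> {a - int R..<a} \<union> {a + int n..<a + int n + int R}"
          using K(2) R[OF A] unfolding Q_def by fastforce
        then have "card (Q A) \<le> card ({a - int R..<a} \<union> {a + int n..<a + int n + int R})"
          by (intro card_mono) auto
        also have "\<dots> \<le> 2 * R" by (rule order_trans[OF card_Un_le]) simp
        finally have cQ: "real (card (Q A)) \<le> 2 * real R" by linarith
        have "2 * nm A / real (card A) \<le> 2 * nm A" "0 \<le> 2 * nm A / real (card A)"
          using card_ge_1[OF AI] nm0[OF AI] by (auto simp: divide_le_eq mult_le_cancel_left1)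
        then have "real (card (Q A)) * (2 * nm A / real (card A)) \<le> 2 * real R * (2 * nm A)"
          using cQ by (intro mult_mono) auto
        then show ?thesis by (simp add: dQ)
      qed
      have large: "(\<Sum>k\<in>K. d k A) \<le> 2 * real n * nm A" if A: "A \<in> I0" for A
      proof -
        have fA: "finite A" using A by (simp add: I0_def)
        have "Q A \<subseteq> (\<Union>j\<in>A. {a - j..<a + int n - j})" by (auto simp: Q_def)
        then have "card (Q A) \<le> card (\<Union>j\<in>A. {a - j..<a + int n - j})"
          using fA by (intro card_mono) auto
        also have "\<dots> \<le> (\<Sum>j\<in>A. card {a - j..<a + int n - j})" using fA by (rule card_UN_le)
        also have "\<dots> = card A * n" by simp
        finally have "real (card (Q A)) \<le> real (card A) * real n"
          using of_nat_mono by fastforce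
        then have "real (card (Q A)) * (2 * nm A / real (card A))
            \<le> real (card A) * real n * (2 * nm A / real (card A))"
          using nm0[OF A] by (intro mult_right_mono) auto
        also have "\<dots> = 2 * real n * nm A" using card_ge_1[OF A] by simp
        finally show ?thesis by (simp add: dQ)
      qed
      have "(\<lambda>A. \<Sum>k\<in>K. d k A) summable_on I0"
        using sum_infsum_swap[of K d I0] K(1) d_sum by blast
      then have "(\<lambda>A. \<Sum>k\<in>K. d k A) summable_on I0 - F" "nm summable_on I0 - F"
        using nm_summable by (auto intro: summable_on_subset_banach)
      then show ?thesis
        using small large by (intro add_mono sum_mono infsum_mono summable_on_cmult_right) auto
    qed
    also have "\<dots> = 4 * real R * sum nm F + 2 * real n * infsum nm (I0 - F)"
      by (simp add: sum_distrib_left infsum_cmult_right')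
    also have "\<dots> \<le> \<epsilon> / 2 * real n + 2 * real n * (\<epsilon> / 4)"
    proof (rule add_mono)
      have "4 * real R * sum nm F / (\<epsilon> / 2) \<le> real n" using n0 n by linarith
      then show "4 * real R * sum nm F \<le> \<epsilon> / 2 * real n" using assms by (simp add: field_simps)
      show "2 * real n * infsum nm (I0 - F) \<le> 2 * real n * (\<epsilon> / 4)"
        using F(3) by (intro mult_left_mono) auto
    qed
    finally show "(\<Sum>k\<in>K. \<bar>phi \<Phi> (shift k x) - phi \<Phi> (shift k y)\<bar>) \<le> \<epsilon> * real n"
      by (simp add: algebra_simps)
  qed
qed

end

section \<open>Refilling blocks in finite volume\<close>

text \<open>Interface to what precedes: graph and potential are from here on represented by uniform
  continuity, by the small influence of a block on the energy of its exterior and by the filling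
  property.\<close>

locale block_filling = observable X \<phi> M
  for X :: "(int \<Rightarrow> 'a::{finite, discrete_topology}) set"
    and \<phi> :: "(int \<Rightarrow> 'a) \<Rightarrow> real" and M :: real +
  fixes D :: nat
  assumes uniform: "\<epsilon> > 0 \<Longrightarrow> \<exists>R::nat. \<forall>x\<in>X. \<forall>y\<in>X. (\<forall>j. \<bar>j\<bar> \<le> int R \<longrightarrow> x j = y j) \<longrightarrow>
      \<bar>\<phi> x - \<phi> y\<bar> \<le> \<epsilon>"
    and influence: "\<epsilon> > 0 \<Longrightarrow> \<exists>n0::nat. \<forall>n\<ge>n0. \<forall>x\<in>X. \<forall>y\<in>X. \<forall>a K.
      (\<forall>k. k < a \<or> k \<ge> a + int n \<longrightarrow> x k = y k) \<longrightarrow> finite K \<longrightarrow> K \<inter> {a..<a + int n} = {} \<longrightarrow>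
      (\<Sum>k\<in>K. \<bar>\<phi> (shift k x) - \<phi> (shift k y)\<bar>) \<le> \<epsilon> * real n"
    and filling: "x \<in> X \<Longrightarrow> y \<in> X \<Longrightarrow> L \<ge> 2 * D \<Longrightarrow>
      \<exists>x'\<in>X. \<exists>s\<le>D. (\<forall>k. k < a \<or> k \<ge> a + int L \<longrightarrow> x' k = x k) \<and>
        (\<forall>k. int D \<le> k \<and> k < int L - int D \<longrightarrow> x' (a + k) = y (b + k + int s))"
begin

text \<open>At sites of depth \<open>m = D + R\<close> or more the points agree, up to the
  translation, within distance \<open>R\<close>, so the summands differ by at most
  \<open>\<epsilon> / 2\<close>. The remaining \<open>2 * m\<close> sites of each point cost
  together at most \<open>4 * m * M\<close>, a bounded amount that is below
  \<open>\<epsilon> / 2 * L\<close> for large \<open>L\<close>.\<close>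

lemma distortion:
  assumes "\<epsilon> > 0"
  obtains n0 :: nat where "\<And>L x y a b s. L \<ge> n0 \<Longrightarrow> x \<in> X \<Longrightarrow> y \<in> X \<Longrightarrow> s \<le> D \<Longrightarrow>
    (\<And>k. int D \<le> k \<Longrightarrow> k < int L - int D \<Longrightarrow> x (a + k) = y (b + k + int s)) \<Longrightarrow>
    \<bar>erg_sum \<phi> {a..<a + int L} x - erg_sum \<phi> {b..<b + int L} y\<bar> \<le> \<epsilon> * real L"
proof -
  obtain R where R: "\<And>x y. x \<in> X \<Longrightarrow> y \<in> X \<Longrightarrow> (\<And>j. \<bar>j\<bar> \<le> int R \<Longrightarrow> x j = y j) \<Longrightarrow>
      \<bar>\<phi> x - \<phi> y\<bar> \<le> \<epsilon> / 2"
    using uniform[of "\<epsilon> / 2"] assms by (metis half_gt_zero)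
  define m where "m = D + R"
  obtain n1 :: nat where n1: "real n1 \<ge> 4 * real m * M / (\<epsilon> / 2)"
    using real_arch_simple by blast
  show thesis
  proof (rule that[of "max n1 (2 * m)"])
    fix L :: nat and x0 y0 and a b :: int and s :: nat
    assume L: "L \<ge> max n1 (2 * m)" and x0: "x0 \<in> X" "y0 \<in> X" and s: "s \<le> D"
      and eq0: "\<And>k. int D \<le> k \<Longrightarrow> k < int L - int D \<Longrightarrow> x0 (a + k) = y0 (b + k + int s)"
    define x y where "x = shift a x0" and "y = shift b y0"
    have xy: "x \<in> X" "y \<in> X" using x0 inv by (auto simp: x_def y_def)
    have eq: "x k = y (k + int s)" if "int D \<le> k" "k < int L - int D" for k
      using eq0[OF that] by (simp add: x_def y_def add.commute add.left_commute)
    have sm: "s \<le> m" using s by (simp add: m_def)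
    \<comment> \<open>Used with \<open>t = 0\<close> for \<open>x\<close> and \<open>t = s\<close>
      for \<open>y\<close>: the middle of \<open>y\<close> is moved by \<open>s\<close>, so that the
      two middle sums can be compared term by term, and the outer pieces have total length
      \<open>2 * m\<close> for either \<open>t\<close>.\<close>
    have split: "{0..<int L} = ({0..<int m + int t} \<union> {int m + int t..<int L - int m + int t})
        \<union> {int L - int m + int t..<int L}" if "t \<le> m" for t
      using L that by auto
    have sp: "erg_sum \<phi> {0..<int L} z = erg_sum \<phi> {0..<int m + int t} z
        + erg_sum \<phi> {int m + int t..<int L - int m + int t} z
        + erg_sum \<phi> {int L - int m + int t..<int L} z" if "t \<le> m" for t z
      using L that by (subst split[OF that]) (subst erg_sum_Un; auto simp: erg_sum_Un)+
    have edge: "\<bar>erg_sum \<phi> {0..<int m + int t} z\<bar> + \<bar>erg_sum \<phi> {int L - int m + int t..<int L} z\<bar>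
        \<le> 2 * real m * M" if "t \<le> m" "z \<in> X" for t z
    proof -
      have "\<bar>erg_sum \<phi> {0..<int m + int t} z\<bar> \<le> M * (real m + real t)"
        using erg_sum_bound[OF that(2), of "{0..<int m + int t}"] by simp
      moreover have "\<bar>erg_sum \<phi> {int L - int m + int t..<int L} z\<bar> \<le> M * (real m - real t)"
        using erg_sum_bound[OF that(2), of "{int L - int m + int t..<int L}"] that(1)
        by (simp add: of_nat_diff)
      ultimately show ?thesis by (simp add: algebra_simps)
    qed
    have mid: "\<bar>erg_sum \<phi> {int m..<int L - int m} x
        - erg_sum \<phi> {int m + int s..<int L - int m + int s} y\<bar> \<le> \<epsilon> / 2 * real L"
    proof -
      have "erg_sum \<phi> {int m + int s..<int L - int m + int s} y
          = erg_sum \<phi> {int m..<int L - int m} (shift (int s) y)"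
        by (rule erg_sum_shift_interval[symmetric])
      then have "\<bar>erg_sum \<phi> {int m..<int L - int m} x
        - erg_sum \<phi> {int m + int s..<int L - int m + int s} y\<bar>
        = \<bar>\<Sum>k\<in>{int m..<int L - int m}. \<phi> (shift k x) - \<phi> (shift (k + int s) y)\<bar>"
        by (simp add: erg_sum_def sum_subtractf)
      also have "\<dots> \<le> (\<Sum>k\<in>{int m..<int L - int m}. \<bar>\<phi> (shift k x) - \<phi> (shift (k + int s) y)\<bar>)"
        by (rule sum_abs)
      also have "\<dots> \<le> of_nat (card {int m..<int L - int m}) * (\<epsilon> / 2)"
      proof (rule sum_bounded_above)
        fix k assume k: "k \<in> {int m..<int L - int m}"
        have "x (j + k) = y (j + (k + int s))" if "\<bar>j\<bar> \<le> int R" for j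
        proof -
          have "int D \<le> j + k" "j + k < int L - int D" using k that by (auto simp: m_def)
          then show ?thesis using eq[of "j + k"] by (simp add: add.assoc)
        qed
        then show "\<bar>\<phi> (shift k x) - \<phi> (shift (k + int s) y)\<bar> \<le> \<epsilon> / 2"
          using xy inv by (intro R) auto
      qed
      also have "\<dots> \<le> real L * (\<epsilon> / 2)"
        using assms by (intro mult_right_mono) auto
      finally show ?thesis by (simp add: mult.commute)
    qed
    have "4 * real m * M \<le> \<epsilon> / 2 * real L"
    proof -
      have "4 * real m * M / (\<epsilon> / 2) \<le> real L" using n1 L by linarith
      then show ?thesis using assms by (simp add: field_simps)
    qed
    have "\<bar>erg_sum \<phi> {0..<int L} x - erg_sum \<phi> {0..<int L} y\<bar> \<le> \<epsilon> * real L"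
    proof -
      have "\<bar>erg_sum \<phi> {0..<int m} x\<bar> + \<bar>erg_sum \<phi> {int L - int m..<int L} x\<bar> \<le> 2 * real m * M"
        using edge[of 0 x] xy(1) by simp
      moreover have "erg_sum \<phi> {0..<int L} x = erg_sum \<phi> {0..<int m} x
          + erg_sum \<phi> {int m..<int L - int m} x + erg_sum \<phi> {int L - int m..<int L} x"
        using sp[of 0 x] by simp
      moreover have "\<epsilon> * real L = \<epsilon> / 2 * real L + \<epsilon> / 2 * real L" by simp
      moreover have "4 * real m * M = 2 * real m * M + 2 * real m * M" by simp
      moreover note mid edge[OF sm xy(2)] sp[OF sm, of y] \<open>4 * real m * M \<le> \<epsilon> / 2 * real L\<close>
      ultimately show ?thesis by linarith
    qed
    then show "\<bar>erg_sum \<phi> {a..<a + int L} x0 - erg_sum \<phi> {b..<b + int L} y0\<bar> \<le> \<epsilon> * real L"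
      by (simp add: x_def y_def erg_sum_shift_interval add.commute)
  qed
qed

text \<open>The block length \<open>L\<close> is so large that boundary effects cost at most \<open>\<epsilon>\<close> per site.\<close>

definition refillable :: "real \<Rightarrow> nat \<Rightarrow> bool" where
  "refillable \<epsilon> L \<longleftrightarrow> L \<ge> 2 * D \<and>
    (\<forall>x\<in>X. \<forall>y\<in>X. \<forall>a b s. s \<le> D \<longrightarrow>
      (\<forall>k. int D \<le> k \<longrightarrow> k < int L - int D \<longrightarrow> x (a + k) = y (b + k + int s)) \<longrightarrow>
      \<bar>erg_sum \<phi> {a..<a + int L} x - erg_sum \<phi> {b..<b + int L} y\<bar> \<le> \<epsilon> * real L) \<and>
    (\<forall>x\<in>X. \<forall>y\<in>X. \<forall>a K. (\<forall>k. k < a \<or> k \<ge> a + int L \<longrightarrow> x k = y k) \<longrightarrow> finite K \<longrightarrow>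
      K \<inter> {a..<a + int L} = {} \<longrightarrow> (\<Sum>k\<in>K. \<bar>\<phi> (shift k x) - \<phi> (shift k y)\<bar>) \<le> \<epsilon> * real L)"

lemma refillable_eventually:
  assumes "\<epsilon> > 0"
  obtains n0 where "\<And>L. L \<ge> n0 \<Longrightarrow> refillable \<epsilon> L"
proof -
  obtain n1 where n1: "\<And>L x y a b s. L \<ge> n1 \<Longrightarrow> x \<in> X \<Longrightarrow> y \<in> X \<Longrightarrow> s \<le> D \<Longrightarrow>
    (\<And>k. int D \<le> k \<Longrightarrow> k < int L - int D \<Longrightarrow> x (a + k) = y (b + k + int s)) \<Longrightarrow>
    \<bar>erg_sum \<phi> {a..<a + int L} x - erg_sum \<phi> {b..<b + int L} y\<bar> \<le> \<epsilon> * real L"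
    using distortion[OF assms] by blast
  obtain n2 where n2: "\<forall>n\<ge>n2. \<forall>x\<in>X. \<forall>y\<in>X. \<forall>a K.
      (\<forall>k. k < a \<or> k \<ge> a + int n \<longrightarrow> x k = y k) \<longrightarrow> finite K \<longrightarrow> K \<inter> {a..<a + int n} = {} \<longrightarrow>
      (\<Sum>k\<in>K. \<bar>\<phi> (shift k x) - \<phi> (shift k y)\<bar>) \<le> \<epsilon> * real n"
    using influence[OF assms] ..
  show thesis
  proof (rule that[of "max (2 * D) (max n1 n2)"])
    fix L assume L: "L \<ge> max (2 * D) (max n1 n2)"
    show "refillable \<epsilon> L"
      unfolding refillable_def
    proof (intro conjI ballI allI impI)
      fix x y a b s
      assume "x \<in> X" "y \<in> X" "s \<le> D"
        "\<forall>k. int D \<le> k \<longrightarrow> k < int L - int D \<longrightarrow> x (a + k) = y (b + k + int s)"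
      then show "\<bar>erg_sum \<phi> {a..<a + int L} x - erg_sum \<phi> {b..<b + int L} y\<bar> \<le> \<epsilon> * real L"
        using L by (intro n1) auto
    next
      fix x y a K
      assume "x \<in> X" "y \<in> X" "\<forall>k. k < a \<or> k \<ge> a + int L \<longrightarrow> x k = y k" "finite K"
        "K \<inter> {a..<a + int L} = {}"
      then show "(\<Sum>k\<in>K. \<bar>\<phi> (shift k x) - \<phi> (shift k y)\<bar>) \<le> \<epsilon> * real L"
        using L by (intro n2[rule_format]) auto
    qed (use L in simp)
  qed
qed

text \<open>An exchange balance: up to errors, the weight of \<open>w\<close> times that of the
  inserted piece of \<open>y\<close> is at most the weight of \<open>w'\<close> times that of the
  removed piece. One error \<open>\<epsilon> * L\<close> stems from the sites outside the block and
  one from the inserted piece, which is reproduced only up to margins and translation; the factor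
  \<open>2\<close> stems from the nearly optimal point \<open>x\<close>.\<close>

lemma refill_word:
  assumes R: "refillable \<epsilon> L" and K: "finite K" "{a..<a + int L} \<subseteq> K"
    and w: "w \<in> J K ` X" and y: "y \<in> X"
  shows "\<exists>w'\<in>J K ` X. \<exists>s\<le>D. (\<forall>k\<in>K - {a..<a + int L}. w' k = w k) \<and>
      (\<forall>k. int D \<le> k \<and> k < int L - int D \<longrightarrow> w' (a + k) = y (b + k + int s)) \<and>
      cyl_weight X \<phi> K w * exp (erg_sum \<phi> {b..<b + int L} y)
        \<le> 2 * exp (2 * \<epsilon> * real L) * cyl_weight X \<phi> K w'
          * cyl_weight X \<phi> {a..<a + int L} (J {a..<a + int L} w)"
proof -
  let ?I = "{a..<a + int L}" and ?B = "{b..<b + int L}" and ?W = "cyl_weight X \<phi> K"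
  obtain x where x: "x \<in> X" "J K x = w" "?W w \<le> 2 * exp (erg_sum \<phi> K x)"
    using weight_near_max[OF w] .
  have L: "L \<ge> 2 * D" using R by (simp add: refillable_def)
  obtain x' s where x': "x' \<in> X" "s \<le> D" "\<forall>k. k < a \<or> k \<ge> a + int L \<longrightarrow> x' k = x k"
      "\<forall>k. int D \<le> k \<and> k < int L - int D \<longrightarrow> x' (a + k) = y (b + k + int s)"
    using filling[OF x(1) y L] by blast
  have "\<bar>erg_sum \<phi> ?I x' - erg_sum \<phi> ?B y\<bar> \<le> \<epsilon> * real L"
    using R x' y unfolding refillable_def by blast
  moreover have "\<bar>erg_sum \<phi> (K - ?I) x - erg_sum \<phi> (K - ?I) x'\<bar> \<le> \<epsilon> * real L"
  proof -
    have "\<bar>erg_sum \<phi> (K - ?I) x - erg_sum \<phi> (K - ?I) x'\<bar>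
        \<le> (\<Sum>k\<in>K - ?I. \<bar>\<phi> (shift k x) - \<phi> (shift k x')\<bar>)"
      by (simp add: erg_sum_def flip: sum_subtractf)
    also have "\<dots> \<le> \<epsilon> * real L"
    proof -
      have "\<forall>k. k < a \<or> k \<ge> a + int L \<longrightarrow> x k = x' k" "finite (K - ?I)" "(K - ?I) \<inter> ?I = {}"
        using x'(3) K(1) by auto
      then show ?thesis using R x(1) x'(1) unfolding refillable_def by blast
    qed
    finally show ?thesis .
  qed
  ultimately have e: "erg_sum \<phi> K x + erg_sum \<phi> ?B y
      \<le> 2 * \<epsilon> * real L + erg_sum \<phi> K x' + erg_sum \<phi> ?I x"
    using erg_sum_diff[OF K, of \<phi> x] erg_sum_diff[OF K, of \<phi> x'] by argo
  have "?W w * exp (erg_sum \<phi> ?B y) \<le> 2 * exp (erg_sum \<phi> K x) * exp (erg_sum \<phi> ?B y)"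
    using x(3) by (rule mult_right_mono) simp
  also have "\<dots> = 2 * exp (erg_sum \<phi> K x + erg_sum \<phi> ?B y)"
    by (simp add: exp_add)
  also have "\<dots> \<le> 2 * exp (2 * \<epsilon> * real L + erg_sum \<phi> K x' + erg_sum \<phi> ?I x)"
    using e by simp
  also have "\<dots> = 2 * exp (2 * \<epsilon> * real L) * exp (erg_sum \<phi> K x') * exp (erg_sum \<phi> ?I x)"
    by (simp add: exp_add)
  also have "\<dots> \<le> 2 * exp (2 * \<epsilon> * real L) * ?W (J K x') * cyl_weight X \<phi> ?I (J ?I x)"
    using x(1) x'(1) by (intro mult_mono weight_ge mult_nonneg_nonneg less_imp_le[OF weight_pos]) auto
  also have "J ?I x = J ?I w" using K(2) x(2) by auto
  finally have bound: "?W w * exp (erg_sum \<phi> ?B y)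
      \<le> 2 * exp (2 * \<epsilon> * real L) * ?W (J K x') * cyl_weight X \<phi> ?I (J ?I w)" .
  have "\<forall>k\<in>K - ?I. J K x' k = w k" using x'(3) x(2) by auto
  moreover have "J K x' (a + k) = y (b + k + int s)" if "int D \<le> k" "k < int L - int D" for k
  proof -
    have "a + k \<in> K" using that by (intro subsetD[OF K(2)]) auto
    then show ?thesis using x'(4) that by simp
  qed
  ultimately show ?thesis using bound x'(1,2) by (intro bexI[of _ "J K x'"] exI[of _ s]) auto
qed

text \<open>At most this many words are refilled to the same word: for each of the \<open>D + 1\<close> possible
  shifts, all but \<open>3 * D\<close> of their symbols can be read off.\<close>

definition refill_mult :: real where
  "refill_mult = real (D + 1) * real (CARD('a) ^ (3 * D))"

lemma refill_mult_pos: "refill_mult > 0"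
  by (simp add: refill_mult_def)

text \<open>A pair of a word \<open>w\<close> with the prescribed content of the block and an
  arbitrary content \<open>v\<close> is mapped to \<open>w\<close> refilled by \<open>v\<close>. As
  \<open>h\<close> is an arbitrary weight on the exterior, the result bounds the probability of the
  content conditionally on the exterior. The constant \<open>4\<close> comes from two nearly optimal
  points, and \<open>3 * \<epsilon>\<close> from the two errors of refilling and the comparison of
  the removed word with \<open>x0\<close>.\<close>

lemma occurrence_upper:
  fixes h :: "(int \<Rightarrow> 'a) \<Rightarrow> real"
  assumes R: "refillable \<epsilon> L" and x0: "x0 \<in> X" and K: "finite K" "{a..<a + int L} \<subseteq> K"
    and h0: "\<And>w. w \<in> J K ` X \<Longrightarrow> h w \<ge> 0"
    and hl: "\<And>w w'. w \<in> J K ` X \<Longrightarrow> w' \<in> J K ` X \<Longrightarrow>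
      (\<And>k. k \<in> K - {a..<a + int L} \<Longrightarrow> w k = w' k) \<Longrightarrow> h w = h w'"
  shows "(\<Sum>w\<in>{w \<in> J K ` X. \<forall>k. 0 \<le> k \<and> k < int L \<longrightarrow> w (a + k) = x0 (b + k)}.
        cyl_weight X \<phi> K w * h w) * part_fun X \<phi> {b..<b + int L}
      \<le> 4 * refill_mult * exp (erg_sum \<phi> {b..<b + int L} x0 + 3 * \<epsilon> * real L)
        * (\<Sum>w\<in>J K ` X. cyl_weight X \<phi> K w * h w)"
proof -
  let ?I = "{a..<a + int L}" and ?B = "{b..<b + int L}"
  let ?W = "cyl_weight X \<phi> K" and ?V = "cyl_weight X \<phi> ?B"
  define \<Omega> where "\<Omega> = {w \<in> J K ` X. \<forall>k. 0 \<le> k \<and> k < int L \<longrightarrow> w (a + k) = x0 (b + k)}"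
  define C where "C = 4 * exp (erg_sum \<phi> ?B x0 + 3 * \<epsilon> * real L)"
  have "\<exists>w'\<in>J K ` X. \<exists>s\<le>D. (\<forall>k\<in>K - ?I. w' k = w k) \<and>
      (\<forall>j. int D \<le> j \<and> j < int L - int D \<longrightarrow> w' (a + j) = v (b + j + int s) \<or> b + j + int s \<notin> ?B) \<and>
      ?W w * ?V v \<le> C * ?W w'" if w: "w \<in> \<Omega>" and v: "v \<in> J ?B ` X" for w v
  proof -
    have wK: "w \<in> J K ` X" using w by (simp add: \<Omega>_def)
    obtain y where y: "y \<in> X" "J ?B y = v" "?V v \<le> 2 * exp (erg_sum \<phi> ?B y)"
      using weight_near_max[OF v] .
    obtain w' s where w': "w' \<in> J K ` X" "s \<le> D" "\<forall>k\<in>K - ?I. w' k = w k"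
        "\<forall>k. int D \<le> k \<and> k < int L - int D \<longrightarrow> w' (a + k) = y (b + k + int s)"
        "?W w * exp (erg_sum \<phi> ?B y) \<le> 2 * exp (2 * \<epsilon> * real L) * ?W w'
          * cyl_weight X \<phi> ?I (J ?I w)"
      using refill_word[OF R K wK y(1), of b] by blast
    have Iw: "cyl_weight X \<phi> ?I (J ?I w) \<le> exp (erg_sum \<phi> ?B x0 + \<epsilon> * real L)"
    proof (rule weight_le)
      show "J ?I w \<in> J ?I ` X" using wK K(2) by auto
      fix x assume x: "x \<in> X" "J ?I x = J ?I w"
      have "\<forall>k. int D \<le> k \<longrightarrow> k < int L - int D \<longrightarrow> x (a + k) = x0 (b + k + int 0)"
        using w x(2) by (auto simp: J_eq_iff \<Omega>_def)
      then have "\<bar>erg_sum \<phi> ?I x - erg_sum \<phi> ?B x0\<bar> \<le> \<epsilon> * real L"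
        using R x(1) x0 unfolding refillable_def by blast
      then show "exp (erg_sum \<phi> ?I x) \<le> exp (erg_sum \<phi> ?B x0 + \<epsilon> * real L)" by simp
    qed
    have "?W w * ?V v \<le> ?W w * (2 * exp (erg_sum \<phi> ?B y))"
      using y(3) by (intro mult_left_mono less_imp_le[OF weight_pos[OF wK]])
    also have "\<dots> \<le> 2 * (2 * exp (2 * \<epsilon> * real L) * ?W w' * cyl_weight X \<phi> ?I (J ?I w))"
      using w'(5) by (simp add: mult_ac)
    also have "\<dots> \<le> 2 * (2 * exp (2 * \<epsilon> * real L) * ?W w' * exp (erg_sum \<phi> ?B x0 + \<epsilon> * real L))"
      using Iw weight_pos[OF w'(1)] by (intro mult_left_mono) auto
    also have "\<dots> = 4 * (exp (2 * \<epsilon> * real L) * exp (erg_sum \<phi> ?B x0 + \<epsilon> * real L)) * ?W w'"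
      by simp
    also have "exp (2 * \<epsilon> * real L) * exp (erg_sum \<phi> ?B x0 + \<epsilon> * real L)
        = exp (erg_sum \<phi> ?B x0 + 3 * \<epsilon> * real L)"
      by (simp add: algebra_simps flip: exp_add)
    finally have "?W w * ?V v \<le> C * ?W w'" by (simp add: C_def)
    moreover have "w' (a + j) = v (b + j + int s) \<or> b + j + int s \<notin> ?B"
      if "int D \<le> j \<and> j < int L - int D" for j
      using w'(4) that y(2) by auto
    ultimately show ?thesis using w'(1-3) by blast
  qed
  then obtain wf sf where f: "\<And>w v. w \<in> \<Omega> \<Longrightarrow> v \<in> J ?B ` X \<Longrightarrow> wf w v \<in> J K ` X \<and> sf w v \<le> D \<and>
      (\<forall>k\<in>K - ?I. wf w v k = w k) \<and>
      (\<forall>j. int D \<le> j \<and> j < int L - int D \<longrightarrow>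
        wf w v (a + j) = v (b + j + int (sf w v)) \<or> b + j + int (sf w v) \<notin> ?B) \<and>
      ?W w * ?V v \<le> C * ?W (wf w v)" by metis
  \<comment> \<open>With translation \<open>s\<close> the symbols of \<open>v\<close> at the sites
    from \<open>b + D + s\<close> to \<open>b + L - D + s - 1\<close> survive. For all
    \<open>s \<le> D\<close> these include the sites from \<open>b + 2 * D\<close> to
    \<open>b + L - D - 1\<close>; \<open>Ed\<close> is what remains of the block, at most
    \<open>3 * D\<close> sites.\<close>
  define Ed where "Ed = {b..<b + 2 * int D} \<union> {b + int L - int D..<b + int L}"
  define F where "F = (\<lambda>(w, v). (wf w v, sf w v, J Ed v))"
  have S0: "0 \<le> (\<Sum>w\<in>J K ` X. ?W w * h w)"
    by (intro mult_nonneg_nonneg sum_nonneg h0 less_imp_le[OF weight_pos])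
  have "(\<Sum>p\<in>\<Omega> \<times> J ?B ` X. ?W (fst p) * h (fst p) * ?V (snd p))
      \<le> (\<Sum>q\<in>J K ` X \<times> {..D} \<times> J Ed ` X. C * (?W (fst q) * h (fst q)))"
  proof (rule sum_le_sum_inj_on[where f = F])
    show "finite (J K ` X \<times> {..D} \<times> J Ed ` X)" using K by (auto simp: Ed_def)
    show "F ` (\<Omega> \<times> J ?B ` X) \<subseteq> J K ` X \<times> {..D} \<times> J Ed ` X"
    proof (rule image_subsetI)
      fix p assume "p \<in> \<Omega> \<times> J ?B ` X"
      then obtain w z where w: "p = (w, J ?B z)" "w \<in> \<Omega>" "z \<in> X" by auto
      have "Ed \<subseteq> ?B" using R by (auto simp: Ed_def refillable_def)
      then have "J Ed (J ?B z) = J Ed z" by simp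
      then show "F p \<in> J K ` X \<times> {..D} \<times> J Ed ` X"
        using f[of w "J ?B z"] w by (auto simp: F_def)
    qed
    \<comment> \<open>Outside the block \<open>w\<close> is visible in \<open>wf w v\<close>, and
      inside it is prescribed by \<open>x0\<close>. Once the translation is known, \<open>v\<close>
      too can be read off from \<open>wf w v\<close> at the sites outside \<open>Ed\<close>; on
      \<open>Ed\<close> it is recorded.\<close>
    show "inj_on F (\<Omega> \<times> J ?B ` X)"
    proof (rule inj_onI)
      fix p p' assume "p \<in> \<Omega> \<times> J ?B ` X" "p' \<in> \<Omega> \<times> J ?B ` X" and eq: "F p = F p'"
      then obtain w v w' v' where p: "p = (w, v)" "p' = (w', v')" "w \<in> \<Omega>" "w' \<in> \<Omega>"
          "v \<in> J ?B ` X" "v' \<in> J ?B ` X" by auto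
      have eqs: "wf w v = wf w' v'" "sf w v = sf w' v'" "J Ed v = J Ed v'"
        using eq p by (auto simp: F_def)
      note f1 = f[OF p(3,5)] and f2 = f[OF p(4,6)]
      have wk: "w k = w' k" if "k \<in> K" for k
      proof (cases "k \<in> ?I")
        case True
        then have "0 \<le> k - a \<and> k - a < int L" by auto
        then have "w (a + (k - a)) = x0 (b + (k - a))" "w' (a + (k - a)) = x0 (b + (k - a))"
          using p(3,4) unfolding \<Omega>_def by blast+
        then show ?thesis by simp
      next
        case False
        then have "wf w v k = w k" "wf w' v' k = w' k" using f1 f2 that by blast+
        then show ?thesis using eqs(1) by simp
      qed
      have "J K w = J K w'" using wk by (simp add: J_eq_iff)
      then have "w = w'" using p(3,4) by (auto simp: \<Omega>_def)
      have vk: "v k = v' k" if "k \<in> ?B" for k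
      proof (cases "k \<in> Ed")
        case True
        then show ?thesis using eqs(3) by (auto simp: J_eq_iff)
      next
        case False
        define j where "j = k - b - int (sf w v)"
        have kj: "b + j + int (sf w v) = k" "b + j + int (sf w' v') = k"
          using eqs(2) by (simp_all add: j_def)
        have "int D \<le> j \<and> j < int L - int D" using False that f1 by (auto simp: j_def Ed_def)
        then have "wf w v (a + j) = v k" "wf w' v' (a + j) = v' k"
          using f1 f2 kj that by metis+
        then show ?thesis using eqs(1) by simp
      qed
      have "J ?B v = J ?B v'" using vk by (simp add: J_eq_iff)
      then have "v = v'" using p by auto
      then show "p = p'" using \<open>w = w'\<close> p by simp
    qed
  next
    fix p assume "p \<in> \<Omega> \<times> J ?B ` X"
    then obtain w v where p: "p = (w, v)" "w \<in> \<Omega>" "v \<in> J ?B ` X" by auto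
    have w\<Omega>: "w \<in> J K ` X" using p by (auto simp: \<Omega>_def)
    note f1 = f[OF p(2,3)]
    have "h w = h (wf w v)" by (rule hl[OF w\<Omega>]) (use f1 in auto)
    moreover have "h w * (?W w * ?V v) \<le> h w * (C * ?W (wf w v))"
      using f1 h0[OF w\<Omega>] by (intro mult_left_mono) auto
    ultimately show "?W (fst p) * h (fst p) * ?V (snd p) \<le> C * (?W (fst (F p)) * h (fst (F p)))"
      using p by (simp add: F_def mult_ac)
  next
    fix q assume "q \<in> J K ` X \<times> {..D} \<times> J Ed ` X"
    then have "fst q \<in> J K ` X" by auto
    then have "?W (fst q) > 0" "h (fst q) \<ge> 0" using h0 weight_pos by blast+
    then show "0 \<le> C * (?W (fst q) * h (fst q))" by (simp add: C_def)
  qed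
  also have "(\<Sum>p\<in>\<Omega> \<times> J ?B ` X. ?W (fst p) * h (fst p) * ?V (snd p))
      = (\<Sum>w\<in>\<Omega>. ?W w * h w) * part_fun X \<phi> ?B"
    by (simp add: part_fun_def sum_product sum.cartesian_product split_def)
  also have "(\<Sum>q\<in>J K ` X \<times> {..D} \<times> J Ed ` X. C * (?W (fst q) * h (fst q)))
      = C * (\<Sum>w\<in>J K ` X. ?W w * h w) * (real (D + 1) * real (card (J Ed ` X)))"
  proof -
    have "(\<Sum>q\<in>J K ` X \<times> {..D} \<times> J Ed ` X. C * (?W (fst q) * h (fst q)))
        = (\<Sum>w\<in>J K ` X. \<Sum>r\<in>{..D} \<times> J Ed ` X. C * (?W w * h w))"
      by (simp only: sum.cartesian_product split_def)
    also have "\<dots> = (\<Sum>w\<in>J K ` X. C * (?W w * h w) * (real (D + 1) * real (card (J Ed ` X))))"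
      by (intro sum.cong) (simp_all add: card_cartesian_product algebra_simps)
    also have "\<dots> = C * (\<Sum>w\<in>J K ` X. ?W w * h w) * (real (D + 1) * real (card (J Ed ` X)))"
      unfolding sum_distrib_left sum_distrib_right ..
    finally show ?thesis .
  qed
  also have "\<dots> \<le> C * (\<Sum>w\<in>J K ` X. ?W w * h w) * refill_mult"
    unfolding refill_mult_def
  proof (intro mult_left_mono of_nat_mono)
    have "J Ed ` X \<subseteq> PiE Ed (\<lambda>_. UNIV :: 'a set)" by (auto simp: J_def)
    moreover have "finite (PiE Ed (\<lambda>_. UNIV :: 'a set))"
      by (rule finite_PiE) (simp_all add: Ed_def)
    ultimately have "card (J Ed ` X) \<le> card (PiE Ed (\<lambda>_. UNIV :: 'a set))"
      by (metis card_mono)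
    also have "\<dots> = CARD('a) ^ card Ed" by (simp add: card_PiE Ed_def)
    also have "\<dots> \<le> CARD('a) ^ (3 * D)"
    proof (rule power_increasing)
      have "card Ed \<le> card {b..<b + 2 * int D} + card {b + int L - int D..<b + int L}"
        unfolding Ed_def by (rule card_Un_le)
      then show "card Ed \<le> 3 * D" by simp
    qed (simp add: Suc_leI)
    finally show "card (J Ed ` X) \<le> CARD('a) ^ (3 * D)" .
    show "0 \<le> C * (\<Sum>w\<in>J K ` X. ?W w * h w)" using S0 by (simp add: C_def)
  qed simp
  finally show ?thesis by (simp add: \<Omega>_def C_def mult_ac)
qed

text \<open>Filling can place a word only up to margins of length \<open>D\<close> and a translation
  by at most \<open>D\<close>; this is the event that it is able to enforce.\<close>

definition occurs :: "nat \<Rightarrow> int \<Rightarrow> int \<Rightarrow> (int \<Rightarrow> 'a) \<Rightarrow> (int \<Rightarrow> 'a) \<Rightarrow> bool" where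
  "occurs L a b y w \<longleftrightarrow> (\<exists>s\<le>D. \<forall>k. int D \<le> k \<and> k < int L - int D \<longrightarrow>
    w (a + k) = y (b + k + int s))"

text \<open>Here the content of \<open>x0\<close> is inserted and the removed content is recorded in
  full, so the map is injective without further data; summing over the recorded words with their
  weights yields the factor \<open>part_fun\<close>. Again \<open>h\<close> acts as a condition on
  the exterior.\<close>

lemma occurrence_lower:
  fixes h :: "(int \<Rightarrow> 'a) \<Rightarrow> real"
  assumes R: "refillable \<epsilon> L" and x0: "x0 \<in> X" and K: "finite K" "{a..<a + int L} \<subseteq> K"
    and h0: "\<And>w. w \<in> J K ` X \<Longrightarrow> h w \<ge> 0"
    and hl: "\<And>w w'. w \<in> J K ` X \<Longrightarrow> w' \<in> J K ` X \<Longrightarrow>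
      (\<And>k. k \<in> K - {a..<a + int L} \<Longrightarrow> w k = w' k) \<Longrightarrow> h w = h w'"
  shows "(\<Sum>w\<in>J K ` X. cyl_weight X \<phi> K w * h w)
      * exp (erg_sum \<phi> {b..<b + int L} x0 - 2 * \<epsilon> * real L)
      \<le> 2 * part_fun X \<phi> {a..<a + int L} *
        (\<Sum>w\<in>{w \<in> J K ` X. occurs L a b x0 w}. cyl_weight X \<phi> K w * h w)"
proof -
  let ?I = "{a..<a + int L}" and ?B = "{b..<b + int L}"
  let ?W = "cyl_weight X \<phi> K" and ?V = "cyl_weight X \<phi> ?I"
  define \<Omega> where "\<Omega> = {w \<in> J K ` X. occurs L a b x0 w}"
  define c where "c = exp (erg_sum \<phi> ?B x0 - 2 * \<epsilon> * real L)"
  have "\<exists>w'\<in>\<Omega>. (\<forall>k\<in>K - ?I. w' k = w k) \<and> ?W w * c \<le> 2 * ?W w' * ?V (J ?I w)"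
    if w: "w \<in> J K ` X" for w
  proof -
    obtain w' s where w': "w' \<in> J K ` X" "s \<le> D" "\<forall>k\<in>K - ?I. w' k = w k"
        "\<forall>k. int D \<le> k \<and> k < int L - int D \<longrightarrow> w' (a + k) = x0 (b + k + int s)"
        "?W w * exp (erg_sum \<phi> ?B x0) \<le> 2 * exp (2 * \<epsilon> * real L) * ?W w' * ?V (J ?I w)"
      using refill_word[OF R K w x0, of b] by blast
    have "?W w * c = ?W w * exp (erg_sum \<phi> ?B x0) / exp (2 * \<epsilon> * real L)"
      by (simp add: c_def exp_diff)
    also have "\<dots> \<le> 2 * exp (2 * \<epsilon> * real L) * ?W w' * ?V (J ?I w) / exp (2 * \<epsilon> * real L)"
      using w'(5) by (rule divide_right_mono) simp
    finally show ?thesis using w' by (intro bexI[of _ w']) (auto simp: \<Omega>_def occurs_def)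
  qed
  then obtain wf where f: "\<And>w. w \<in> J K ` X \<Longrightarrow> wf w \<in> \<Omega> \<and> (\<forall>k\<in>K - ?I. wf w k = w k) \<and>
      ?W w * c \<le> 2 * ?W (wf w) * ?V (J ?I w)" by metis
  have "(\<Sum>w\<in>J K ` X. ?W w * h w * c) \<le> (\<Sum>q\<in>\<Omega> \<times> J ?I ` X. 2 * (?W (fst q) * h (fst q) * ?V (snd q)))"
  proof (rule sum_le_sum_inj_on[where f = "\<lambda>w. (wf w, J ?I w)"])
    show "finite (\<Omega> \<times> J ?I ` X)" using K by (auto simp: \<Omega>_def)
    show "(\<lambda>w. (wf w, J ?I w)) ` J K ` X \<subseteq> \<Omega> \<times> J ?I ` X"
    proof (rule image_subsetI)
      fix w assume w: "w \<in> J K ` X"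
      then have "J ?I w \<in> J ?I ` X" using K(2) by auto
      then show "(wf w, J ?I w) \<in> \<Omega> \<times> J ?I ` X" using f[OF w] by blast
    qed
    show "inj_on (\<lambda>w. (wf w, J ?I w)) (J K ` X)"
    proof (rule inj_onI)
      fix w w'
      assume w: "w \<in> J K ` X" "w' \<in> J K ` X" and eq: "(wf w, J ?I w) = (wf w', J ?I w')"
      have "w k = w' k" if "k \<in> K" for k
      proof (cases "k \<in> ?I")
        case True
        then show ?thesis using eq by (auto simp: J_eq_iff)
      next
        case False
        then have "wf w k = w k" "wf w' k = w' k" using f w that by blast+
        then show ?thesis using eq by simp
      qed
      then have "J K w = J K w'" by (simp add: J_eq_iff)
      then show "w = w'" using w by auto
    qed
  next
    fix w assume w: "w \<in> J K ` X"
    have "wf w \<in> J K ` X" using f[OF w] by (simp add: \<Omega>_def)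
    then have "h w = h (wf w)" by (rule hl[OF w]) (use f[OF w] in auto)
    moreover have "h w * (?W w * c) \<le> h w * (2 * ?W (wf w) * ?V (J ?I w))"
      using f[OF w] h0[OF w] by (intro mult_left_mono) auto
    ultimately show "?W w * h w * c \<le> 2 * (?W (fst (wf w, J ?I w)) * h (fst (wf w, J ?I w))
        * ?V (snd (wf w, J ?I w)))"
      by (simp add: mult_ac)
  next
    fix q assume "q \<in> \<Omega> \<times> J ?I ` X"
    then have "fst q \<in> J K ` X" "snd q \<in> J ?I ` X" by (auto simp: \<Omega>_def)
    then have "?W (fst q) > 0" "?V (snd q) > 0" "h (fst q) \<ge> 0"
      using h0 weight_pos by blast+
    then show "0 \<le> 2 * (?W (fst q) * h (fst q) * ?V (snd q))" by simp
  qed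
  also have "\<dots> = 2 * (\<Sum>q\<in>\<Omega> \<times> J ?I ` X. ?W (fst q) * h (fst q) * ?V (snd q))"
    by (rule sum_distrib_left[symmetric])
  also have "(\<Sum>q\<in>\<Omega> \<times> J ?I ` X. ?W (fst q) * h (fst q) * ?V (snd q))
      = (\<Sum>w\<in>\<Omega>. ?W w * h w) * part_fun X \<phi> ?I"
    by (simp add: part_fun_def sum_product sum.cartesian_product split_def)
  finally show ?thesis by (simp add: \<Omega>_def c_def sum_distrib_right mult_ac)
qed

end

section \<open>Pressure under perturbation by a cylinder function\<close>

text \<open>Induction over the blocks: the product over those already treated does not depend on the
  content of the next one and takes the place of \<open>h\<close> in its estimate. This is the
  reason for the arbitrary \<open>h\<close> in the one-block estimates.\<close>

lemma sum_prod_blocks: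
  fixes W :: "(int \<Rightarrow> 'a) \<Rightarrow> real" and g :: "'i \<Rightarrow> (int \<Rightarrow> 'a) \<Rightarrow> real"
  assumes "finite T"
    and step: "\<And>a h. a \<in> T \<Longrightarrow> (\<And>w. w \<in> U \<Longrightarrow> h w \<ge> 0) \<Longrightarrow>
      (\<And>w w'. w \<in> U \<Longrightarrow> w' \<in> U \<Longrightarrow> (\<And>k. k \<in> K - I a \<Longrightarrow> w k = w' k) \<Longrightarrow> h w = h w') \<Longrightarrow>
      (\<Sum>w\<in>U. W w * h w * g a w) \<le> c * (\<Sum>w\<in>U. W w * h w)"
    and disj: "\<And>a a'. a \<in> T \<Longrightarrow> a' \<in> T \<Longrightarrow> a \<noteq> a' \<Longrightarrow> I a \<inter> I a' = {}"
    and sub: "\<And>a. a \<in> T \<Longrightarrow> I a \<subseteq> K"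
    and g_local: "\<And>a w w'. a \<in> T \<Longrightarrow> w \<in> U \<Longrightarrow> w' \<in> U \<Longrightarrow> (\<And>k. k \<in> I a \<Longrightarrow> w k = w' k) \<Longrightarrow> g a w = g a w'"
    and g0: "\<And>a w. a \<in> T \<Longrightarrow> w \<in> U \<Longrightarrow> g a w \<ge> 0" and c0: "c \<ge> 0"
  shows "(\<Sum>w\<in>U. W w * (\<Prod>a\<in>T. g a w)) \<le> c ^ card T * sum W U"
proof -
  have "(\<Sum>w\<in>U. W w * (\<Prod>a\<in>T'. g a w)) \<le> c ^ card T' * sum W U" if "finite T'" "T' \<subseteq> T" for T'
    using that
  proof (induction T')
    case (insert a T')
    have "(\<Sum>w\<in>U. W w * (\<Prod>a\<in>insert a T'. g a w)) = (\<Sum>w\<in>U. W w * (\<Prod>a\<in>T'. g a w) * g a w)"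
      using insert.hyps by (intro sum.cong) (simp_all add: mult_ac)
    also have "\<dots> \<le> c * (\<Sum>w\<in>U. W w * (\<Prod>a\<in>T'. g a w))"
    proof (rule step)
      show "a \<in> T" using insert.prems by simp
      show "(\<Prod>a\<in>T'. g a w) \<ge> 0" if "w \<in> U" for w
        using that g0 insert.prems by (intro prod_nonneg) auto
      fix w w' assume w: "w \<in> U" "w' \<in> U" "\<And>k. k \<in> K - I a \<Longrightarrow> w k = w' k"
      show "(\<Prod>a\<in>T'. g a w) = (\<Prod>a\<in>T'. g a w')"
      proof (rule prod.cong)
        fix a' assume a': "a' \<in> T'"
        then have T: "a' \<in> T" "a \<in> T" "a \<noteq> a'" using insert by auto
        show "g a' w = g a' w'"
          using disj[OF T(2,1,3)] sub[OF T(1)] by (intro g_local T w) blast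
      qed simp
    qed
    also have "\<dots> \<le> c * (c ^ card T' * sum W U)"
      using insert c0 by (intro mult_left_mono) auto
    finally show ?case using insert.hyps by (simp add: mult_ac)
  qed simp
  then show ?thesis using assms(1) by simp
qed

lemma exp_average_le:
  fixes t :: "int \<Rightarrow> real"
  assumes "L > 0"
  shows "exp ((\<Sum>r\<in>{0..<int L}. t r) / real L) \<le> (\<Sum>r\<in>{0..<int L}. exp (t r)) / real L"
proof -
  have "convex_on UNIV (exp :: real \<Rightarrow> real)" by (rule exp_convex)
  then have "exp (\<Sum>r\<in>{0..<int L}. (1 / real L) *\<^sub>R t r) \<le> (\<Sum>r\<in>{0..<int L}. (1 / real L) * exp (t r))"
    using assms by (intro convex_on_sum) auto
  then show ?thesis by (simp add: sum_divide_distrib)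
qed

definition block_starts :: "nat \<Rightarrow> nat \<Rightarrow> int \<Rightarrow> int set" where
  "block_starts N L r = {a. 0 \<le> a \<and> a + int L \<le> int N \<and> a mod int L = r}"

lemma finite_block_starts [simp]: "finite (block_starts N L r)"
  by (rule finite_subset[of _ "{0..int N}"]) (auto simp: block_starts_def)

lemma block_starts_disjoint:
  assumes "a \<in> block_starts N L r" "a' \<in> block_starts N L r" "a \<noteq> a'" "L > 0"
  shows "{a..<a + int L} \<inter> {a'..<a' + int L} = {}"
proof -
  have "a mod int L = a' mod int L" using assms by (simp add: block_starts_def)
  then have "int L dvd a - a'" by (simp add: mod_eq_dvd_iff)
  then have "int L \<le> \<bar>a - a'\<bar>" using assms(3) by (meson dvd_abs_iff eq_iff_diff_eq_0 zdvd_imp_le zero_less_abs_iff)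
  then show ?thesis by auto
qed

lemma card_block_starts:
  assumes "L > 0"
  shows "card (block_starts N L r) * L \<le> N"
proof -
  have "card (\<Union>a\<in>block_starts N L r. {a..<a + int L}) = (\<Sum>a\<in>block_starts N L r. card {a..<a + int L})"
    using block_starts_disjoint[OF _ _ _ assms] by (intro card_UN_disjoint) auto
  also have "\<dots> = card (block_starts N L r) * L" by simp
  finally have "card (block_starts N L r) * L = card (\<Union>a\<in>block_starts N L r. {a..<a + int L})" ..
  also have "\<dots> \<le> card {0..<int N}" by (intro card_mono) (auto simp: block_starts_def)
  finally show ?thesis by simp
qed

lemma card_block_starts_0:
  assumes "L > 0"
  shows "real (card (block_starts N L 0)) \<ge> real N / real L - 1"
proof -
  have "(\<lambda>i. int i * int L) ` {..<N div L} \<subseteq> block_starts N L 0"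
  proof clarify
    fix i assume "i < N div L"
    then have "Suc i * L \<le> N div L * L" by (intro mult_le_mono1) simp
    also have "\<dots> \<le> N" by simp
    finally have "int (Suc i * L) \<le> int N" by (simp only: of_nat_le_iff)
    then show "int i * int L \<in> block_starts N L 0" by (simp add: block_starts_def algebra_simps)
  qed
  then have "card ((\<lambda>i. int i * int L) ` {..<N div L}) \<le> card (block_starts N L 0)"
    by (intro card_mono) auto
  then have "N div L \<le> card (block_starts N L 0)"
    using assms by (subst (asm) card_image) (auto simp: inj_on_def)
  moreover have "real N / real L \<le> real (N div L) + 1"
    using floor_divide_of_nat_eq[where ?'a = real, of N L] by linarith
  ultimately show ?thesis by linarith
qed

context block_filling
begin

text \<open>The constant \<open>C\<close> absorbs what happens at the ends of the volume; it
  disappears on division by \<open>N\<close>.\<close>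

lemma pressure_mono_limit:
  assumes "observable X \<psi> M'"
    and le: "\<And>N. N \<ge> 1 \<Longrightarrow> part_fun X \<psi> {0..<int N}
      \<le> exp (C + d * real N) * part_fun X \<phi> {0..<int N}"
  shows "pressure X \<psi> \<le> pressure X \<phi> + d"
proof -
  interpret \<psi>: observable X \<psi> M' by (rule assms(1))
  have "(\<lambda>N. ln (part_fun X \<phi> {0..<int N}) / real N + (C / real N + d))
      \<longlonglongrightarrow> pressure X \<phi> + (0 + d)"
    by (intro tendsto_add pressure_tendsto tendsto_const lim_const_over_n)
  then show ?thesis
  proof (intro LIMSEQ_le[OF \<psi>.pressure_tendsto])
    show "\<exists>N0. \<forall>N\<ge>N0. ln (part_fun X \<psi> {0..<int N}) / real N
        \<le> ln (part_fun X \<phi> {0..<int N}) / real N + (C / real N + d)"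
    proof (intro exI allI impI)
      fix N :: nat assume N: "N \<ge> 1"
      have "ln (part_fun X \<psi> {0..<int N})
          \<le> ln (exp (C + d * real N) * part_fun X \<phi> {0..<int N})"
        using le[OF N] \<psi>.part_fun_pos part_fun_pos
        by (subst ln_le_cancel_iff) auto
      also have "\<dots> = C + d * real N + ln (part_fun X \<phi> {0..<int N})"
        using part_fun_pos by (subst ln_mult_pos) auto
      finally have le: "ln (part_fun X \<psi> {0..<int N})
          \<le> C + d * real N + ln (part_fun X \<phi> {0..<int N})" .
      show "ln (part_fun X \<psi> {0..<int N}) / real N
        \<le> ln (part_fun X \<phi> {0..<int N}) / real N + (C / real N + d)"
      proof -
        have "ln (part_fun X \<psi> {0..<int N}) / real N
          \<le> (C + d * real N + ln (part_fun X \<phi> {0..<int N})) / real N"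
          using le by (rule divide_right_mono) simp
        then show ?thesis using N by (simp add: add_divide_distrib)
      qed
    qed
  qed simp
qed

lemma observable_add:
  assumes "\<And>x. x \<in> X \<Longrightarrow> \<bar>f x\<bar> \<le> c"
  shows "observable X (\<lambda>x. \<phi> x + f x) (M + c)"
proof
  fix x assume x: "x \<in> X"
  show "\<bar>\<phi> x + f x\<bar> \<le> M + c" using bound[OF x] assms[OF x] by linarith
qed (use inv nonempty in auto)

lemma erg_sum_add:
  "erg_sum (\<lambda>x. \<phi> x + f x) K x = erg_sum \<phi> K x + erg_sum f K x"
  by (simp add: erg_sum_def sum.distrib)

text \<open>\<open>erg_sum f K\<close> may read symbols outside \<open>K\<close> and then is not a
  function of the word on \<open>K\<close>. A bound \<open>G\<close> that is one reduces the
  perturbed sum to the unperturbed weights, to which the one-block estimates apply.\<close>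

lemma part_fun_perturb:
  assumes c: "\<And>x. x \<in> X \<Longrightarrow> \<bar>f x\<bar> \<le> c"
    and G: "\<And>x. x \<in> X \<Longrightarrow> exp (erg_sum f K x) \<le> G (J K x)"
    and G0: "\<And>w. w \<in> J K ` X \<Longrightarrow> G w \<ge> 0"
  shows "part_fun X (\<lambda>x. \<phi> x + f x) K \<le> (\<Sum>w\<in>J K ` X. cyl_weight X \<phi> K w * G w)"
proof -
  interpret \<psi>: observable X "\<lambda>x. \<phi> x + f x" "M + c"
    using c by (rule observable_add)
  show ?thesis
    unfolding part_fun_def
  proof (intro sum_mono \<psi>.weight_le)
    fix w x assume w: "w \<in> J K ` X" "x \<in> X" "J K x = w"
    have "exp (erg_sum (\<lambda>x. \<phi> x + f x) K x) = exp (erg_sum \<phi> K x) * exp (erg_sum f K x)"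
      by (simp add: erg_sum_add exp_add)
    also have "\<dots> \<le> cyl_weight X \<phi> K w * G w"
      using weight_ge[OF w(2), of K] G[OF w(2)] w(3) weight_pos[OF w(1)]
      by (intro mult_mono) (auto simp: less_imp_le)
    finally show "exp (erg_sum (\<lambda>x. \<phi> x + f x) K x) \<le> cyl_weight X \<phi> K w * G w" .
  qed auto
qed

text \<open>By convexity of the exponential it suffices to consider the occurrences at positions in a
  fixed residue class modulo the length of the word, which do not overlap.\<close>

lemma pressure_add_cylinder_le:
  assumes R: "refillable \<epsilon> L" and L: "L > 0" and x0: "x0 \<in> X" and b: "- int L \<le> b" "b \<le> 0"
  defines "p \<equiv> 4 * refill_mult * exp (erg_sum \<phi> {b..<b + int L} x0 + 3 * \<epsilon> * real L)
    / part_fun X \<phi> {b..<b + int L}"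
  shows "pressure X (\<lambda>x. \<phi> x + 1 / real L * of_bool (\<forall>k\<in>{b..<b + int L}. x k = x0 k))
    \<le> pressure X \<phi> + 2 * p / real L"
proof -
  have p0: "p \<ge> 0"
    unfolding p_def using part_fun_pos[of "{b..<b + int L}"] refill_mult_pos by simp
  define f where "f x = 1 / real L * of_bool (\<forall>k\<in>{b..<b + int L}. x k = x0 k)" for x
  have fb: "\<bar>f x\<bar> \<le> 1 / real L" for x by (simp add: f_def)
  have "pressure X (\<lambda>x. \<phi> x + f x) \<le> pressure X \<phi> + 2 * p / real L"
  proof (rule pressure_mono_limit)
    show "observable X (\<lambda>x. \<phi> x + f x) (M + 1 / real L)"
      using fb by (rule observable_add)
    fix N :: nat assume "N \<ge> 1"
    let ?K = "{0..<int N}"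
    let ?W = "cyl_weight X \<phi> ?K"
    define occ :: "int \<Rightarrow> (int \<Rightarrow> 'a) \<Rightarrow> real" where
      "occ a w = of_bool (\<forall>k. 0 \<le> k \<and> k < int L \<longrightarrow> w (a + k) = x0 (b + k))" for a w
    have occ01: "occ a w \<ge> 0" "occ a w \<le> 1" for a w by (auto simp: occ_def)
    define T where "T = block_starts N L"
    define A where "A = {a. 0 \<le> a \<and> a + int L \<le> int N}"
    have fA: "finite A" by (rule finite_subset[of _ "{0..int N}"]) (auto simp: A_def)
    have TA: "T r = {a \<in> A. a mod int L = r}" for r
      by (auto simp: T_def A_def block_starts_def)
    have sumf: "erg_sum f ?K x \<le> 1 + (\<Sum>r\<in>{0..<int L}. \<Sum>a\<in>T r. occ a (J ?K x)) / real L" for x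
    proof -
      have f_occ: "f (shift t x) = occ (t + b) x / real L" for t
      proof -
        have "(\<forall>k\<in>{b..<b + int L}. shift t x k = x0 k)
            \<longleftrightarrow> (\<forall>k. 0 \<le> k \<and> k < int L \<longrightarrow> x (t + b + k) = x0 (b + k))"
        proof (intro iffI ballI allI impI)
          fix k assume "\<forall>k\<in>{b..<b + int L}. shift t x k = x0 k" "0 \<le> k \<and> k < int L"
          then show "x (t + b + k) = x0 (b + k)"
            by (auto dest!: bspec[of _ _ "b + k"] simp: add_ac)
        next
          fix k assume "\<forall>k. 0 \<le> k \<and> k < int L \<longrightarrow> x (t + b + k) = x0 (b + k)" "k \<in> {b..<b + int L}"
          then show "shift t x k = x0 k"
            by (auto dest!: spec[of _ "k - b"] simp: add_ac)
        qed
        then show ?thesis by (simp add: f_def occ_def)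
      qed
      \<comment> \<open>Starting points of occurrences that stick out of the volume. There are at
        most \<open>L\<close> of them, each worth \<open>1 / L\<close>, so together they cost the
        summand \<open>1\<close> in \<open>sumf\<close>.\<close>
      define E where "E = {b..<0} \<union> {int N - int L + 1..<int N + b}"
      have "erg_sum f ?K x = (\<Sum>t\<in>?K. occ (t + b) x) / real L"
        by (simp add: erg_sum_def f_occ sum_divide_distrib)
      also have "(\<Sum>t\<in>?K. occ (t + b) x) = (\<Sum>a\<in>{b..<int N + b}. occ a x)"
        by (rule sum.reindex_bij_witness[of _ "\<lambda>a. a - b" "\<lambda>t. t + b"]) auto
      also have "\<dots> \<le> (\<Sum>a\<in>A \<union> E. occ a x)"
        using fA occ01 by (intro sum_mono2) (auto simp: A_def E_def)
      also have "\<dots> \<le> (\<Sum>a\<in>A. occ a x) + (\<Sum>a\<in>E. occ a x)"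
        using fA occ01 by (subst sum.union_inter[symmetric]) (auto simp: E_def intro!: sum_nonneg)
      also have "(\<Sum>a\<in>E. occ a x) \<le> of_nat (card E) * 1"
        using occ01 by (intro sum_bounded_above)
      also have "real (card E) \<le> real L"
      proof -
        have "card E \<le> card {b..<0} + card {int N - int L + 1..<int N + b}"
          unfolding E_def by (rule card_Un_le)
        also have "\<dots> \<le> L" using b L by simp
        finally show ?thesis by simp
      qed
      also have "(\<Sum>a\<in>A. occ a x) = (\<Sum>a\<in>A. occ a (J ?K x))"
        by (intro sum.cong) (auto simp: occ_def A_def)
      also have "\<dots> = (\<Sum>r\<in>{0..<int L}. \<Sum>a\<in>T r. occ a (J ?K x))"
        unfolding TA using fA L by (intro sum.group[symmetric]) auto
      finally have "erg_sum f ?K x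
          \<le> ((\<Sum>r\<in>{0..<int L}. \<Sum>a\<in>T r. occ a (J ?K x)) + real L * 1) / real L"
        by (simp add: divide_right_mono)
      then show ?thesis using L by (simp add: add_divide_distrib)
    qed
    have "part_fun X (\<lambda>x. \<phi> x + f x) ?K
        \<le> (\<Sum>w\<in>J ?K ` X. ?W w * (exp 1 / real L * (\<Sum>r\<in>{0..<int L}. \<Prod>a\<in>T r. exp (occ a w))))"
    proof (rule part_fun_perturb[OF fb])
      fix x assume "x \<in> X"
      have "exp (erg_sum f ?K x)
          \<le> exp 1 * exp ((\<Sum>r\<in>{0..<int L}. \<Sum>a\<in>T r. occ a (J ?K x)) / real L)"
        using sumf[of x] by (simp flip: exp_add)
      also have "\<dots> \<le> exp 1 * ((\<Sum>r\<in>{0..<int L}. exp (\<Sum>a\<in>T r. occ a (J ?K x))) / real L)"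
        using exp_average_le[OF L] by (intro mult_left_mono) auto
      also have "\<dots> = exp 1 / real L * (\<Sum>r\<in>{0..<int L}. \<Prod>a\<in>T r. exp (occ a (J ?K x)))"
        by (simp add: exp_sum T_def)
      finally show "exp (erg_sum f ?K x)
          \<le> exp 1 / real L * (\<Sum>r\<in>{0..<int L}. \<Prod>a\<in>T r. exp (occ a (J ?K x)))" .
    next
      show "0 \<le> exp 1 / real L * (\<Sum>r\<in>{0..<int L}. \<Prod>a\<in>T r. exp (occ a w))" for w
        by (intro mult_nonneg_nonneg sum_nonneg prod_nonneg) auto
    qed
    also have "\<dots> = exp 1 / real L * (\<Sum>r\<in>{0..<int L}. \<Sum>w\<in>J ?K ` X. ?W w * (\<Prod>a\<in>T r. exp (occ a w)))"
      by (simp add: sum_distrib_left sum.swap[of _ "{0..<int L}"] mult_ac)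
    also have "\<dots> \<le> exp 1 / real L * (\<Sum>r\<in>{0..<int L}. exp (2 * p / real L * real N)
        * part_fun X \<phi> ?K)"
    proof (intro mult_left_mono sum_mono)
      fix r
      have "(\<Sum>w\<in>J ?K ` X. ?W w * (\<Prod>a\<in>T r. exp (occ a w)))
          \<le> exp (2 * p) ^ card (T r) * sum ?W (J ?K ` X)"
      proof (rule sum_prod_blocks[where I = "\<lambda>a. {a..<a + int L}" and K = ?K])
        show "finite (T r)" by (simp add: T_def)
        show "{a..<a + int L} \<inter> {a'..<a' + int L} = {}" if "a \<in> T r" "a' \<in> T r" "a \<noteq> a'" for a a'
          using block_starts_disjoint that L by (simp add: T_def)
        show "{a..<a + int L} \<subseteq> ?K" if "a \<in> T r" for a
          using that by (auto simp: T_def block_starts_def)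
        show "exp (occ a w) = exp (occ a w')" if "\<And>k. k \<in> {a..<a + int L} \<Longrightarrow> w k = w' k" for a w w'
          using that by (simp add: occ_def)
      next
        fix a and h :: "(int \<Rightarrow> 'a) \<Rightarrow> real" assume a: "a \<in> T r" and h0: "\<And>w. w \<in> J ?K ` X \<Longrightarrow> h w \<ge> 0"
          and hl: "\<And>w w'. w \<in> J ?K ` X \<Longrightarrow> w' \<in> J ?K ` X \<Longrightarrow>
            (\<And>k. k \<in> ?K - {a..<a + int L} \<Longrightarrow> w k = w' k) \<Longrightarrow> h w = h w'"
        let ?S = "\<Sum>w\<in>J ?K ` X. ?W w * h w"
        have S0: "?S \<ge> 0"
          by (intro mult_nonneg_nonneg sum_nonneg h0 less_imp_le[OF weight_pos])
        \<comment> \<open>As \<open>occ\<close> is \<open>0\<close> or \<open>1\<close>, its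
          exponential is \<open>1 + (exp 1 - 1) * occ\<close>. With \<open>exp 1 - 1 \<le> 2\<close>
          and conditional probability at most \<open>p\<close>, each block costs a factor of at most
          \<open>1 + 2 * p \<le> exp (2 * p)\<close>.\<close>
        have "(\<Sum>w\<in>J ?K ` X. ?W w * h w * exp (occ a w))
            = (\<Sum>w\<in>J ?K ` X. ?W w * h w + (exp 1 - 1) * (?W w * h w * occ a w))"
          by (intro sum.cong) (auto simp: occ_def algebra_simps)
        also have "\<dots> = ?S + (exp 1 - 1) * (\<Sum>w\<in>J ?K ` X. ?W w * h w * occ a w)"
          by (simp add: sum.distrib sum_distrib_left)
        also have "\<dots> \<le> ?S + (exp 1 - 1) * (p * ?S)"
        proof -
          have "(\<Sum>w\<in>J ?K ` X. ?W w * h w * occ a w)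
              = (\<Sum>w\<in>{w \<in> J ?K ` X. \<forall>k. 0 \<le> k \<and> k < int L \<longrightarrow> w (a + k) = x0 (b + k)}. ?W w * h w)"
            by (intro sum.mono_neutral_cong_right) (auto simp: occ_def)
          also have "\<dots> \<le> p * ?S"
          proof -
            have "{a..<a + int L} \<subseteq> ?K" using a by (auto simp: T_def block_starts_def)
            from occurrence_upper[OF R x0 _ this h0 hl, where b = b] show ?thesis
              using part_fun_pos[of "{b..<b + int L}"] by (simp add: p_def field_simps)
          qed
          finally show ?thesis by (intro add_left_mono mult_left_mono) auto
        qed
        finally have "(\<Sum>w\<in>J ?K ` X. ?W w * h w * exp (occ a w)) \<le> (1 + (exp 1 - 1) * p) * ?S"
          by (simp add: algebra_simps)
        also have "\<dots> \<le> exp (2 * p) * ?S"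
        proof (rule mult_right_mono[OF _ S0])
          have "(exp 1 - 1) * p \<le> 2 * p" using exp_le p0 by (intro mult_right_mono) auto
          then show "1 + (exp 1 - 1) * p \<le> exp (2 * p)"
            using exp_ge_add_one_self[of "2 * p"] by linarith
        qed
        finally show "(\<Sum>w\<in>J ?K ` X. ?W w * h w * exp (occ a w)) \<le> exp (2 * p) * ?S" .
      qed auto
      also have "exp (2 * p) ^ card (T r) \<le> exp (2 * p / real L * real N)"
      proof -
        have "real (card (T r) * L) \<le> real N"
          using card_block_starts[OF L, of N r] unfolding T_def by (simp only: of_nat_le_iff)
        then have "real (card (T r)) \<le> real N / real L" using L by (simp add: field_simps)
        then have "2 * p * real (card (T r)) \<le> 2 * p * (real N / real L)"
          using p0 by (intro mult_left_mono) auto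
        then show ?thesis by (simp add: exp_of_nat_mult[symmetric] mult_ac)
      qed
      finally show "(\<Sum>w\<in>J ?K ` X. ?W w * (\<Prod>a\<in>T r. exp (occ a w)))
          \<le> exp (2 * p / real L * real N) * part_fun X \<phi> ?K"
        using part_fun_pos[of ?K]
        by (simp add: part_fun_def mult_right_mono)
    qed auto
    also have "\<dots> = exp (1 + 2 * p / real L * real N) * part_fun X \<phi> ?K"
      using L by (simp add: exp_add)
    finally show "part_fun X (\<lambda>x. \<phi> x + f x) ?K
        \<le> exp (1 + 2 * p / real L * real N) * part_fun X \<phi> ?K" .
  qed
  then show ?thesis by (simp add: f_def)
qed

text \<open>Disjoint blocks, each with room for the word and the three margins of length \<open>D\<close>, suffice
  for the lower bound: whatever the configuration outside a block is, the word occurs somewhere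
  in the block with conditional weight at least \<open>p\<close>.\<close>

lemma pressure_diff_cylinder_le:
  assumes R: "refillable \<epsilon> L" and L: "L = l + 3 * D" and x0: "x0 \<in> X" and \<beta>: "- int l < \<beta>" "\<beta> \<le> 0"
  defines "b \<equiv> \<beta> - 2 * int D"
  defines "p \<equiv> exp (erg_sum \<phi> {b..<b + int L} x0 - 2 * \<epsilon> * real L)
    / (2 * part_fun X \<phi> {0..<int L})"
  shows "pressure X (\<lambda>x. \<phi> x + (- 1) * of_bool (\<forall>k\<in>{\<beta>..<\<beta> + int l}. x k = x0 k))
    \<le> pressure X \<phi> - p / (2 * real L)"
proof -
  have L0: "L > 0" using \<beta> L by simp
  have p0: "p \<ge> 0" unfolding p_def using part_fun_pos[of "{0..<int L}"] by simp
  define f :: "(int \<Rightarrow> 'a) \<Rightarrow> real" where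
    "f x = (- 1) * of_bool (\<forall>k\<in>{\<beta>..<\<beta> + int l}. x k = x0 k)" for x
  have fb: "\<bar>f x\<bar> \<le> 1" for x by (simp add: f_def)
  have "pressure X (\<lambda>x. \<phi> x + f x) \<le> pressure X \<phi> + - (p / (2 * real L))"
  proof (rule pressure_mono_limit)
    show "observable X (\<lambda>x. \<phi> x + f x) (M + 1)"
      using fb by (rule observable_add)
    fix N :: nat assume "N \<ge> 1"
    let ?K = "{0..<int N}"
    let ?W = "cyl_weight X \<phi> ?K"
    define E :: "int \<Rightarrow> (int \<Rightarrow> 'a) \<Rightarrow> real" where
      "E a w = of_bool (occurs L a b x0 w)" for a w
    define T where "T = block_starts N L 0"
    have TK: "{a..<a + int L} \<subseteq> ?K" if "a \<in> T" for a
      using that by (auto simp: T_def block_starts_def)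
    have sumf: "erg_sum f ?K x \<le> (\<Sum>a\<in>T. - E a (J ?K x))" for x
    proof -
      have block: "(\<Sum>t\<in>{a..<a + int L}. f (shift t x)) \<le> - E a (J ?K x)" if a: "a \<in> T" for a
      proof (cases "occurs L a b x0 (J ?K x)")
        case True
        then obtain s where s: "s \<le> D" "\<And>k. int D \<le> k \<Longrightarrow> k < int L - int D \<Longrightarrow>
            J ?K x (a + k) = x0 (b + k + int s)" unfolding occurs_def by blast
        \<comment> \<open>By \<open>b = \<beta> - 2 * D\<close> and \<open>L = l + 3 * D\<close>,
          the sites of \<open>x0\<close> that are reproduced for every translation
          \<open>s \<le> D\<close> are exactly those of the cylinder, from \<open>\<beta>\<close> to
          \<open>\<beta> + l - 1\<close>. The copy is found at time \<open>t\<close>, and the bounds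
          on \<open>\<beta>\<close> keep \<open>t\<close> inside the block.\<close>
        define t where "t = a - b - int s"
        have t: "t \<in> {a..<a + int L}" using s(1) \<beta> L by (auto simp: t_def b_def)
        have "shift t x j = x0 j" if j: "j \<in> {\<beta>..<\<beta> + int l}" for j
        proof -
          define k where "k = j - b - int s"
          have k: "int D \<le> k" "k < int L - int D"
            using j s(1) L by (auto simp: k_def b_def)
          have "a + k \<in> ?K" using k by (intro subsetD[OF TK[OF a]]) auto
          then have "x (a + k) = x0 (b + k + int s)" using s(2)[OF k] by simp
          moreover have "a + k = j + t" "b + k + int s = j" by (simp_all add: k_def t_def)
          ultimately show ?thesis by simp
        qed
        then have "f (shift t x) = - 1" by (simp add: f_def)
        moreover have "(\<Sum>t\<in>{a..<a + int L}. f (shift t x)) =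
            f (shift t x) + (\<Sum>t\<in>{a..<a + int L} - {t}. f (shift t x))"
          using t by (intro sum.remove) auto
        moreover have "(\<Sum>t\<in>{a..<a + int L} - {t}. f (shift t x)) \<le> 0"
          by (intro sum_nonpos) (simp add: f_def)
        ultimately show ?thesis using True by (simp add: E_def)
      next
        case False
        then have "E a (J ?K x) = 0" by (simp only: E_def of_bool_eq)
        moreover have "(\<Sum>t\<in>{a..<a + int L}. f (shift t x)) \<le> 0"
          by (intro sum_nonpos) (simp add: f_def)
        ultimately show ?thesis by simp
      qed
      let ?U = "\<Union>a\<in>T. {a..<a + int L}"
      have UK: "?U \<subseteq> ?K" using TK by blast
      have "erg_sum f ?K x = (\<Sum>t\<in>?K - ?U. f (shift t x)) + (\<Sum>t\<in>?U. f (shift t x))"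
        unfolding erg_sum_def using UK by (intro sum.subset_diff) auto
      \<comment> \<open>\<open>f\<close> is nonpositive, so the times outside the chosen blocks may
        be dropped from an upper bound.\<close>
      also have "(\<Sum>t\<in>?K - ?U. f (shift t x)) \<le> 0"
        by (intro sum_nonpos) (simp add: f_def)
      also have "(\<Sum>t\<in>?U. f (shift t x)) = (\<Sum>a\<in>T. \<Sum>t\<in>{a..<a + int L}. f (shift t x))"
        using block_starts_disjoint[OF _ _ _ L0]
        by (intro sum.UNION_disjoint) (auto simp: T_def)
      also have "\<dots> \<le> (\<Sum>a\<in>T. - E a (J ?K x))" using block by (rule sum_mono)
      finally show ?thesis by simp
    qed
    have "part_fun X (\<lambda>x. \<phi> x + f x) ?K
        \<le> (\<Sum>w\<in>J ?K ` X. ?W w * (\<Prod>a\<in>T. exp (- E a w)))"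
    proof (rule part_fun_perturb[OF fb])
      fix x assume "x \<in> X"
      have "exp (erg_sum f ?K x) \<le> exp (\<Sum>a\<in>T. - E a (J ?K x))"
        using sumf[of x] by simp
      then show "exp (erg_sum f ?K x) \<le> (\<Prod>a\<in>T. exp (- E a (J ?K x)))"
        by (simp add: exp_sum T_def)
    qed (auto intro!: prod_nonneg)
    also have "\<dots> \<le> exp (- (p / 2)) ^ card T * sum ?W (J ?K ` X)"
    proof (rule sum_prod_blocks[where I = "\<lambda>a. {a..<a + int L}" and K = ?K])
      show "finite T" by (simp add: T_def)
      show "{a..<a + int L} \<inter> {a'..<a' + int L} = {}" if "a \<in> T" "a' \<in> T" "a \<noteq> a'" for a a'
        using block_starts_disjoint that L0 by (simp add: T_def)
      show "{a..<a + int L} \<subseteq> ?K" if "a \<in> T" for a using TK[OF that] .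
      show "exp (- E a w) = exp (- E a w')" if "\<And>k. k \<in> {a..<a + int L} \<Longrightarrow> w k = w' k" for a w w'
      proof -
        have "w (a + k) = w' (a + k)" if "int D \<le> k \<and> k < int L - int D" for k
          using that by (intro \<open>\<And>k. k \<in> {a..<a + int L} \<Longrightarrow> w k = w' k\<close>) auto
        then have "E a w = E a w'" unfolding E_def occurs_def by (metis (no_types, lifting))
        then show ?thesis by simp
      qed
    next
      fix a and h :: "(int \<Rightarrow> 'a) \<Rightarrow> real" assume a: "a \<in> T" and h0: "\<And>w. w \<in> J ?K ` X \<Longrightarrow> h w \<ge> 0"
        and hl: "\<And>w w'. w \<in> J ?K ` X \<Longrightarrow> w' \<in> J ?K ` X \<Longrightarrow>
          (\<And>k. k \<in> ?K - {a..<a + int L} \<Longrightarrow> w k = w' k) \<Longrightarrow> h w = h w'"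
      let ?S = "\<Sum>w\<in>J ?K ` X. ?W w * h w"
      have S0: "?S \<ge> 0"
        by (intro mult_nonneg_nonneg sum_nonneg h0 less_imp_le[OF weight_pos])
      \<comment> \<open>As \<open>E\<close> is \<open>0\<close> or \<open>1\<close>, the exponential
        of \<open>- E\<close> is \<open>1 - (1 - exp (- 1)) * E\<close>, and
        \<open>1 - exp (- 1) \<ge> 1 / 2\<close>: each block gives a factor of at most
        \<open>1 - p / 2 \<le> exp (- (p / 2))\<close>.\<close>
      have "(\<Sum>w\<in>J ?K ` X. ?W w * h w * exp (- E a w))
          = (\<Sum>w\<in>J ?K ` X. ?W w * h w - (1 - exp (- 1)) * (?W w * h w * E a w))"
        by (intro sum.cong) (auto simp: E_def algebra_simps)
      also have "\<dots> = ?S - (1 - exp (- 1)) * (\<Sum>w\<in>J ?K ` X. ?W w * h w * E a w)"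
        by (simp add: sum_subtractf sum_distrib_left)
      also have "(\<Sum>w\<in>J ?K ` X. ?W w * h w * E a w)
          = (\<Sum>w\<in>{w \<in> J ?K ` X. occurs L a b x0 w}. ?W w * h w)"
        by (intro sum.mono_neutral_cong_right) (simp_all add: E_def)
      finally have eq: "(\<Sum>w\<in>J ?K ` X. ?W w * h w * exp (- E a w)) = ?S - (1 - exp (- 1)) *
        (\<Sum>w\<in>{w \<in> J ?K ` X. occurs L a b x0 w}. ?W w * h w)" (is "_ = _ - _ * ?SE") .
      from occurrence_lower[OF R x0 _ TK[OF a] h0 hl, where b = b] have "p * ?S \<le> ?SE"
        using part_fun_pos[of "{0..<int L}"]
        by (simp add: p_def field_simps part_fun_interval)
      moreover have "1 - exp (- 1 :: real) \<ge> 1 / 2"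
      proof -
        have "exp (1::real) \<ge> 2" using exp_ge_add_one_self[of 1] by simp
        then show ?thesis by (simp add: exp_minus field_simps)
      qed
      ultimately have "1 / 2 * (p * ?S) \<le> (1 - exp (- 1)) * ?SE"
        using p0 S0 by (intro mult_mono) auto
      then have "(\<Sum>w\<in>J ?K ` X. ?W w * h w * exp (- E a w)) \<le> (1 + - (p / 2)) * ?S"
        unfolding eq by (simp add: algebra_simps)
      also have "\<dots> \<le> exp (- (p / 2)) * ?S"
        using exp_ge_add_one_self[of "- (p / 2)"] S0 by (intro mult_right_mono)
      finally show "(\<Sum>w\<in>J ?K ` X. ?W w * h w * exp (- E a w)) \<le> exp (- (p / 2)) * ?S" .
    qed auto
    also have "exp (- (p / 2)) ^ card T \<le> exp (p / 2 + - (p / (2 * real L)) * real N)"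
    proof -
      \<comment> \<open>The volume contains at least \<open>N / L - 1\<close> blocks; the missing
        one becomes the additive constant \<open>p / 2\<close>, the others the rate
        \<open>p / (2 * L)\<close>.\<close>
      have "p / 2 * (real N / real L - 1) \<le> p / 2 * real (card T)"
        using card_block_starts_0[OF L0, of N] p0 by (intro mult_left_mono) (auto simp: T_def)
      moreover have "p / 2 * (real N / real L - 1) = p / (2 * real L) * real N - p / 2"
        by (simp add: algebra_simps)
      ultimately have "real (card T) * - (p / 2) \<le> p / 2 + - (p / (2 * real L)) * real N"
        by (simp add: mult.commute)
      then show ?thesis by (simp only: exp_of_nat_mult[symmetric] exp_le_cancel_iff)
    qed
    finally show "part_fun X (\<lambda>x. \<phi> x + f x) ?K
        \<le> exp (p / 2 + - (p / (2 * real L)) * real N) * part_fun X \<phi> ?K"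
      using part_fun_pos[of ?K] by (simp add: part_fun_def mult_right_mono)
  qed
  then show ?thesis by (simp add: f_def)
qed

end

section \<open>Measures of cylinders under tangency\<close>

lemma Lam_eq: "Lam m = {- int m..<- int m + int (2 * m + 1)}"
  by (auto simp: Lam_def)

lemma card_Lam [simp]: "card (Lam m) = 2 * m + 1"
  by (simp add: Lam_def)

context observable
begin

lemma part_fun_eventually:
  assumes "\<epsilon> > 0"
  obtains n0 :: nat where "\<And>n. n \<ge> n0 \<Longrightarrow> n > 0 \<Longrightarrow>
    \<bar>ln (part_fun X \<psi> {0..<int n}) - real n * pressure X \<psi>\<bar> \<le> \<epsilon> * real n"
proof -
  obtain n0 where n0: "\<And>n. n \<ge> n0 \<Longrightarrow>
      norm (ln (part_fun X \<psi> {0..<int n}) / real n - pressure X \<psi>) < \<epsilon>"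
    using LIMSEQ_D[OF pressure_tendsto assms] by blast
  show thesis
  proof (rule that[of n0])
    fix n assume n: "n \<ge> n0" "n > 0"
    have "\<bar>ln (part_fun X \<psi> {0..<int n}) - real n * pressure X \<psi>\<bar>
        = real n * \<bar>ln (part_fun X \<psi> {0..<int n}) / real n - pressure X \<psi>\<bar>"
      using n(2) by (simp add: abs_mult_pos' right_diff_distrib)
    also have "\<dots> \<le> real n * \<epsilon>"
      using n0[OF n(1)] by (intro mult_left_mono) auto
    finally show "\<bar>ln (part_fun X \<psi> {0..<int n}) - real n * pressure X \<psi>\<bar> \<le> \<epsilon> * real n"
      by (simp add: mult.commute)
  qed
qed

end

context block_filling
begin

text \<open>Tangency along the multiples of a single cylinder indicator, the common consequence of
  both alternatives for \<open>\<nu>\<close>. It is applied with \<open>c = 1 / L\<close> and with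
  \<open>c = - 1\<close>.\<close>

definition cylinder_tangent :: "(int \<Rightarrow> 'a) measure \<Rightarrow> bool" where
  "cylinder_tangent \<nu> \<longleftrightarrow> (\<forall>x0\<in>X. \<forall>m c. pressure X \<phi> + c * measure \<nu> (B X m x0)
    \<le> pressure X (\<lambda>x. \<phi> x + c * of_bool (\<forall>k\<in>Lam m. x k = x0 k)))"

text \<open>With \<open>c = 1 / L\<close> the factor \<open>1 / L\<close> cancels, leaving
  \<open>measure \<nu> (B X m x0) \<le> 2 * p\<close>. The five parts of \<open>\<delta>\<close> pay
  for the three errors in \<open>p\<close>, for the replacement of \<open>ln Z\<close> by the
  pressure and for the constant \<open>8 * refill_mult\<close>. Positivity is a premise because
  \<open>ln 0 = 0\<close>; the lower bound supplies it.\<close>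

lemma cylinder_measure_upper:
  assumes tan: "cylinder_tangent \<nu>"
    and "\<delta> > 0"
  obtains N :: nat where "\<And>m x0. m \<ge> N \<Longrightarrow> x0 \<in> X \<Longrightarrow> measure \<nu> (B X m x0) > 0 \<Longrightarrow>
    ln (measure \<nu> (B X m x0)) \<le> erg_sum \<phi> (Lam m) x0
      - real (card (Lam m)) * pressure X \<phi> + \<delta> * real (card (Lam m))"
proof -
  have d5: "\<delta> / 5 > 0" using assms by simp
  obtain n0 where n0: "\<And>L. L \<ge> n0 \<Longrightarrow> refillable (\<delta> / 5) L"
    using refillable_eventually[OF d5] by blast
  obtain n1 where n1: "\<And>n. n \<ge> n1 \<Longrightarrow> n > 0 \<Longrightarrow>
    \<bar>ln (part_fun X \<phi> {0..<int n}) - real n * pressure X \<phi>\<bar> \<le> \<delta> / 5 * real n"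
    using part_fun_eventually[OF d5] by blast
  obtain n2 :: nat where n2: "real n2 \<ge> ln (8 * refill_mult) / (\<delta> / 5)"
    using real_arch_simple by blast
  show thesis
  proof (rule that[of "max n0 (max n1 n2)"])
    fix m :: nat and x0
    assume m: "m \<ge> max n0 (max n1 n2)" and x0: "x0 \<in> X" and pos: "measure \<nu> (B X m x0) > 0"
    define L where "L = 2 * m + 1"
    have L: "L \<ge> n0" "L \<ge> n1" "L \<ge> n2" "L > 0" using m by (auto simp: L_def)
    have Lm: "Lam m = {- int m..<- int m + int L}" unfolding L_def by (rule Lam_eq)
    define Z where "Z = part_fun X \<phi> {0..<int L}"
    have Z: "Z > 0" unfolding Z_def by (rule part_fun_pos) simp
    have ZL: "part_fun X \<phi> (Lam m) = Z"
      unfolding Z_def Lm by (rule part_fun_interval)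
    define p where "p = 4 * refill_mult * exp (erg_sum \<phi> (Lam m) x0 + 3 * (\<delta> / 5) * real L) / Z"
    have "pressure X \<phi> + 1 / real L * measure \<nu> (B X m x0) \<le>
        pressure X (\<lambda>x. \<phi> x + 1 / real L * of_bool (\<forall>k\<in>Lam m. x k = x0 k))"
      using tan x0 unfolding cylinder_tangent_def by blast
    also have "\<dots> \<le> pressure X \<phi> + 2 * p / real L"
      unfolding p_def ZL[symmetric] unfolding Lm
      by (rule pressure_add_cylinder_le[OF n0[OF L(1)] L(4) x0]) (simp_all add: L_def)
    finally have "measure \<nu> (B X m x0) / real L \<le> 2 * p / real L" by simp
    then have "measure \<nu> (B X m x0) \<le> 2 * p"
      using L(4) unfolding divide_le_cancel by linarith
    then have "ln (measure \<nu> (B X m x0)) \<le> ln (2 * p)"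
      using pos by (intro ln_mono)
    moreover have "ln (2 * p) = ln (8 * refill_mult)
        + (erg_sum \<phi> (Lam m) x0 + 3 * (\<delta> / 5) * real L) - ln Z"
    proof -
      have "2 * p = (8 * refill_mult) * exp (erg_sum \<phi> (Lam m) x0 + 3 * (\<delta> / 5) * real L) / Z"
        by (simp add: p_def)
      then show ?thesis using Z refill_mult_pos
        by (simp only:) (subst ln_divide_pos ln_mult_pos; simp)+
    qed
    moreover have "ln (8 * refill_mult) \<le> \<delta> / 5 * real L"
    proof -
      have "ln (8 * refill_mult) / (\<delta> / 5) \<le> real L" using n2 L(3) by linarith
      then show ?thesis using assms(2) by (simp add: field_simps)
    qed
    moreover have "- ln Z \<le> \<delta> / 5 * real L - real L * pressure X \<phi>"
      using n1[OF L(2,4)] unfolding Z_def by linarith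
    ultimately have "ln (measure \<nu> (B X m x0)) \<le> erg_sum \<phi> (Lam m) x0
      - real L * pressure X \<phi> + \<delta> * real L"
      by argo
    then show "ln (measure \<nu> (B X m x0)) \<le> erg_sum \<phi> (Lam m) x0
      - real (card (Lam m)) * pressure X \<phi> + \<delta> * real (card (Lam m))"
      unfolding L_def card_Lam .
  qed
qed

text \<open>With \<open>c = - 1\<close> tangency gives
  \<open>measure \<nu> (B X m x0) \<ge> p / (2 * L)\<close>, which also proves positivity. The block
  is longer than the cylinder by \<open>3 * D\<close> sites, whose energy and pressure are bounded,
  and the factor \<open>1 / L\<close> is subexponential.\<close>

lemma cylinder_measure_lower:
  assumes tan: "cylinder_tangent \<nu>"
    and "\<delta> > 0"
  obtains N :: nat where "\<And>m x0. m \<ge> N \<Longrightarrow> x0 \<in> X \<Longrightarrow> measure \<nu> (B X m x0) > 0 \<and>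
    erg_sum \<phi> (Lam m) x0 - real (card (Lam m)) * pressure X \<phi> - \<delta> * real (card (Lam m))
      \<le> ln (measure \<nu> (B X m x0))"
proof -
  have d12: "\<delta> / 12 > 0" using assms by simp
  obtain n0 where n0: "\<And>L. L \<ge> n0 \<Longrightarrow> refillable (\<delta> / 12) L"
    using refillable_eventually[OF d12] by blast
  obtain n1 where n1: "\<And>n. n \<ge> n1 \<Longrightarrow> n > 0 \<Longrightarrow>
    \<bar>ln (part_fun X \<phi> {0..<int n}) - real n * pressure X \<phi>\<bar> \<le> \<delta> / 12 * real n"
    using part_fun_eventually[OF d12] by blast
  \<comment> \<open>\<open>C\<close> collects what does not grow with \<open>l\<close>: the constant
    in the bound for \<open>ln (4 * L)\<close>, and for each of the \<open>3 * D\<close> additional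
    sites its energy \<open>M\<close>, its pressure and its share \<open>\<delta> / 2\<close> of the
    errors. The errors \<open>3 * (\<delta> / 12) * L\<close> and \<open>\<delta> / 4 * L\<close>
    add up to \<open>\<delta> / 2 * L\<close>, which leaves \<open>\<delta> / 2 * l\<close> for
    \<open>C\<close>.\<close>
  define C where "C = ln (16 / \<delta>) + 3 * real D * (M + \<bar>pressure X \<phi>\<bar> + \<delta> / 2)"
  obtain n2 :: nat where n2: "real n2 \<ge> C / (\<delta> / 2)" using real_arch_simple by blast
  show thesis
  proof (rule that[of "max n0 (max n1 n2)"])
    fix m :: nat and x0
    assume m: "m \<ge> max n0 (max n1 n2)" and x0: "x0 \<in> X"
    define l where "l = 2 * m + 1"
    define L where "L = l + 3 * D"
    have l: "l \<ge> n2" using m by (auto simp: l_def)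
    have L: "L \<ge> n0" "L \<ge> n1" "L > 0" using m by (auto simp: L_def l_def)
    have Lm: "Lam m = {- int m..<- int m + int l}" unfolding l_def by (rule Lam_eq)
    define Z where "Z = part_fun X \<phi> {0..<int L}"
    have Z: "Z > 0" unfolding Z_def by (rule part_fun_pos) simp
    let ?K = "{- int m - 2 * int D..<- int m - 2 * int D + int L}"
    define p where "p = exp (erg_sum \<phi> ?K x0 - 2 * (\<delta> / 12) * real L) / (2 * Z)"
    have p: "p > 0" using Z by (simp add: p_def)
    have "pressure X \<phi> + (- 1) * measure \<nu> (B X m x0) \<le>
        pressure X (\<lambda>x. \<phi> x + (- 1) * of_bool (\<forall>k\<in>Lam m. x k = x0 k))"
      using tan x0 unfolding cylinder_tangent_def by blast
    also have "\<dots> \<le> pressure X \<phi> - p / (2 * real L)"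
      unfolding Lm p_def Z_def
      by (rule pressure_diff_cylinder_le[OF n0[OF L(1)] L_def x0]) (simp_all add: l_def)
    finally have ge: "p / (2 * real L) \<le> measure \<nu> (B X m x0)" by simp
    have pL: "p / (2 * real L) > 0" using p L(3) by simp
    have pos: "measure \<nu> (B X m x0) > 0" using pL ge by linarith
    have "ln (p / (2 * real L)) \<le> ln (measure \<nu> (B X m x0))"
      using ge pL by (rule ln_mono)
    moreover have "ln (p / (2 * real L))
        = erg_sum \<phi> ?K x0 - 2 * (\<delta> / 12) * real L - ln Z - ln (4 * real L)"
    proof -
      have "p / (2 * real L) = exp (erg_sum \<phi> ?K x0 - 2 * (\<delta> / 12) * real L) / (Z * (4 * real L))"
        by (simp add: p_def)
      then show ?thesis
        using Z L(3) by (simp only:) (subst ln_divide_pos ln_mult_pos; simp)+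
    qed
    moreover have "ln Z \<le> real L * pressure X \<phi> + \<delta> / 12 * real L"
      using n1[OF L(2,3)] unfolding Z_def by linarith
    moreover have "erg_sum \<phi> ?K x0 \<ge> erg_sum \<phi> (Lam m) x0 - M * (3 * real D)"
    proof -
      have sub: "Lam m \<subseteq> ?K" by (auto simp: Lm L_def)
      have "card (?K - Lam m) = 3 * D"
        using sub by (subst card_Diff_subset) (auto simp: Lm L_def)
      then show ?thesis
        using erg_sum_diff[OF _ sub, of \<phi> x0] erg_sum_bound[OF x0, of "?K - Lam m"] by simp
    qed
    moreover have "ln (4 * real L) \<le> \<delta> / 4 * real L + ln (16 / \<delta>)"
    proof -
      \<comment> \<open>\<open>ln t \<le> t - 1\<close> is used at
        \<open>t = \<delta> / 4 * L\<close>; the remaining factor is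
        \<open>16 / \<delta>\<close>.\<close>
      have "4 * real L = (\<delta> / 4 * real L) * (16 / \<delta>)" using assms(2) by simp
      then have "ln (4 * real L) = ln (\<delta> / 4 * real L) + ln (16 / \<delta>)"
        using assms(2) L(3) by (simp only:) (subst ln_mult_pos; simp)
      moreover have "ln (\<delta> / 4 * real L) \<le> \<delta> / 4 * real L - 1"
        using assms(2) L(3) by (intro ln_le_minus_one) simp
      ultimately show ?thesis by linarith
    qed
    moreover have "real L * pressure X \<phi> \<le> real l * pressure X \<phi> + 3 * real D * \<bar>pressure X \<phi>\<bar>"
    proof -
      have "3 * real D * pressure X \<phi> \<le> 3 * real D * \<bar>pressure X \<phi>\<bar>" by (intro mult_left_mono) auto
      then show ?thesis by (simp add: L_def algebra_simps)
    qed
    moreover have "C \<le> \<delta> / 2 * real l"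
    proof -
      have "C / (\<delta> / 2) \<le> real l" using n2 l by linarith
      then show ?thesis using assms(2) by (simp add: field_simps)
    qed
    moreover have "\<delta> / 12 * real L = \<delta> / 12 * real l + \<delta> / 12 * (3 * real D)"
      "\<delta> / 4 * real L = \<delta> / 4 * real l + \<delta> / 4 * (3 * real D)"
      by (simp_all add: L_def algebra_simps)
    moreover have "C = ln (16 / \<delta>) + M * (3 * real D) + 3 * real D * \<bar>pressure X \<phi>\<bar> + \<delta> / 2 * (3 * real D)"
      by (simp add: C_def algebra_simps)
    ultimately have "erg_sum \<phi> (Lam m) x0 - real l * pressure X \<phi> - \<delta> * real l
      \<le> ln (measure \<nu> (B X m x0))"
      by argo
    then show "measure \<nu> (B X m x0) > 0 \<and>
      erg_sum \<phi> (Lam m) x0 - real (card (Lam m)) * pressure X \<phi> - \<delta> * real (card (Lam m))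
        \<le> ln (measure \<nu> (B X m x0))"
      using pos by (simp add: l_def)
  qed
qed

lemma weak_gibbs_of_cylinder_tangent:
  assumes tan: "cylinder_tangent \<nu>"
    and \<nu>: "borel_prob_on X \<nu>"
  shows "weak_gibbs_measure X (\<lambda>x. \<phi> x - pressure X \<phi>) \<nu>"
  unfolding weak_gibbs_measure_def
proof (intro conjI \<nu> allI impI)
  fix \<delta> :: real assume \<delta>: "\<delta> > 0"
  obtain N1 where N1: "\<And>m x0. m \<ge> N1 \<Longrightarrow> x0 \<in> X \<Longrightarrow> measure \<nu> (B X m x0) > 0 \<Longrightarrow>
    ln (measure \<nu> (B X m x0)) \<le> erg_sum \<phi> (Lam m) x0
      - real (card (Lam m)) * pressure X \<phi> + \<delta> * real (card (Lam m))"
    using cylinder_measure_upper[OF tan \<delta>] by blast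
  obtain N2 where N2: "\<And>m x0. m \<ge> N2 \<Longrightarrow> x0 \<in> X \<Longrightarrow> measure \<nu> (B X m x0) > 0 \<and>
    erg_sum \<phi> (Lam m) x0 - real (card (Lam m)) * pressure X \<phi> - \<delta> * real (card (Lam m))
      \<le> ln (measure \<nu> (B X m x0))"
    using cylinder_measure_lower[OF tan \<delta>] by blast
  have "measure \<nu> (B X m x) > 0 \<and>
        \<bar>1 / real (card (Lam m)) * ln (measure \<nu> (B X m x))
          - 1 / real (card (Lam m)) * (\<Sum>j\<in>Lam m. \<phi> (shift j x) - pressure X \<phi>)\<bar> \<le> \<delta>"
    if m: "m \<ge> max N1 N2" and x: "x \<in> X" for m x
  proof -
    define n where "n = real (card (Lam m))"
    have n: "n > 0" by (simp add: n_def)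
    have S: "(\<Sum>j\<in>Lam m. \<phi> (shift j x) - pressure X \<phi>) = erg_sum \<phi> (Lam m) x - n * pressure X \<phi>"
      by (simp add: erg_sum_def sum_subtractf n_def)
    have pos: "measure \<nu> (B X m x) > 0" using N2[OF _ x] m by simp
    have "\<bar>ln (measure \<nu> (B X m x)) - (erg_sum \<phi> (Lam m) x - n * pressure X \<phi>)\<bar> \<le> \<delta> * n"
      using N1[OF _ x pos] N2[OF _ x, of m] m unfolding n_def[symmetric] by (simp add: abs_le_iff)
    then have "\<bar>ln (measure \<nu> (B X m x)) - (erg_sum \<phi> (Lam m) x - n * pressure X \<phi>)\<bar> / n \<le> \<delta>"
      using n by (simp add: divide_le_eq)
    moreover have "\<bar>t\<bar> / n = \<bar>t / n\<bar>" for t using n by simp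
    ultimately show ?thesis using pos unfolding S n_def[symmetric] by (simp add: diff_divide_distrib)
  qed
  then show "\<exists>N. \<forall>m\<ge>N. \<forall>x\<in>X. measure \<nu> (B X m x) > 0 \<and>
        \<bar>1 / real (card (Lam m)) * ln (measure \<nu> (B X m x))
          - 1 / real (card (Lam m)) * (\<Sum>j\<in>Lam m. \<phi> (shift j x) - pressure X \<phi>)\<bar> \<le> \<delta>"
    by blast
qed

end

section \<open>The variational inequality\<close>

lemma open_cylinder_condition:
  assumes "finite K"
  shows "open {x :: int \<Rightarrow> 'a::discrete_topology. \<forall>k\<in>K. x k = y k}"
proof -
  have "open {f :: int \<Rightarrow> 'a. \<forall>k\<in>K. f k \<in> {y k}}"
    by (intro product_topology_basis' assms discrete_topology_class.open_discrete)
  then show ?thesis by simp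
qed

lemma open_contains_cylinder:
  fixes x :: "int \<Rightarrow> 'a::discrete_topology"
  assumes "open U" "x \<in> U"
  obtains m :: nat where "\<And>y. (\<And>j. \<bar>j\<bar> \<le> int m \<Longrightarrow> y j = x j) \<Longrightarrow> y \<in> U"
proof -
  have "openin (product_topology (\<lambda>i. euclidean) UNIV) U"
    using assms(1) by (simp add: open_fun_def)
  from product_topology_open_contains_basis[OF this assms(2)]
  have "\<exists>V. x \<in> (\<Pi>\<^sub>E i\<in>UNIV. V i) \<and> (\<forall>i. open (V i)) \<and> finite {i. V i \<noteq> UNIV} \<and> (\<Pi>\<^sub>E i\<in>UNIV. V i) \<subseteq> U"
    by simp
  then obtain V where V: "x \<in> (\<Pi>\<^sub>E i\<in>UNIV. V i)" "finite {i :: int. V i \<noteq> (UNIV :: 'a set)}"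
      "(\<Pi>\<^sub>E i\<in>UNIV. V i) \<subseteq> U" by blast
  obtain m where m: "\<And>A j. A \<in> {{i. V i \<noteq> UNIV}} \<Longrightarrow> j \<in> A \<Longrightarrow> \<bar>j\<bar> \<le> int m"
    using finite_subset_int_interval[of "{{i. V i \<noteq> UNIV}}"] V(2) by blast
  show thesis
  proof (rule that[of m])
    fix y assume y: "\<And>j. \<bar>j\<bar> \<le> int m \<Longrightarrow> y j = x j"
    have "y i \<in> V i" for i
    proof (cases "V i = UNIV")
      case False
      then have "y i = x i" using m y by blast
      then show ?thesis using V(1) by auto
    qed simp
    then show "y \<in> U" using V(3) by auto
  qed
qed

section \<open>Approximation of Borel sets by cylinder sets\<close>

definition cylinder_set :: "(int \<Rightarrow> 'a) set \<Rightarrow> nat \<Rightarrow> (int \<Rightarrow> 'a) set \<Rightarrow> bool" where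
  "cylinder_set X m U \<longleftrightarrow> U \<subseteq> X \<and>
    (\<forall>x\<in>X. \<forall>y\<in>X. (\<forall>j. \<bar>j\<bar> \<le> int m \<longrightarrow> x j = y j) \<longrightarrow> (x \<in> U \<longleftrightarrow> y \<in> U))"

lemma cylinder_set_mono: "cylinder_set X m U \<Longrightarrow> m \<le> n \<Longrightarrow> cylinder_set X n U"
  unfolding cylinder_set_def by (meson order_trans of_nat_mono)

lemma cylinder_set_openin:
  fixes U :: "(int \<Rightarrow> 'a::discrete_topology) set"
  assumes "cylinder_set X m U"
  obtains V where "open V" "U = X \<inter> V"
proof (rule that)
  let ?V = "\<Union>y\<in>U. {x. \<forall>k\<in>{- int m..int m}. x k = y k}"
  show "open ?V" by (intro open_UN ballI open_cylinder_condition) simp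
  show "U = X \<inter> ?V"
  proof (intro equalityI subsetI)
    fix x assume "x \<in> X \<inter> ?V"
    then obtain y where "y \<in> U" "x \<in> X" "\<forall>k\<in>{- int m..int m}. x k = y k" by blast
    moreover from this have "\<forall>j. \<bar>j\<bar> \<le> int m \<longrightarrow> x j = y j"
      by (metis abs_le_iff atLeastAtMost_iff minus_le_iff)
    ultimately show "x \<in> U" using assms unfolding cylinder_set_def by blast
  qed (use assms in \<open>auto simp: cylinder_set_def\<close>)
qed

lemma continuous_on_local:
  fixes X :: "(int \<Rightarrow> 'a::discrete_topology) set" and f :: "(int \<Rightarrow> 'a) \<Rightarrow> real"
  assumes "\<And>\<epsilon>. \<epsilon> > 0 \<Longrightarrow> \<exists>R::nat. \<forall>x\<in>X. \<forall>y\<in>X. (\<forall>j. \<bar>j\<bar> \<le> int R \<longrightarrow> x j = y j) \<longrightarrow> \<bar>f x - f y\<bar> \<le> \<epsilon>"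
  shows "continuous_on X f"
  unfolding continuous_on_def tendsto_iff
proof (intro ballI allI impI)
  fix x and e :: real assume x: "x \<in> X" and e: "e > 0"
  have "e / 2 > 0" using e by simp
  from assms[OF this] obtain R :: nat where
    R: "\<forall>x\<in>X. \<forall>y\<in>X. (\<forall>j. \<bar>j\<bar> \<le> int R \<longrightarrow> x j = y j) \<longrightarrow> \<bar>f x - f y\<bar> \<le> e / 2" by blast
  show "\<forall>\<^sub>F y in at x within X. dist (f y) (f x) < e"
    unfolding eventually_at_topological
  proof (intro exI conjI ballI impI)
    show "open {y. \<forall>k\<in>{- int R..int R}. y k = x k}" by (rule open_cylinder_condition) simp
    fix y assume y: "y \<in> {y. \<forall>k\<in>{- int R..int R}. y k = x k}" "y \<in> X"
    then have "\<forall>j. \<bar>j\<bar> \<le> int R \<longrightarrow> y j = x j"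
      by (metis (mono_tags, lifting) abs_le_iff atLeastAtMost_iff mem_Collect_eq minus_le_iff)
    then have "\<bar>f y - f x\<bar> \<le> e / 2" using R x y(2) by blast
    then show "dist (f y) (f x) < e" using e by (simp add: dist_real_def)
  qed simp
qed

lemma continuous_on_shift: "continuous_on S (shift j :: (int \<Rightarrow> 'a::topological_space) \<Rightarrow> _)"
  unfolding shift_def[abs_def]
  by (intro continuous_on_coordinatewise_then_product
      continuous_on_subset[OF continuous_on_product_coordinates]) auto

locale invariant_measure =
  fixes X :: "(int \<Rightarrow> 'a::{finite, discrete_topology}) set"
    and \<nu> :: "(int \<Rightarrow> 'a) measure"
  assumes X_shift: "x \<in> X \<Longrightarrow> shift j x \<in> X"
    and inv_meas: "\<nu> \<in> invariant_measures X"

sublocale invariant_measure \<subseteq> prob_space \<nu>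
  using inv_meas by (auto simp: invariant_measures_def borel_prob_on_def)

context invariant_measure
begin

lemma space_eq: "space \<nu> = X" and sets_eq: "sets \<nu> = sets (restrict_space borel X)"
  and distr_shift: "distr \<nu> \<nu> (shift j) = \<nu>"
  using inv_meas by (auto simp: invariant_measures_def borel_prob_on_def)

lemma X_nonempty: "X \<noteq> {}"
  using not_empty by (simp add: space_eq)

lemma measurable_shift [measurable]: "shift j \<in> measurable \<nu> \<nu>"
proof -
  have "shift j \<in> measurable (borel :: (int \<Rightarrow> 'a) measure) borel"
    by (intro borel_measurable_continuous_onI continuous_on_shift)
  then have "shift j \<in> measurable (restrict_space borel X) (restrict_space borel X)"
    using X_shift by (intro measurable_restrict_space3) auto
  then show ?thesis by (simp cong: measurable_cong_sets add: sets_eq)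
qed

lemma continuous_measurable:
  "continuous_on X f \<Longrightarrow> f \<in> borel_measurable \<nu>" for f :: "_ \<Rightarrow> real"
  using borel_measurable_continuous_on_restrict[of X f]
  by (simp cong: measurable_cong_sets add: sets_eq)

lemma cylinder_measurable:
  assumes "cylinder_set X m U"
  shows "U \<in> sets \<nu>"
proof -
  obtain V where "open V" "U = X \<inter> V" using cylinder_set_openin[OF assms] .
  then show ?thesis by (auto simp: sets_eq sets_restrict_space)
qed

lemma integral_shift:
  "f \<in> borel_measurable \<nu> \<Longrightarrow> (\<integral>x. f (shift j x) \<partial>\<nu>) = (\<integral>x. f x \<partial>\<nu>)" for f :: "_ \<Rightarrow> real"
  using integral_distr[OF measurable_shift, of f j] by (simp add: distr_shift)

lemma integrable_shift:
  "integrable \<nu> f \<Longrightarrow> integrable \<nu> (\<lambda>x. f (shift j x))" for f :: "_ \<Rightarrow> real"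
  using integrable_distr[OF measurable_shift, of j f] by (simp add: distr_shift)

lemma bounded_integrable:
  fixes f :: "_ \<Rightarrow> real"
  assumes "f \<in> borel_measurable \<nu>" "\<And>x. x \<in> X \<Longrightarrow> \<bar>f x\<bar> \<le> c"
  shows "integrable \<nu> f"
  using assms by (intro integrable_const_bound[where B = c]) (auto simp: space_eq)

text \<open>\<open>U m\<close> collects the points of \<open>X\<close> whose whole cylinder of
  radius \<open>m\<close> in the full shift lies in \<open>S\<close>. These sets increase to
  \<open>X \<inter> S\<close>, so continuity of the measure from below gives the claim.\<close>

lemma approximable_open:
  assumes "open S" "\<epsilon> > 0"
  shows "\<exists>m U. cylinder_set X m U \<and> prob (sym_diff (X \<inter> S) U) < \<epsilon>"
proof -
  define U where "U m = {x \<in> X. \<forall>y. (\<forall>j. \<bar>j\<bar> \<le> int m \<longrightarrow> y j = x j) \<longrightarrow> y \<in> S}" for m :: nat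
  have cyl: "cylinder_set X m (U m)" for m
    unfolding cylinder_set_def U_def by auto
  have US: "U m \<subseteq> X \<inter> S" for m by (auto simp: U_def)
  have "X \<inter> S \<subseteq> (\<Union>m. U m)"
  proof
    fix x assume x: "x \<in> X \<inter> S"
    then obtain m :: nat where "\<And>y. (\<And>j. \<bar>j\<bar> \<le> int m \<Longrightarrow> y j = x j) \<Longrightarrow> y \<in> S"
      using open_contains_cylinder[OF assms(1), of x] by blast
    then show "x \<in> (\<Union>m. U m)" using x by (auto simp: U_def)
  qed
  then have un: "(\<Union>m. U m) = X \<inter> S" using US by blast
  have meas: "range U \<subseteq> sets \<nu>" using cylinder_measurable[OF cyl] by auto
  have "incseq U"
    unfolding incseq_def U_def
  proof (intro allI impI subsetI)
    fix m n :: nat and x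
    assume mn: "m \<le> n"
      and x: "x \<in> {x \<in> X. \<forall>y. (\<forall>j. \<bar>j\<bar> \<le> int m \<longrightarrow> y j = x j) \<longrightarrow> y \<in> S}"
    have "int m \<le> int n" using mn by simp
    then show "x \<in> {x \<in> X. \<forall>y. (\<forall>j. \<bar>j\<bar> \<le> int n \<longrightarrow> y j = x j) \<longrightarrow> y \<in> S}"
      using x by (auto intro: order_trans)
  qed
  then have "(\<lambda>m. prob (U m)) \<longlonglongrightarrow> prob (\<Union>m. U m)"
    using meas by (intro finite_Lim_measure_incseq)
  from LIMSEQ_D[OF this assms(2)] obtain m where
    m: "norm (prob (U m) - prob (X \<inter> S)) < \<epsilon>" unfolding un by blast
  have XS: "X \<inter> S \<in> sets \<nu>" using assms(1) by (auto simp: sets_eq sets_restrict_space)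
  have "sym_diff (X \<inter> S) (U m) = X \<inter> S - U m" using US by blast
  then have "prob (sym_diff (X \<inter> S) (U m)) = prob (X \<inter> S) - prob (U m)"
    using XS meas US by (simp add: finite_measure_Diff)
  then show ?thesis using m cyl by (intro exI[of _ m] exI[of _ "U m"]) auto
qed

lemma approximable_Union:
  fixes A :: "nat \<Rightarrow> (int \<Rightarrow> 'a) set"
  assumes A: "\<And>i. A i \<in> sets \<nu>"
    and app: "\<And>i \<epsilon>. \<epsilon> > 0 \<Longrightarrow> \<exists>m U. cylinder_set X m U \<and> prob (sym_diff (A i) U) < \<epsilon>"
    and e: "\<epsilon> > 0"
  shows "\<exists>m U. cylinder_set X m U \<and> prob (sym_diff (\<Union>i. A i) U) < \<epsilon>"
proof -
  define P where "P n = (\<Union>i<n. A i)" for n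
  have P: "P n \<in> sets \<nu>" for n using A by (auto simp: P_def)
  have un: "(\<Union>n. P n) = (\<Union>i. A i)" by (auto simp: P_def)
  have "incseq P" unfolding incseq_def P_def by (auto intro: less_le_trans)
  then have "(\<lambda>n. prob (P n)) \<longlonglongrightarrow> prob (\<Union>n. P n)"
    using P by (intro finite_Lim_measure_incseq) auto
  from LIMSEQ_D[OF this, of "\<epsilon> / 2"] obtain n where
    n: "norm (prob (P n) - prob (\<Union>i. A i)) < \<epsilon> / 2" unfolding un using e by auto
  \<comment> \<open>\<open>n\<close> sets with this error cost at most
    \<open>\<epsilon> / 2\<close>; \<open>n + 1\<close> in place of \<open>n\<close> keeps the
    quotient positive when \<open>n = 0\<close>.\<close>
  have "\<epsilon> / (2 * real (n + 1)) > 0" using e by simp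
  from app[OF this] obtain m U where mU: "\<And>i. cylinder_set X (m i) (U i)"
      "\<And>i. prob (sym_diff (A i) (U i)) < \<epsilon> / (2 * real (n + 1))" by metis
  have Us: "U i \<in> sets \<nu>" for i using cylinder_measurable mU(1) by blast
  define V where "V = (\<Union>i<n. U i)"
  have V: "V \<in> sets \<nu>" using Us by (auto simp: V_def)
  have "cylinder_set X (Max (m ` {..n})) V"
  proof -
    have c: "cylinder_set X (Max (m ` {..n})) (U i)" if "i < n" for i
      using that by (intro cylinder_set_mono[OF mU(1)] Max_ge) auto
    show ?thesis
      unfolding cylinder_set_def
    proof (intro conjI ballI impI)
      show "V \<subseteq> X" using c unfolding V_def cylinder_set_def by blast
      fix x y assume "x \<in> X" "y \<in> X" "\<forall>j. \<bar>j\<bar> \<le> int (Max (m ` {..n})) \<longrightarrow> x j = y j"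
      then have "x \<in> U i \<longleftrightarrow> y \<in> U i" if "i < n" for i
        using c[OF that] unfolding cylinder_set_def by blast
      then show "x \<in> V \<longleftrightarrow> y \<in> V" by (auto simp: V_def)
    qed
  qed
  moreover have "prob (sym_diff (\<Union>i. A i) V) < \<epsilon>"
  proof -
    have PA: "P n \<subseteq> (\<Union>i. A i)" by (auto simp: P_def)
    have "sym_diff (\<Union>i. A i) V \<subseteq> ((\<Union>i. A i) - P n) \<union> (\<Union>i<n. sym_diff (A i) (U i))"
      by (auto simp: P_def V_def)
    then have "prob (sym_diff (\<Union>i. A i) V)
        \<le> prob (((\<Union>i. A i) - P n) \<union> (\<Union>i<n. sym_diff (A i) (U i)))"
      using A P Us V by (intro finite_measure_mono) auto
    also have "\<dots> \<le> prob ((\<Union>i. A i) - P n) + prob (\<Union>i<n. sym_diff (A i) (U i))"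
      using A P Us by (intro measure_Un_le) auto
    also have "prob ((\<Union>i. A i) - P n) < \<epsilon> / 2"
    proof -
      have "prob ((\<Union>i. A i) - P n) = prob (\<Union>i. A i) - prob (P n)"
        using A P PA by (intro finite_measure_Diff) auto
      then show ?thesis using n unfolding real_norm_def by linarith
    qed
    also have "prob (\<Union>i<n. sym_diff (A i) (U i)) \<le> (\<Sum>i<n. prob (sym_diff (A i) (U i)))"
      using A Us by (intro finite_measure_subadditive_finite) auto
    also have "\<dots> \<le> of_nat (card {..<n}) * (\<epsilon> / (2 * real (n + 1)))"
      using mU(2) by (intro sum_bounded_above less_imp_le)
    also have "\<dots> \<le> \<epsilon> / 2" using e by (simp add: field_simps)
    finally show ?thesis by simp
  qed
  ultimately show ?thesis by blast
qed

text \<open>The approximable sets form a sigma-algebra that contains the open sets. Measurability is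
  carried along in the induction because the step for unions uses it; complements within
  \<open>X\<close> leave the symmetric difference unchanged.\<close>

lemma approximable_cylinder:
  assumes "A \<in> sets \<nu>" "\<epsilon> > 0"
  shows "\<exists>m U. cylinder_set X m U \<and> prob (sym_diff A U) < \<epsilon>"
proof -
  obtain A' where A': "A' \<in> sets borel" "A = X \<inter> A'"
    using assms(1) by (auto simp: sets_eq sets_restrict_space)
  have "A' \<in> sigma_sets UNIV {S. open S}" using A'(1) by (simp add: borel_def)
  then have "X \<inter> A' \<in> sets \<nu> \<and>
      (\<forall>\<epsilon>>0. \<exists>m U. cylinder_set X m U \<and> prob (sym_diff (X \<inter> A') U) < \<epsilon>)"
  proof induction
    case (Basic S)
    then show ?case using approximable_open by (auto simp: sets_eq sets_restrict_space)
  next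
    case Empty
    have "cylinder_set X 0 {}" by (simp add: cylinder_set_def)
    then show ?case by (auto intro!: exI[of _ "0::nat"] exI[of _ "{}"])
  next
    case (Compl A)
    have "X \<inter> (UNIV - A) = X - (X \<inter> A)" by auto
    then have "X \<inter> (UNIV - A) \<in> sets \<nu>" using Compl.IH sets.compl_sets[of "X \<inter> A" \<nu>] by (simp add: space_eq)
    moreover have "\<exists>m U. cylinder_set X m U \<and> prob (sym_diff (X \<inter> (UNIV - A)) U) < \<epsilon>"
      if "\<epsilon> > 0" for \<epsilon>
    proof -
      obtain m U where U: "cylinder_set X m U" "prob (sym_diff (X \<inter> A) U) < \<epsilon>"
        using Compl.IH \<open>\<epsilon> > 0\<close> by blast
      have "U \<subseteq> X" using U(1) by (simp add: cylinder_set_def)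
      then have "sym_diff (X \<inter> (UNIV - A)) (X - U) = sym_diff (X \<inter> A) U" by blast
      moreover have "cylinder_set X m (X - U)" using U(1) unfolding cylinder_set_def by blast
      ultimately show ?thesis using U(2) by (intro exI[of _ m] exI[of _ "X - U"]) simp
    qed
    ultimately show ?case by blast
  next
    case (Union A)
    have eq: "X \<inter> (\<Union>i. A i) = (\<Union>i. X \<inter> A i)" by auto
    have "X \<inter> (\<Union>i. A i) \<in> sets \<nu>" unfolding eq
      using conjunct1[OF Union.IH] by (intro sets.countable_UN) auto
    moreover have "\<exists>m U. cylinder_set X m U \<and> prob (sym_diff (X \<inter> (\<Union>i. A i)) U) < \<epsilon>"
      if "\<epsilon> > 0" for \<epsilon>
      unfolding eq
    proof (rule approximable_Union)
      show "X \<inter> A i \<in> sets \<nu>" for i by (rule conjunct1[OF Union.IH])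
      show "\<exists>m U. cylinder_set X m U \<and> prob (sym_diff (X \<inter> A i) U) < \<epsilon>'" if "\<epsilon>' > 0" for i \<epsilon>'
        by (rule conjunct2[OF Union.IH, rule_format, OF that])
    qed (rule that)
    ultimately show ?case by blast
  qed
  then show ?thesis using A'(2) assms(2) by blast
qed

end

section \<open>Entropy of iterated partitions\<close>

text \<open>Gibbs' inequality: the entropy is at most the mean of \<open>- ln q\<close> for a
  subprobability \<open>q\<close>, by \<open>ln t \<le> t - 1\<close> in each cell. The function
  \<open>g\<close> bounds \<open>- ln (q i)\<close> pointwise on the cells, so that ergodic sums can
  be integrated directly instead of being summed over cells.\<close>

lemma (in prob_space) entropy_gibbs_inequality:
  fixes q :: "'i \<Rightarrow> real" and g :: "'a \<Rightarrow> real"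
  assumes I: "finite I" and A: "\<And>i. i \<in> I \<Longrightarrow> A i \<in> sets M" and disj: "disjoint_family_on A I"
    and un: "(\<Union>i\<in>I. A i) = space M"
    and q0: "\<And>i. i \<in> I \<Longrightarrow> q i \<ge> 0" and q1: "sum q I \<le> 1"
    and qg: "\<And>i x. i \<in> I \<Longrightarrow> prob (A i) > 0 \<Longrightarrow> x \<in> A i \<Longrightarrow> q i > 0 \<and> - ln (q i) \<le> g x"
    and g: "integrable M g"
  shows "- (\<Sum>i\<in>I. prob (A i) * ln (prob (A i))) \<le> (\<integral>x. g x \<partial>M)"
proof -
  let ?p = "\<lambda>i. prob (A i)"
  have ind: "integrable M (\<lambda>x. indicator (A i) x * g x)" if "i \<in> I" for i
    using integrable_real_mult_indicator[OF A[OF that] g] by (simp add: mult.commute)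
  have term_le: "- (?p i * ln (?p i)) \<le> (\<integral>x. indicator (A i) x * g x \<partial>M) + (q i - ?p i)" if i: "i \<in> I" for i
  proof (cases "?p i > 0")
    case True
    then obtain x where "x \<in> A i" by (metis all_not_in_conv less_irrefl measure_empty)
    then have q: "q i > 0" using qg[OF i True] by blast
    have "ln (q i / ?p i) \<le> q i / ?p i - 1" using q True by (intro ln_le_minus_one) simp
    then have "?p i * ln (q i / ?p i) \<le> ?p i * (q i / ?p i - 1)" using True by (intro mult_left_mono) auto
    also have "\<dots> = q i - ?p i" using True by (simp add: field_simps)
    finally have "?p i * ln (q i) - ?p i * ln (?p i) \<le> q i - ?p i"
      using q True by (simp add: ln_divide_pos right_diff_distrib)
    moreover have "- (?p i * ln (q i)) \<le> (\<integral>x. indicator (A i) x * g x \<partial>M)"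
    proof -
      have "- (?p i * ln (q i)) = (\<integral>x. indicator (A i) x * (- ln (q i)) \<partial>M)"
        using A[OF i] by simp
      also have "\<dots> \<le> (\<integral>x. indicator (A i) x * g x \<partial>M)"
      proof (rule integral_mono[OF _ ind[OF i]])
        have "integrable M (indicator (A i) :: 'a \<Rightarrow> real)"
          using A[OF i] by (intro integrable_real_indicator) (auto simp: emeasure_eq_measure)
        then show "integrable M (\<lambda>x. indicator (A i) x * - ln (q i))"
          by (rule integrable_mult_left)
        show "indicator (A i) x * - ln (q i) \<le> indicator (A i) x * g x" for x
          using qg[OF i True, of x] by (auto simp: indicator_def)
      qed
      finally show ?thesis .
    qed
    ultimately show ?thesis by linarith
  next
    case False
    then have p0: "?p i = 0" using measure_nonneg[of M "A i"] by linarith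
    have "emeasure M (A i) = 0" using p0 by (simp add: emeasure_eq_measure)
    then have "AE x in M. x \<notin> A i" using A[OF i] by (intro AE_not_in) (auto simp: null_sets_def)
    then have "(\<integral>x. indicator (A i) x * g x \<partial>M) = (\<integral>x. 0 \<partial>M)"
      using A[OF i] borel_measurable_integrable[OF ind[OF i]]
      by (intro integral_cong_AE) (auto elim!: eventually_mono)
    then show ?thesis using p0 q0[OF i] by simp
  qed
  have "- (\<Sum>i\<in>I. ?p i * ln (?p i)) \<le> (\<Sum>i\<in>I. (\<integral>x. indicator (A i) x * g x \<partial>M) + (q i - ?p i))"
    unfolding sum_negf[symmetric] using term_le by (rule sum_mono)
  also have "\<dots> = (\<Sum>i\<in>I. (\<integral>x. indicator (A i) x * g x \<partial>M)) + (sum q I - sum ?p I)"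
    by (simp add: sum.distrib sum_subtractf)
  also have "sum ?p I = 1"
    using finite_measure_finite_Union[OF I _ disj] A prob_space un by auto
  also have "(\<Sum>i\<in>I. (\<integral>x. indicator (A i) x * g x \<partial>M)) = (\<integral>x. (\<Sum>i\<in>I. indicator (A i) x * g x) \<partial>M)"
    using ind by (intro Bochner_Integration.integral_sum[symmetric])
  also have "\<dots> = (\<integral>x. g x \<partial>M)"
  proof (rule Bochner_Integration.integral_cong)
    fix x assume "x \<in> space M"
    then obtain i where i: "i \<in> I" "x \<in> A i" using un by auto
    have "(\<Sum>i\<in>I. indicator (A i) x * g x) = (\<Sum>j\<in>I. if j = i then g x else 0)"
      using disj i by (intro sum.cong) (auto simp: disjoint_family_on_def indicator_def)
    then show "(\<Sum>i\<in>I. indicator (A i) x * g x) = g x" using I i by simp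
  qed simp
  finally show ?thesis using q1 by simp
qed

lemma shift_1_funpow: "(shift 1 ^^ i) x = shift (int i) x"
  by (induction i) (simp_all add: add_ac)

context invariant_measure
begin

definition joint :: "nat \<Rightarrow> (nat \<Rightarrow> (int \<Rightarrow> 'a) set) \<Rightarrow> (int \<Rightarrow> 'a) set" where
  "joint n c = {x \<in> X. \<forall>i<n. shift (int i) x \<in> c i}"

text \<open>The sum runs over names, that is over a product set, and not over cells; this allows
  sums of product weights to be factored.\<close>

definition joint_entropy :: "(int \<Rightarrow> 'a) set set \<Rightarrow> nat \<Rightarrow> real" where
  "joint_entropy \<xi> n = - (\<Sum>c\<in>PiE {..<n} (\<lambda>_. \<xi>). prob (joint n c) * ln (prob (joint n c)))"

end

locale invariant_partition = invariant_measure +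
  fixes \<xi> :: "(int \<Rightarrow> 'a) set set"
  assumes \<xi>: "\<xi> \<in> finite_partitions \<nu>"
begin

lemma \<xi>_finite: "finite \<xi>" and \<xi>_sets: "C \<in> \<xi> \<Longrightarrow> C \<in> sets \<nu>" and \<xi>_part: "partition_on X \<xi>"
  using \<xi> by (auto simp: finite_partitions_def space_eq)

lemma \<xi>_disjoint: "C \<in> \<xi> \<Longrightarrow> C' \<in> \<xi> \<Longrightarrow> x \<in> C \<Longrightarrow> x \<in> C' \<Longrightarrow> C = C'"
  using \<xi>_part unfolding partition_on_def disjoint_def by blast

lemma \<xi>_cover: "x \<in> X \<Longrightarrow> \<exists>C\<in>\<xi>. x \<in> C"
  using \<xi>_part unfolding partition_on_def by blast

lemma \<xi>_nonempty: "\<xi> \<noteq> {}"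
  using \<xi>_cover X_nonempty by blast

lemma joint_sets:
  assumes "\<And>i. i < n \<Longrightarrow> c i \<in> \<xi>"
  shows "joint n c \<in> sets \<nu>"
proof -
  have "joint n c = {x \<in> space \<nu>. \<forall>i\<in>{..<n}. shift (int i) x \<in> c i}"
    by (auto simp: joint_def space_eq)
  also have "\<dots> \<in> sets \<nu>"
  proof (rule sets.sets_Collect_finite_All)
    fix i assume "i \<in> {..<n}"
    then have "shift (int i) -` c i \<inter> space \<nu> \<in> sets \<nu>"
      using assms \<xi>_sets by (intro measurable_sets[OF measurable_shift]) auto
    then show "{x \<in> space \<nu>. shift (int i) x \<in> c i} \<in> sets \<nu>"
      by (simp add: vimage_def Int_def conj_commute)
  qed simp
  finally show ?thesis .
qed

lemma joint_eq_iff: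
  assumes "x \<in> joint n c" "c \<in> PiE {..<n} (\<lambda>_. \<xi>)" "x \<in> joint n c'" "c' \<in> PiE {..<n} (\<lambda>_. \<xi>)"
  shows "c = c'"
proof (rule PiE_ext[OF assms(2,4)])
  fix i assume i: "i \<in> {..<n}"
  show "c i = c' i"
    by (rule \<xi>_disjoint[of _ _ "shift (int i) x"]) (use assms i in \<open>auto simp: joint_def\<close>)
qed

lemma joint_disjoint: "disjoint_family_on (joint n) (PiE {..<n} (\<lambda>_. \<xi>))"
  unfolding disjoint_family_on_def using joint_eq_iff by blast

lemma joint_cover: "(\<Union>c\<in>PiE {..<n} (\<lambda>_. \<xi>). joint n c) = X"
proof (intro equalityI subsetI)
  fix x assume x: "x \<in> X"
  define c where "c = (\<lambda>i\<in>{..<n}. SOME C. C \<in> \<xi> \<and> shift (int i) x \<in> C)"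
  have "c i \<in> \<xi> \<and> shift (int i) x \<in> c i" if "i < n" for i
    using someI_ex[of "\<lambda>C. C \<in> \<xi> \<and> shift (int i) x \<in> C"] \<xi>_cover[OF X_shift[OF x]] that
    by (auto simp: c_def)
  then have "c \<in> PiE {..<n} (\<lambda>_. \<xi>)" "x \<in> joint n c"
    using x by (auto simp: joint_def c_def)
  then show "x \<in> (\<Union>c\<in>PiE {..<n} (\<lambda>_. \<xi>). joint n c)" by blast
qed (auto simp: joint_def)

lemma finite_joint_index: "finite (PiE {..<n::nat} (\<lambda>_. \<xi>))"
  using \<xi>_finite by (intro finite_PiE) auto

text \<open>Empty cells contribute \<open>0 * ln 0 = 0\<close>, and a nonempty cell determines its
  name. Hence the set of cells, in which all empty ones coincide, and the family of names give the
  same entropy.\<close>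

lemma joint_entropy_eq:
  "partition_entropy \<nu> (iterated_join \<nu> (shift 1) \<xi> n) = joint_entropy \<xi> n"
proof -
  let ?P = "PiE {..<n} (\<lambda>_. \<xi>)"
  let ?F = "\<lambda>C. prob C * ln (prob C)"
  have join: "iterated_join \<nu> (shift 1) \<xi> n = joint n ` ?P"
  proof (intro equalityI subsetI)
    fix S assume "S \<in> iterated_join \<nu> (shift 1) \<xi> n"
    then obtain c where c: "\<forall>i<n. c i \<in> \<xi>" "S = joint n c"
      by (auto simp: iterated_join_def joint_def space_eq shift_1_funpow)
    have "joint n c = joint n (restrict c {..<n})" by (auto simp: joint_def)
    then show "S \<in> joint n ` ?P" using c by (intro image_eqI[of _ _ "restrict c {..<n}"]) auto
  next
    fix S assume "S \<in> joint n ` ?P"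
    then obtain c where c: "c \<in> ?P" "S = joint n c" by blast
    then have "\<forall>i<n. c i \<in> \<xi>" by auto
    then show "S \<in> iterated_join \<nu> (shift 1) \<xi> n"
      unfolding iterated_join_def c(2) by (auto simp: joint_def space_eq shift_1_funpow intro!: exI[of _ c])
  qed
  have "(\<Sum>C\<in>joint n ` ?P. ?F C) = (\<Sum>C\<in>joint n ` {c \<in> ?P. joint n c \<noteq> {}}. ?F C)"
    using finite_joint_index by (intro sum.mono_neutral_right) auto
  also have "\<dots> = (\<Sum>c\<in>{c \<in> ?P. joint n c \<noteq> {}}. ?F (joint n c))"
  proof (rule sum.reindex_cong[OF _ refl refl])
    show "inj_on (joint n) {c \<in> ?P. joint n c \<noteq> {}}"
      by (rule inj_onI) (use joint_eq_iff in blast)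
  qed
  also have "\<dots> = (\<Sum>c\<in>?P. ?F (joint n c))"
    using finite_joint_index by (intro sum.mono_neutral_left) auto
  finally show ?thesis unfolding partition_entropy_def joint_entropy_def join by simp
qed

lemma joint_measure_sum: "(\<Sum>c\<in>PiE {..<n} (\<lambda>_. \<xi>). prob (joint n c)) = 1"
proof -
  have "prob (\<Union>c\<in>PiE {..<n} (\<lambda>_. \<xi>). joint n c) = (\<Sum>c\<in>PiE {..<n} (\<lambda>_. \<xi>). prob (joint n c))"
    by (intro finite_measure_finite_Union finite_joint_index joint_disjoint)
      (auto intro!: joint_sets)
  then show ?thesis using prob_space by (simp add: joint_cover space_eq)
qed

lemma joint_entropy_nonneg: "joint_entropy \<xi> n \<ge> 0"
proof -
  have "prob C * ln (prob C) \<le> 0" for C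
  proof (cases "prob C > 0")
    case True
    then show ?thesis using prob_le_1[of C] by (simp add: mult_nonneg_nonpos)
  next
    case False
    then have "prob C = 0" using measure_nonneg[of \<nu> C] by linarith
    then show ?thesis by simp
  qed
  then show ?thesis unfolding joint_entropy_def by (simp add: sum_nonpos)
qed

lemma joint_gibbs:
  assumes "\<And>c. c \<in> PiE {..<n} (\<lambda>_. \<xi>) \<Longrightarrow> q c \<ge> 0" "sum q (PiE {..<n} (\<lambda>_. \<xi>)) \<le> 1"
    and "\<And>c x. c \<in> PiE {..<n} (\<lambda>_. \<xi>) \<Longrightarrow> prob (joint n c) > 0 \<Longrightarrow> x \<in> joint n c \<Longrightarrow>
      q c > 0 \<and> - ln (q c) \<le> g x"
    and "integrable \<nu> g"
  shows "joint_entropy \<xi> n \<le> (\<integral>x. g x \<partial>\<nu>)"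
  unfolding joint_entropy_def
proof (rule entropy_gibbs_inequality[where q = q and A = "joint n", OF finite_joint_index _ joint_disjoint])
  show "joint n c \<in> sets \<nu>" if "c \<in> PiE {..<n} (\<lambda>_. \<xi>)" for c
    using that by (intro joint_sets) auto
  show "(\<Union>c\<in>PiE {..<n} (\<lambda>_. \<xi>). joint n c) = space \<nu>"
    by (simp add: joint_cover space_eq)
qed (fact assms)+

text \<open>The Gibbs inequality, with the product of the probabilities of the initial name of
  length \<open>m\<close> and of the final name of length \<open>n\<close> as comparison weight; by
  invariance the final name has the same mean information as an initial one of its length.\<close>

lemma joint_entropy_subadditive:
  "joint_entropy \<xi> (m + n) \<le> joint_entropy \<xi> m + joint_entropy \<xi> n"
proof -
  let ?P = "\<lambda>n. PiE {..<n} (\<lambda>_. \<xi>)"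
  define p where "p n c = prob (joint n c)" for n c
  \<comment> \<open>The information function of the partition into names of length \<open>n\<close>;
    its integral is the joint entropy.\<close>
  define G where "G n x = (\<Sum>c\<in>?P n. indicator (joint n c) x * (- ln (p n c)))" for n x
  have jm: "joint n c \<in> sets \<nu>" if "c \<in> ?P n" for n c using that by (intro joint_sets) auto
  have int_c: "integrable \<nu> (\<lambda>x. indicator (joint n c) x * (- ln (p n c)))" if "c \<in> ?P n" for n c
    using integrable_real_indicator[of "joint n c" \<nu>] jm[OF that]
    by (intro integrable_mult_left) (auto simp: emeasure_eq_measure)
  have int: "integrable \<nu> (G n)" for n
    unfolding G_def[abs_def] using int_c by (intro Bochner_Integration.integrable_sum)
  have intG: "(\<integral>x. G n x \<partial>\<nu>) = joint_entropy \<xi> n" for n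
  proof -
    have "(\<integral>x. G n x \<partial>\<nu>) = (\<Sum>c\<in>?P n. \<integral>x. indicator (joint n c) x * (- ln (p n c)) \<partial>\<nu>)"
      unfolding G_def[abs_def] using int_c by (rule Bochner_Integration.integral_sum)
    also have "\<dots> = (\<Sum>c\<in>?P n. - (p n c * ln (p n c)))"
      using jm by (intro sum.cong) (simp_all add: p_def)
    finally show ?thesis by (simp add: joint_entropy_def p_def sum_negf)
  qed
  have G_eq: "G n x = - ln (p n c)" if c: "c \<in> ?P n" and x: "x \<in> joint n c" for n c x
  proof -
    have "G n x = (\<Sum>c'\<in>?P n. if c' = c then - ln (p n c) else 0)"
      unfolding G_def
    proof (rule sum.cong)
      fix c' assume c': "c' \<in> ?P n"
      show "indicator (joint n c') x * (- ln (p n c')) = (if c' = c then - ln (p n c) else 0)"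
      proof (cases "c' = c")
        case True
        then show ?thesis using x by simp
      next
        case False
        then have "x \<notin> joint n c'" using joint_eq_iff[OF _ c' x c] by blast
        then show ?thesis using False by simp
      qed
    qed simp
    then show ?thesis using c finite_joint_index by simp
  qed
  define r where "r c = restrict c {..<m}" for c :: "nat \<Rightarrow> (int \<Rightarrow> 'a) set"
  define s where "s c = (\<lambda>i\<in>{..<n}. c (m + i))" for c :: "nat \<Rightarrow> (int \<Rightarrow> 'a) set"
  have rs: "r c \<in> ?P m" "s c \<in> ?P n" if "c \<in> ?P (m + n)" for c
    using that by (auto simp: r_def s_def)
  have rsj: "x \<in> joint m (r c)" "shift (int m) x \<in> joint n (s c)" if x: "x \<in> joint (m + n) c" for c x
  proof -
    show "x \<in> joint m (r c)" using x by (auto simp: joint_def r_def)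
    have "shift (int i) (shift (int m) x) \<in> c (m + i)" if "i < n" for i
    proof -
      have "\<forall>k<m + n. shift (int k) x \<in> c k" using x by (simp add: joint_def)
      then have "shift (int (m + i)) x \<in> c (m + i)" using that by (meson add_less_cancel_left)
      then show ?thesis by (simp add: add.commute)
    qed
    then show "shift (int m) x \<in> joint n (s c)" using x X_shift by (simp add: joint_def s_def)
  qed
  have "joint_entropy \<xi> (m + n) \<le> (\<integral>x. G m x + G n (shift (int m) x) \<partial>\<nu>)"
  proof (rule joint_gibbs)
    show "0 \<le> p m (r c) * p n (s c)" for c by (simp add: p_def)
    have "(\<Sum>c\<in>?P (m + n). p m (r c) * p n (s c)) \<le> (\<Sum>z\<in>?P m \<times> ?P n. p m (fst z) * p n (snd z))"
    proof (rule sum_le_sum_inj_on[where f = "\<lambda>c. (r c, s c)"])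
      show "inj_on (\<lambda>c. (r c, s c)) (?P (m + n))"
      proof (rule inj_onI)
        fix c c' assume c: "c \<in> ?P (m + n)" "c' \<in> ?P (m + n)" "(r c, s c) = (r c', s c')"
        show "c = c'"
        proof (rule PiE_ext[OF c(1,2)])
          fix i assume i: "i \<in> {..<m + n}"
          have eq: "r c i = r c' i" "s c (i - m) = s c' (i - m)" using c(3) by auto
          show "c i = c' i"
          proof (cases "i < m")
            case True
            then show ?thesis using eq(1) by (simp add: r_def)
          next
            case False
            then have "i - m < n" "m + (i - m) = i" using i by auto
            then show ?thesis using eq(2) by (simp add: s_def)
          qed
        qed
      qed
      show "(\<lambda>c. (r c, s c)) ` ?P (m + n) \<subseteq> ?P m \<times> ?P n" using rs by blast
      show "finite (?P m \<times> ?P n)" using finite_joint_index by blast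
    qed (auto simp: p_def)
    also have "\<dots> = (\<Sum>c\<in>?P m. p m c) * (\<Sum>c\<in>?P n. p n c)"
      by (simp add: sum_product sum.cartesian_product split_def)
    also have "\<dots> = 1" using joint_measure_sum by (simp add: p_def)
    finally show "(\<Sum>c\<in>?P (m + n). p m (r c) * p n (s c)) \<le> 1" .
  next
    fix c x assume c: "c \<in> ?P (m + n)" and pos: "prob (joint (m + n) c) > 0"
      and x: "x \<in> joint (m + n) c"
    have "prob (joint (m + n) c) \<le> p m (r c)"
      unfolding p_def using rsj(1) jm[OF rs(1)[OF c]] by (intro finite_measure_mono) auto
    then have pm: "p m (r c) > 0" using pos by linarith
    have meas: "shift (int m) -` joint n (s c) \<inter> space \<nu> \<in> sets \<nu>"
      using jm[OF rs(2)[OF c]] by (rule measurable_sets[OF measurable_shift])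
    have "prob (joint (m + n) c) \<le> prob (shift (int m) -` joint n (s c) \<inter> space \<nu>)"
      using rsj(2) meas by (intro finite_measure_mono) (auto simp: space_eq joint_def)
    also have "\<dots> = p n (s c)"
      using measure_distr[OF measurable_shift jm[OF rs(2)[OF c]], of "int m"]
      by (simp add: distr_shift p_def)
    finally have pn: "p n (s c) > 0" using pos by linarith
    have "G m x = - ln (p m (r c))" "G n (shift (int m) x) = - ln (p n (s c))"
      using G_eq rs[OF c] rsj[OF x] by auto
    then show "p m (r c) * p n (s c) > 0 \<and>
        - ln (p m (r c) * p n (s c)) \<le> G m x + G n (shift (int m) x)"
      using pm pn by (simp add: ln_mult_pos)
  qed (intro Bochner_Integration.integrable_add int integrable_shift)
  also have "\<dots> = (\<integral>x. G m x \<partial>\<nu>) + (\<integral>x. G n (shift (int m) x) \<partial>\<nu>)"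
    by (intro Bochner_Integration.integral_add int integrable_shift)
  also have "(\<integral>x. G n (shift (int m) x) \<partial>\<nu>) = (\<integral>x. G n x \<partial>\<nu>)"
    using int by (intro integral_shift) auto
  finally show ?thesis by (simp add: intG)
qed

lemma joint_entropy_convergent: "convergent (\<lambda>n. joint_entropy \<xi> n / real n)"
  using joint_entropy_subadditive
  by (rule fekete[where c = 0]) (use joint_entropy_nonneg in auto)

end

context invariant_partition
begin

text \<open>\<open>d\<close> guesses the cell of a point from the coordinates within
  \<open>m\<close>, using cylinder sets \<open>U C\<close> close to the cells; on \<open>X\<close>
  it can err only where some \<open>U C\<close> differs from \<open>C\<close>, which is the set
  \<open>bad\<close>. The guess is defined for every function, so also for words that carry
  \<open>undefined\<close> outside their volume and may not belong to \<open>X\<close>.\<close>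

lemma cylinder_approximation:
  assumes "\<epsilon> > 0"
  obtains m :: nat and d bad where "bad \<in> sets \<nu>" "prob bad \<le> \<epsilon>" "\<And>z. d z \<in> \<xi>"
    "\<And>z z'. (\<And>j. \<bar>j\<bar> \<le> int m \<Longrightarrow> z j = z' j) \<Longrightarrow> d z = d z'"
    "\<And>x. x \<in> X \<Longrightarrow> x \<notin> bad \<Longrightarrow> x \<in> d x"
proof -
  have k: "card \<xi> > 0" using \<xi>_finite \<xi>_nonempty by (simp add: card_gt_0_iff)
  then have "\<epsilon> / real (card \<xi>) > 0" using assms by simp
  then have "\<forall>C\<in>\<xi>. \<exists>m U. cylinder_set X m U \<and> prob (sym_diff C U) < \<epsilon> / real (card \<xi>)"
    using approximable_cylinder \<xi>_sets by blast
  then obtain mc U where U: "\<And>C. C \<in> \<xi> \<Longrightarrow> cylinder_set X (mc C) (U C)"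
      "\<And>C. C \<in> \<xi> \<Longrightarrow> prob (sym_diff C (U C)) < \<epsilon> / real (card \<xi>)" by metis
  define m where "m = Max (mc ` \<xi>)"
  have Um: "cylinder_set X m (U C)" if "C \<in> \<xi>" for C
    using that \<xi>_finite by (intro cylinder_set_mono[OF U(1)]) (auto simp: m_def)
  define bad where "bad = (\<Union>C\<in>\<xi>. sym_diff C (U C))"
  have sd: "sym_diff C (U C) \<in> sets \<nu>" if "C \<in> \<xi>" for C
    using \<xi>_sets[OF that] cylinder_measurable[OF Um[OF that]] by auto
  have bad: "bad \<in> sets \<nu>" unfolding bad_def using sd \<xi>_finite by (intro sets.finite_UN) auto
  have "prob bad \<le> (\<Sum>C\<in>\<xi>. prob (sym_diff C (U C)))"
    unfolding bad_def using sd \<xi>_finite by (intro finite_measure_subadditive_finite) auto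
  also have "\<dots> \<le> of_nat (card \<xi>) * (\<epsilon> / real (card \<xi>))"
    using U(2) by (intro sum_bounded_above less_imp_le)
  also have "\<dots> = \<epsilon>" using k by simp
  finally have mbad: "prob bad \<le> \<epsilon>" .
  \<comment> \<open>Agreement with some point of \<open>U C\<close> replaces membership, so that
    only the coordinates within \<open>m\<close> matter for an arbitrary \<open>z\<close>.\<close>
  define memb where "memb C z \<longleftrightarrow> (\<exists>y\<in>U C. \<forall>j. \<bar>j\<bar> \<le> int m \<longrightarrow> z j = y j)" for C z
  define Q where "Q z C \<longleftrightarrow> C \<in> \<xi> \<and> (memb C z \<or> \<not> (\<exists>C\<in>\<xi>. memb C z))" for z C
  define d where "d z = (SOME C. Q z C)" for z
  have d: "Q z (d z)" for z
    unfolding d_def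
  proof (rule someI_ex)
    show "\<exists>C. Q z C" using \<xi>_nonempty unfolding Q_def by blast
  qed
  show thesis
  proof (rule that[OF bad mbad])
    show "d z \<in> \<xi>" for z using d[of z] by (simp add: Q_def)
    fix z z' :: "int \<Rightarrow> 'a" assume "\<And>j. \<bar>j\<bar> \<le> int m \<Longrightarrow> z j = z' j"
    then have "memb C z \<longleftrightarrow> memb C z'" for C by (simp add: memb_def)
    then have "Q z = Q z'" by (simp add: Q_def fun_eq_iff)
    then show "d z = d z'" by (simp add: d_def)
  next
    fix x assume x: "x \<in> X" "x \<notin> bad"
    obtain C0 where C0: "C0 \<in> \<xi>" "x \<in> C0" using \<xi>_cover x by blast
    then have "x \<in> U C0" using x(2) by (auto simp: bad_def)
    then have "memb C0 x" by (auto simp: memb_def)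
    then have "memb (d x) x" "d x \<in> \<xi>" using d[of x] C0(1) by (auto simp: Q_def)
    then obtain y where y: "y \<in> U (d x)" "\<forall>j. \<bar>j\<bar> \<le> int m \<longrightarrow> x j = y j" by (auto simp: memb_def)
    have cyl: "cylinder_set X m (U (d x))" using Um \<open>d x \<in> \<xi>\<close> .
    then have "y \<in> X" using y(1) by (auto simp: cylinder_set_def)
    then have "x \<in> U (d x)" using cyl y x(1) unfolding cylinder_set_def by blast
    then show "x \<in> d x" using x(2) \<open>d x \<in> \<xi>\<close> by (auto simp: bad_def)
  qed
qed

text \<open>The comparison weights in the Gibbs inequality are those of a word drawn from the finite
  volume Gibbs distribution whose approximate \<open>\<xi>\<close>-name is then perturbed independently at each
  time with probability about \<open>\<delta>\<close>.\<close>

lemma joint_entropy_le_part_fun: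
  assumes obs: "observable X \<psi> M" and meas: "\<psi> \<in> borel_measurable \<nu>"
    and bad: "bad \<in> sets \<nu>" and d\<xi>: "\<And>z. d z \<in> \<xi>"
    and d_local: "\<And>z z'. (\<And>j. \<bar>j\<bar> \<le> int m \<Longrightarrow> z j = z' j) \<Longrightarrow> d z = d z'"
    and d_good: "\<And>x. x \<in> X \<Longrightarrow> x \<notin> bad \<Longrightarrow> x \<in> d x"
    and \<delta>: "0 < \<delta>" "\<delta> < 1"
  shows "joint_entropy \<xi> n \<le> ln (part_fun X \<psi> {- int m..<int n + int m})
    - real (n + 2 * m) * (\<integral>x. \<psi> x \<partial>\<nu>)
    + real n * (- ln (1 - \<delta>) + ln (real (card \<xi>) / \<delta>) * prob bad)"
proof -
  interpret \<psi>: observable X \<psi> M by (rule obs)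
  let ?K = "{- int m..<int n + int m}"
  let ?P = "PiE {..<n} (\<lambda>_. \<xi>)"
  let ?W = "cyl_weight X \<psi> ?K"
  define Z where "Z = part_fun X \<psi> ?K"
  have Z: "Z > 0" unfolding Z_def by (rule \<psi>.part_fun_pos) simp
  have k1: "real (card \<xi>) \<ge> 1"
    using \<xi>_finite \<xi>_nonempty by (simp add: Suc_le_eq card_gt_0_iff)
  \<comment> \<open>Substochastic noise: the guessed cell is kept with weight
    \<open>1 - \<delta>\<close>, and every other one gets \<open>\<delta> / card \<xi> > 0\<close>,
    so that a wrong guess costs the finite amount \<open>b\<close>.\<close>
  define \<kappa> where "\<kappa> D C = (if C = D then 1 - \<delta> else \<delta> / real (card \<xi>))" for C D :: "(int \<Rightarrow> 'a) set"
  have \<kappa>0: "\<kappa> D C > 0" for C D using \<delta> k1 by (simp add: \<kappa>_def)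
  have \<kappa>1: "(\<Sum>C\<in>\<xi>. \<kappa> D C) \<le> 1" if "D \<in> \<xi>" for D
  proof -
    have "(\<Sum>C\<in>\<xi>. \<kappa> D C) = \<kappa> D D + (\<Sum>C\<in>\<xi> - {D}. \<kappa> D C)"
      using \<xi>_finite that by (intro sum.remove)
    also have "(\<Sum>C\<in>\<xi> - {D}. \<kappa> D C) = (\<Sum>C\<in>\<xi> - {D}. \<delta> / real (card \<xi>))"
      by (intro sum.cong) (auto simp: \<kappa>_def)
    also have "\<dots> \<le> (\<Sum>C\<in>\<xi>. \<delta> / real (card \<xi>))"
      using \<xi>_finite \<delta> by (intro sum_mono2) auto
    also have "\<dots> = \<delta>" using k1 by simp
    finally show ?thesis by (simp add: \<kappa>_def)
  qed
  define a where "a = - ln (1 - \<delta>)"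
  define b where "b = ln (real (card \<xi>) / \<delta>)"
  have a0: "a \<ge> 0" using \<delta> by (simp add: a_def)
  have b0: "b \<ge> 0" using \<delta> k1 by (simp add: b_def)
  define q where "q c = (\<Sum>u\<in>J ?K ` X. ?W u / Z * (\<Prod>i<n. \<kappa> (d (shift (int i) u)) (c i)))" for c
  \<comment> \<open>The cost of the word of \<open>x\<close> in the Gibbs distribution, plus
    \<open>a\<close> at each time and \<open>b\<close> more at the times at which the orbit is in
    \<open>bad\<close>.\<close>
  define g where "g x = ln Z - erg_sum \<psi> ?K x + (\<Sum>i<n. a + b * indicator bad (shift (int i) x))" for x
  have i1: "integrable \<nu> (\<lambda>x. \<psi> (shift k x))" for k
    using bounded_integrable[OF meas \<psi>.bound] by (rule integrable_shift)
  have i2: "integrable \<nu> (\<lambda>x. indicator bad (shift k x) :: real)" for k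
    using bad by (intro integrable_shift integrable_real_indicator) (auto simp: emeasure_eq_measure)
  have i3: "integrable \<nu> (erg_sum \<psi> ?K)"
    unfolding erg_sum_def[abs_def] using i1 by (rule Bochner_Integration.integrable_sum)
  have i4: "integrable \<nu> (\<lambda>x. \<Sum>i<n. a + b * indicator bad (shift (int i) x))"
    using i2 by (intro Bochner_Integration.integrable_sum Bochner_Integration.integrable_add
        integrable_mult_right) auto
  have "joint_entropy \<xi> n \<le> (\<integral>x. g x \<partial>\<nu>)"
  proof (rule joint_gibbs)
    show "q c \<ge> 0" for c
      unfolding q_def using Z \<kappa>0
      by (intro sum_nonneg mult_nonneg_nonneg divide_nonneg_nonneg prod_nonneg less_imp_le[OF \<psi>.weight_pos])
        (auto intro: less_imp_le)
    have "sum q ?P = (\<Sum>u\<in>J ?K ` X. \<Sum>c\<in>?P. ?W u / Z * (\<Prod>i<n. \<kappa> (d (shift (int i) u)) (c i)))"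
      unfolding q_def by (rule sum.swap)
    also have "\<dots> = (\<Sum>u\<in>J ?K ` X. ?W u / Z * (\<Prod>i<n. \<Sum>C\<in>\<xi>. \<kappa> (d (shift (int i) u)) C))"
      using \<xi>_finite by (simp add: prod_sum_PiE sum_distrib_left)
    also have "\<dots> \<le> (\<Sum>u\<in>J ?K ` X. ?W u / Z * 1)"
    proof (intro sum_mono mult_left_mono prod_le_1)
      fix u assume "u \<in> J ?K ` X"
      then show "0 \<le> ?W u / Z" using Z \<psi>.weight_pos[of u ?K] by simp
    next
      fix u i
      show "0 \<le> (\<Sum>C\<in>\<xi>. \<kappa> (d (shift (int i) u)) C) \<and> (\<Sum>C\<in>\<xi>. \<kappa> (d (shift (int i) u)) C) \<le> 1"
        by (intro conjI sum_nonneg \<kappa>1 d\<xi> less_imp_le[OF \<kappa>0])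
    qed
    also have "\<dots> = 1" using Z by (simp add: Z_def part_fun_def flip: sum_divide_distrib)
    finally show "sum q ?P \<le> 1" .
  next
    fix c x assume c: "c \<in> ?P" and x: "x \<in> joint n c"
    have xX: "x \<in> X" using x by (simp add: joint_def)
    let ?u = "J ?K x"
    \<comment> \<open>The guess at a time \<open>i < n\<close> reads \<open>m\<close> sites to
      either side; the volume \<open>?K\<close> contains them all.\<close>
    have du: "d (shift (int i) ?u) = d (shift (int i) x)" if "i < n" for i
    proof (rule d_local)
      fix j assume "\<bar>j\<bar> \<le> int m"
      then have "j + int i \<in> ?K" using that by auto
      then show "shift (int i) ?u j = shift (int i) x j" by simp
    qed
    \<comment> \<open>The summand of \<open>q c\<close> that belongs to the word of \<open>x\<close>
      itself, with the supremum replaced by the value at \<open>x\<close>. The other summands are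
      nonnegative and are dropped.\<close>
    define t where "t = exp (erg_sum \<psi> ?K x) / Z * (\<Prod>i<n. \<kappa> (d (shift (int i) x)) (c i))"
    have t0: "t > 0" unfolding t_def using Z \<kappa>0 by (intro mult_pos_pos divide_pos_pos prod_pos) auto
    have "t \<le> ?W ?u / Z * (\<Prod>i<n. \<kappa> (d (shift (int i) ?u)) (c i))"
    proof -
      have "(\<Prod>i<n. \<kappa> (d (shift (int i) ?u)) (c i)) = (\<Prod>i<n. \<kappa> (d (shift (int i) x)) (c i))"
        using du by (intro prod.cong) auto
      then show ?thesis
        unfolding t_def using Z
        by (auto intro!: mult_right_mono divide_right_mono \<psi>.weight_ge[OF xX] prod_nonneg less_imp_le[OF \<kappa>0])
    qed
    also have "\<dots> \<le> q c"
      unfolding q_def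
    proof (rule member_le_sum)
      show "0 \<le> ?W v / Z * (\<Prod>i<n. \<kappa> (d (shift (int i) v)) (c i))" if "v \<in> J ?K ` X - {?u}" for v
        using that Z \<kappa>0 \<psi>.weight_pos[of v ?K]
        by (intro mult_nonneg_nonneg divide_nonneg_nonneg prod_nonneg) (auto intro: less_imp_le)
    qed (use xX in auto)
    finally have tq: "t \<le> q c" .
    have \<kappa>g: "- ln (\<kappa> (d (shift (int i) x)) (c i)) \<le> a + b * indicator bad (shift (int i) x)"
      if i: "i < n" for i
    proof (cases "c i = d (shift (int i) x)")
      case True
      then show ?thesis using b0 by (simp add: \<kappa>_def a_def indicator_def)
    next
      case False
      have "shift (int i) x \<in> bad"
      proof (rule ccontr)
        assume nb: "shift (int i) x \<notin> bad"
        have "c i = d (shift (int i) x)"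
        proof (rule \<xi>_disjoint)
          show "c i \<in> \<xi>" using c i by auto
          show "shift (int i) x \<in> c i" using x i by (simp add: joint_def)
          show "shift (int i) x \<in> d (shift (int i) x)" using d_good[OF X_shift[OF xX] nb] .
        qed (rule d\<xi>)
        then show False using False by simp
      qed
      moreover have "- ln (\<delta> / real (card \<xi>)) = b"
        using \<delta> k1 by (simp add: b_def ln_divide_pos)
      ultimately show ?thesis using False a0 by (simp add: \<kappa>_def)
    qed
    have "- ln (q c) \<le> - ln t" using tq t0 by simp
    also have "ln t = erg_sum \<psi> ?K x - ln Z + (\<Sum>i<n. ln (\<kappa> (d (shift (int i) x)) (c i)))"
    proof -
      have "ln t = ln (exp (erg_sum \<psi> ?K x) / Z) + ln (\<Prod>i<n. \<kappa> (d (shift (int i) x)) (c i))"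
        unfolding t_def using Z \<kappa>0 by (intro ln_mult_pos prod_pos divide_pos_pos) auto
      also have "ln (\<Prod>i<n. \<kappa> (d (shift (int i) x)) (c i)) = (\<Sum>i<n. ln (\<kappa> (d (shift (int i) x)) (c i)))"
        using \<kappa>0 by (intro ln_prod) (auto simp: less_imp_neq[symmetric])
      finally show ?thesis using Z by (simp add: ln_divide_pos)
    qed
    also have "- (erg_sum \<psi> ?K x - ln Z + (\<Sum>i<n. ln (\<kappa> (d (shift (int i) x)) (c i))))
        = ln Z - erg_sum \<psi> ?K x + (\<Sum>i<n. - ln (\<kappa> (d (shift (int i) x)) (c i)))"
      by (simp add: sum_negf)
    also have "\<dots> \<le> g x"
      unfolding g_def using \<kappa>g by (intro add_left_mono sum_mono) auto
    finally show "q c > 0 \<and> - ln (q c) \<le> g x" using tq t0 by simp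
  next
    show "integrable \<nu> g"
      unfolding g_def[abs_def] using i3 i4 by auto
  qed
  also have "(\<integral>x. g x \<partial>\<nu>) = ln Z - (\<integral>x. erg_sum \<psi> ?K x \<partial>\<nu>)
      + (\<integral>x. (\<Sum>i<n. a + b * indicator bad (shift (int i) x)) \<partial>\<nu>)"
  proof -
    have "(\<integral>x. g x \<partial>\<nu>) = (\<integral>x. ln Z - erg_sum \<psi> ?K x \<partial>\<nu>)
        + (\<integral>x. (\<Sum>i<n. a + b * indicator bad (shift (int i) x)) \<partial>\<nu>)"
      unfolding g_def using i3 i4 by (intro Bochner_Integration.integral_add) auto
    also have "(\<integral>x. ln Z - erg_sum \<psi> ?K x \<partial>\<nu>) = (\<integral>x. ln Z \<partial>\<nu>) - (\<integral>x. erg_sum \<psi> ?K x \<partial>\<nu>)"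
      using i3 by (intro Bochner_Integration.integral_diff) auto
    also have "(\<integral>x. ln Z \<partial>\<nu>) = ln Z" using prob_space by simp
    finally show ?thesis .
  qed
  also have "(\<integral>x. erg_sum \<psi> ?K x \<partial>\<nu>) = real (n + 2 * m) * (\<integral>x. \<psi> x \<partial>\<nu>)"
  proof -
    have "(\<integral>x. erg_sum \<psi> ?K x \<partial>\<nu>) = (\<Sum>k\<in>?K. \<integral>x. \<psi> (shift k x) \<partial>\<nu>)"
      unfolding erg_sum_def using i1 by (rule Bochner_Integration.integral_sum)
    also have "\<dots> = (\<Sum>k\<in>?K. \<integral>x. \<psi> x \<partial>\<nu>)" by (simp add: integral_shift[OF meas])
    finally show ?thesis by (simp add: nat_add_distrib)
  qed
  also have "(\<integral>x. (\<Sum>i<n. a + b * indicator bad (shift (int i) x)) \<partial>\<nu>) = real n * (a + b * prob bad)"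
  proof -
    have "(\<integral>x. (\<Sum>i<n. a + b * indicator bad (shift (int i) x)) \<partial>\<nu>)
        = (\<Sum>i<n. \<integral>x. a + b * indicator bad (shift (int i) x) \<partial>\<nu>)"
      using i2 by (intro Bochner_Integration.integral_sum) auto
    also have "\<dots> = (\<Sum>i<n. a + b * prob bad)"
    proof (rule sum.cong)
      fix i
      have "(\<integral>x. a + b * indicator bad (shift (int i) x) \<partial>\<nu>)
          = a + b * (\<integral>x. indicator bad (shift (int i) x) \<partial>\<nu>)"
        using i2 prob_space by simp
      also have "(\<integral>x. indicator bad (shift (int i) x) \<partial>\<nu>) = (\<integral>x. indicator bad x \<partial>\<nu> :: real)"
        using bad by (intro integral_shift) auto
      also have "\<dots> = prob bad" using bad by (simp add: sets.Int_space_eq2)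
      finally show "(\<integral>x. a + b * indicator bad (shift (int i) x) \<partial>\<nu>) = a + b * prob bad" .
    qed simp
    finally show ?thesis by simp
  qed
  finally show ?thesis by (simp add: Z_def a_def b_def)
qed

text \<open>For a fixed radius \<open>m\<close> of the guess the \<open>2 * m\<close> additional
  sites contribute only a constant, which vanishes in the limit of long names; what remains are the
  two error rates, for noise and for wrong guesses.\<close>

lemma entropy_rate_le_pressure:
  assumes obs: "observable X \<psi> M" and meas: "\<psi> \<in> borel_measurable \<nu>"
  shows "lim (\<lambda>n. partition_entropy \<nu> (iterated_join \<nu> (shift 1) \<xi> n) / real n)
    \<le> pressure X \<psi> - (\<integral>x. \<psi> x \<partial>\<nu>)"
proof (rule field_le_epsilon)
  fix r :: real assume r: "r > 0"
  interpret \<psi>: observable X \<psi> M by (rule obs)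
  \<comment> \<open>This makes \<open>- ln (1 - \<delta>) = r / 2\<close>. The order matters:
    \<open>b\<close> is determined by \<open>\<delta>\<close>, and only then is the bad set chosen
    so small that \<open>b * prob bad \<le> r / 2\<close>.\<close>
  define \<delta> where "\<delta> = 1 - exp (- (r / 2))"
  have \<delta>: "0 < \<delta>" "\<delta> < 1" using r by (auto simp: \<delta>_def)
  define b where "b = ln (real (card \<xi>) / \<delta>)"
  have k1: "real (card \<xi>) \<ge> 1"
    using \<xi>_finite \<xi>_nonempty by (simp add: Suc_le_eq card_gt_0_iff)
  have b0: "b \<ge> 0" using \<delta> k1 by (simp add: b_def)
  have "r / (2 * (b + 1)) > 0" using r b0 by simp
  then obtain m d bad where
    bad: "bad \<in> sets \<nu>" "prob bad \<le> r / (2 * (b + 1))" and d: "\<And>z. d z \<in> \<xi>"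
    "\<And>z z'. (\<And>j. \<bar>j\<bar> \<le> int m \<Longrightarrow> z j = z' j) \<Longrightarrow> d z = d z'"
    "\<And>x. x \<in> X \<Longrightarrow> x \<notin> bad \<Longrightarrow> x \<in> d x"
    using cylinder_approximation by metis
  have "b * prob bad \<le> b * (r / (2 * (b + 1)))" using bad(2) b0 by (rule mult_left_mono)
  also have "\<dots> \<le> r / 2" using b0 r by (simp add: field_simps)
  finally have rate: "- ln (1 - \<delta>) + b * prob bad \<le> r" by (simp add: \<delta>_def)
  define I where "I = (\<integral>x. \<psi> x \<partial>\<nu>)"
  define C where "C = ln (part_fun X \<psi> {0..<int (2 * m)}) - real (2 * m) * I"
  have bound: "joint_entropy \<xi> n / real n
      \<le> ln (part_fun X \<psi> {0..<int n}) / real n + C / real n - I + r" if n: "n \<ge> 1" for n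
  proof -
    have "int n + int m = - int m + int (n + 2 * m)" by simp
    then have K: "{- int m..<int n + int m} = {- int m..<- int m + int (n + 2 * m)}" by (rule arg_cong)
    have Zeq: "part_fun X \<psi> {- int m..<int n + int m} = part_fun X \<psi> {0..<int (n + 2 * m)}"
      unfolding K by (rule \<psi>.part_fun_interval)
    have Zpos: "part_fun X \<psi> {0..<int k} > 0" for k by (rule \<psi>.part_fun_pos) simp
    have "ln (part_fun X \<psi> {0..<int (n + 2 * m)})
        \<le> ln (part_fun X \<psi> {0..<int n} * part_fun X \<psi> {0..<int (2 * m)})"
      by (intro ln_mono \<psi>.part_fun_add Zpos)
    also have "\<dots> = ln (part_fun X \<psi> {0..<int n}) + ln (part_fun X \<psi> {0..<int (2 * m)})"
      using Zpos by (intro ln_mult_pos)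
    finally have lnZ: "ln (part_fun X \<psi> {0..<int (n + 2 * m)})
      \<le> ln (part_fun X \<psi> {0..<int n}) + ln (part_fun X \<psi> {0..<int (2 * m)})" .
    have "joint_entropy \<xi> n \<le> ln (part_fun X \<psi> {0..<int (n + 2 * m)})
        - real (n + 2 * m) * I + real n * (- ln (1 - \<delta>) + b * prob bad)"
      unfolding Zeq[symmetric] I_def b_def
      by (rule joint_entropy_le_part_fun[OF obs meas bad(1)]) (fact d \<delta>)+
    also have "\<dots> \<le> ln (part_fun X \<psi> {0..<int n}) + C - real n * I + real n * r"
      using lnZ mult_left_mono[OF rate, of "real n"] by (simp add: C_def algebra_simps)
    finally have "joint_entropy \<xi> n / real n
        \<le> (ln (part_fun X \<psi> {0..<int n}) + C - real n * I + real n * r) / real n"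
      by (rule divide_right_mono) simp
    then show ?thesis using n by (simp add: add_divide_distrib diff_divide_distrib)
  qed
  have "(\<lambda>n. joint_entropy \<xi> n / real n) \<longlonglongrightarrow> lim (\<lambda>n. joint_entropy \<xi> n / real n)"
    using joint_entropy_convergent by (simp add: convergent_LIMSEQ_iff)
  moreover have "(\<lambda>n. ln (part_fun X \<psi> {0..<int n}) / real n + C / real n - I + r)
      \<longlonglongrightarrow> pressure X \<psi> + 0 - I + r"
    by (intro tendsto_add tendsto_diff \<psi>.pressure_tendsto tendsto_const lim_const_over_n)
  ultimately have "lim (\<lambda>n. joint_entropy \<xi> n / real n) \<le> pressure X \<psi> + 0 - I + r"
    by (rule LIMSEQ_le) (use bound in blast)
  then show "lim (\<lambda>n. partition_entropy \<nu> (iterated_join \<nu> (shift 1) \<xi> n) / real n)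
      \<le> pressure X \<psi> - (\<integral>x. \<psi> x \<partial>\<nu>) + r"
    by (simp add: joint_entropy_eq I_def)
qed

end

context invariant_measure
begin

lemma variational_inequality:
  assumes "observable X \<psi> M" "\<psi> \<in> borel_measurable \<nu>"
  shows "ks_entropy \<nu> (shift 1) \<le> ereal (pressure X \<psi> - (\<integral>x. \<psi> x \<partial>\<nu>))"
  unfolding ks_entropy_def
proof (rule SUP_least)
  fix \<xi> assume \<xi>: "\<xi> \<in> finite_partitions \<nu>"
  interpret invariant_partition X \<nu> \<xi> by unfold_locales (rule \<xi>)
  show "ereal (lim (\<lambda>n. partition_entropy \<nu> (iterated_join \<nu> (shift 1) \<xi> n) / real n))
      \<le> ereal (pressure X \<psi> - (\<integral>x. \<psi> x \<partial>\<nu>))"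
    using entropy_rate_le_pressure[OF assms] by simp
qed

end

theorem mainTheorem2:
  fixes X :: "(int \<Rightarrow> 'a::{finite, discrete_topology}) set"
    and \<Phi> :: "int set \<Rightarrow> (int \<Rightarrow> 'a) \<Rightarrow> real"
    and \<nu> :: "(int \<Rightarrow> 'a) measure"
  assumes "irreducible_sofic_shift X"
    and "absolutely_summable_potential X \<Phi>"
    and "equilibrium_measure X (phi \<Phi>) \<nu> \<or> tangent_functional X (phi \<Phi>) \<nu>"
  shows "weak_gibbs_measure X (\<lambda>x. phi \<Phi> x - pressure X (phi \<Phi>)) \<nu>"
proof -
  have shift: "shift j x \<in> X" if "x \<in> X" for j x
    using assms(1) that by (auto simp: irreducible_sofic_shift_def shift_space_def)
  interpret pot: summable_potential X \<Phi>
    using assms(2) shift by unfold_locales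
  have \<nu>: "\<nu> \<in> invariant_measures X"
    using assms(3) by (auto simp: equilibrium_measure_def tangent_functional_def)
  interpret inv: invariant_measure X \<nu>
    using shift \<nu> by unfold_locales
  obtain D :: nat where D: "\<And>x y a b L. x \<in> X \<Longrightarrow> y \<in> X \<Longrightarrow> L \<ge> 2 * D \<Longrightarrow>
    \<exists>x'\<in>X. \<exists>s\<le>D. (\<forall>k. k < a \<or> k \<ge> a + int L \<longrightarrow> x' k = x k) \<and>
      (\<forall>k. int D \<le> k \<and> k < int L - int D \<longrightarrow> x' (a + k) = y (b + k + int s))"
    using irreducible_sofic_filling[OF assms(1)] by blast
  interpret bf: block_filling X "phi \<Phi>" "infsum pot.nm pot.I0" D
    by unfold_locales
      (fact shift inv.X_nonempty pot.phi_bound pot.phi_uniform pot.phi_block_influence D)+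
  have phi_meas: "phi \<Phi> \<in> borel_measurable \<nu>"
    using continuous_on_local[OF pot.phi_uniform] by (rule inv.continuous_measurable)
  have phi_int: "integrable \<nu> (phi \<Phi>)"
    using phi_meas pot.phi_bound by (rule inv.bounded_integrable)
  have "pressure X (phi \<Phi>) + c * measure \<nu> (B X m x0)
      \<le> pressure X (\<lambda>x. phi \<Phi> x + c * of_bool (\<forall>k\<in>Lam m. x k = x0 k))"
    if x0: "x0 \<in> X" for x0 m c
  proof -
    define f :: "(int \<Rightarrow> 'a) \<Rightarrow> real" where "f x = c * of_bool (\<forall>k\<in>Lam m. x k = x0 k)" for x
    have f_cont: "continuous_on X f"
    proof (rule continuous_on_local, intro exI[of _ m] ballI impI)
      fix \<epsilon> :: real and x y :: "int \<Rightarrow> 'a" assume "\<epsilon> > 0" and eq: "\<forall>j. \<bar>j\<bar> \<le> int m \<longrightarrow> x j = y j"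
      have "x k = y k" if "k \<in> Lam m" for k using eq that by (auto simp: Lam_def abs_le_iff)
      then have "f x = f y" by (simp add: f_def)
      then show "\<bar>f x - f y\<bar> \<le> \<epsilon>" using \<open>\<epsilon> > 0\<close> by simp
    qed
    have f_meas: "f \<in> borel_measurable \<nu>" using f_cont by (rule inv.continuous_measurable)
    have f_bound: "\<bar>f x\<bar> \<le> \<bar>c\<bar>" for x by (simp add: f_def)
    have f_int: "integrable \<nu> f" using f_meas f_bound by (rule inv.bounded_integrable)
    have B_eq: "B X m x0 = {x \<in> X. \<forall>k\<in>Lam m. x k = x0 k}" by (auto simp: B_def J_eq_iff)
    have B_sets: "B X m x0 \<in> sets \<nu>"
    proof (rule inv.cylinder_measurable)
      show "cylinder_set X m (B X m x0)"
        unfolding cylinder_set_def B_eq by (auto simp: Lam_def abs_le_iff)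
    qed
    have "(\<integral>x. f x \<partial>\<nu>) = (\<integral>x. c * indicator (B X m x0) x \<partial>\<nu>)"
      by (intro Bochner_Integration.integral_cong) (auto simp: f_def B_eq inv.space_eq indicator_def)
    also have "\<dots> = c * measure \<nu> (B X m x0)"
      using B_sets by (simp add: sets.Int_space_eq2)
    finally have f_integral: "(\<integral>x. f x \<partial>\<nu>) = c * measure \<nu> (B X m x0)" .
    from assms(3) have "pressure X (phi \<Phi>) + (\<integral>x. f x \<partial>\<nu>) \<le> pressure X (\<lambda>x. phi \<Phi> x + f x)"
    proof
      assume "tangent_functional X (phi \<Phi>) \<nu>"
      then show ?thesis using f_cont by (simp add: tangent_functional_def)
    next
      assume "equilibrium_measure X (phi \<Phi>) \<nu>"
      then have eq: "ks_entropy \<nu> (shift 1) + ereal (\<integral>x. phi \<Phi> x \<partial>\<nu>) = ereal (pressure X (phi \<Phi>))"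
        by (simp add: equilibrium_measure_def)
      \<comment> \<open>The inequality at the perturbed function is compared with the equality at
        \<open>phi \<Phi>\<close>. The entropy cancels, which is legitimate because the equality
        forces it to be finite.\<close>
      have "ks_entropy \<nu> (shift 1) \<le> ereal (pressure X (\<lambda>x. phi \<Phi> x + f x) - (\<integral>x. phi \<Phi> x + f x \<partial>\<nu>))"
        using phi_meas f_meas
        by (intro inv.variational_inequality[OF bf.observable_add[OF f_bound]] borel_measurable_add)
      also have "(\<integral>x. phi \<Phi> x + f x \<partial>\<nu>) = (\<integral>x. phi \<Phi> x \<partial>\<nu>) + (\<integral>x. f x \<partial>\<nu>)"
        using phi_int f_int by (rule Bochner_Integration.integral_add)
      finally have le: "ks_entropy \<nu> (shift 1) \<le> ereal (pressure X (\<lambda>x. phi \<Phi> x + f x) -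
          ((\<integral>x. phi \<Phi> x \<partial>\<nu>) + (\<integral>x. f x \<partial>\<nu>)))" .
      have "q + t \<le> p" if "h \<le> ereal (p - (s + t))" "h + ereal s = ereal q"
        for h :: ereal and p q s t :: real
        using that by (cases h) auto
      from this[OF le eq] show ?thesis .
    qed
    then show ?thesis unfolding f_integral by (simp add: f_def)
  qed
  then have "bf.cylinder_tangent \<nu>" by (simp add: bf.cylinder_tangent_def)
  moreover have "borel_prob_on X \<nu>" using \<nu> by (simp add: invariant_measures_def)
  ultimately show ?thesis by (rule bf.weak_gibbs_of_cylinder_tangent)
qed

end
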